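(* Let $r\ge1$, let $G_r=\widetilde{\mathrm{Cliff}}_r\le U(\mathbb C^{2^r})$ be the finite multiqubit Clifford group defined in the context, let $W_r=(\mathbb C^{2^r})_{\mathbb R}$ be the underlying real representation, and $V_r=W_r\oplus W_r$, whose elements are written as $2^r\times2$ complex matrices (the two columns being the two components). Choose two orthonormal vectors $e_1,e_2\in\mathbb C^{2^r}$ and put $M_0=\frac1{\sqrt2}[e_1\ e_2]$. Let $u_1,\dots,u_4\in\mathbb C^2$ be unit vectors such that $[u_1],\dots,[u_4]\in\mathbb C\mathbb P^1$ are the vertices of a regular tetrahedron under the identification $\mathbb C\mathbb P^1\simeq S(E_{\mathbb C})\simeq S^2$, $[u]\mapsto\sqrt2(uu^*-\frac12I_2)$. For any unit vector $w\in W_r$ set $C_j=w\,u_j^*$, $1\le j\le4$. Then the $G_r$-invariant measure $$\mu_r=\frac{2(2^r-1)}{2^{r+1}+1}\,\mu_{G_rM_0}+\frac{3}{4(2^{r+1}+1)}\sum_{j=1}^4\mu_{G_rC_j}$$ is a weighted spherical $5$-design on $S(V_r)=S^{2^{r+2}-1}$, and it attains equality in the optimal correction bound: the total weight of its constituent orbits with nonzero defect is exactly $\frac{d+1}{dn+1}=\frac{3}{2^{r+1}+1}$ (where $d=2$, $n=2^r$). In particular, the ambient dimension tends to infinity with $r$, while this correction-weight optimal completion with the minimum number (four) of correction orbits is governed by the same regular tetrahedron (the normalized defects $\sqrt2(C_j^*C_j-\frac12I_2)=\sqrt2(u_ju_j^*-\frac12I_2)$) in the fixed three-dimensional space $E_{\mathbb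 C}$.
   Context: Clifford group: put $T_r=(\mathbb C^2)^{\otimes r}\cong\mathbb C^{2^r}$. $\widetilde{\mathrm{Cliff}}_r\le U(T_r)$ is the finite group generated by the one-qubit gates $\mathsf H=\frac1{\sqrt2}\begin{pmatrix}1&1\\1&-1\end{pmatrix}$ and $S=\begin{pmatrix}1&0\\0&i\end{pmatrix}$ acting on each individual tensor factor (trivially on the others), the controlled-NOT gates $\mathrm{CNOT}_{jk}|a,b\rangle=|a,a+b\ (\mathrm{mod}\ 2)\rangle$ acting on pairs $(j,k)$ of tensor factors, and the scalar $e^{\pi i/4}I$. $E_{\mathbb C}$ is the $3$-dimensional real space of traceless Hermitian $2\times2$ complex matrices with inner product $\langle B,C\rangle_E=\operatorname{Re}\operatorname{tr}(BC)$. The defect of $M\in S(V_r)$ is $Z(M)=M^*M-\frac12I_2\in E_{\mathbb C}$; it is constant on $G_r$-orbits. $S(V_r)$ is the unit sphere of $V_r$ for the real inner product $\operatorname{Re}\operatorname{tr}(M^*N)$. Optimal correction bound and minimum: for any probability measure $\sum_iw_i\mu_{G_rx_i}$ ($w_i>0$, $x_i\in S(V_r)$, at least one orbit $G_rx_i$ a spherical $2$-design) satisfying $\sum_iw_iZ(x_i)=0$ and $\sum_iw_i\langle B,Z(x_i)\rangle_E\langle C,Z(x_i)\rangle_E=\frac1{2(q+1)}\langle B,C\rangle_E$ for all $B,C\in E_{\mathbb C}$, with $q=\dim_{\mathbb R}W_r=2^{r+1}$, the total weight of the correction orbits (those with nonzero defect) is at least $\frac{3}{2^{r+1}+1}$;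 such a completion is called correction-weight optimal if equality holds, and the minimum number of correction orbits refers to the minimum among correction-weight optimal completions. For finite nonempty $X\subset S(V_r)$, $\mu_X=\frac1{|X|}\sum_{x\in X}\delta_x$. A weighted spherical $t$-design is a finitely supported probability measure on the sphere that integrates every real polynomial of degree at most $t$ to its average under normalized spherical measure; a finite set $X$ is a spherical $t$-design if $\mu_X$ is one. *)

theory Defs
  imports "HOL-Probability.Probability"
begin

section \<open>Complex matrices\<close>

text \<open>
  An \<open>m \<times> n\<close> complex matrix has type \<open>complex ^ 'n ^ 'm\<close>.  As a Euclidean space this type
  carries the real inner product \<open>Re (tr (M\<^sup>* N))\<close>, see \<open>inner_eq_Re_trace\<close> below; so
  \<open>sphere 0 1\<close> is the unit sphere for that inner product.
\<close>

definition conj_transpose :: "complex ^ 'n ^ 'm \<Rightarrow> complex ^ 'm ^ 'n" where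
  "conj_transpose A = (\<chi> i j. cnj (A $ j $ i))"

lemma inner_eq_Re_trace:
  fixes M N :: "complex ^ 'n ^ 'm"
  shows "inner M N = Re (trace (conj_transpose M ** N))"
proof -
  have "inner M N = (\<Sum>i\<in>UNIV. \<Sum>j\<in>UNIV. Re (cnj (M $ i $ j) * N $ i $ j))"
    by (simp add: inner_vec_def inner_complex_def)
  also have "\<dots> = (\<Sum>j\<in>UNIV. \<Sum>i\<in>UNIV. Re (cnj (M $ i $ j) * N $ i $ j))"
    by (rule sum.swap)
  also have "\<dots> = Re (trace (conj_transpose M ** N))"
    by (simp add: trace_def matrix_matrix_mult_def conj_transpose_def)
  finally show ?thesis .
qed

definition hermitian_inner :: "complex ^ 'n \<Rightarrow> complex ^ 'n \<Rightarrow> complex" where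
  "hermitian_inner a b = (\<Sum>i\<in>UNIV. cnj (a $ i) * b $ i)"

text \<open>The rank-one matrix \<open>w u\<^sup>*\<close>.\<close>

definition outer :: "complex ^ 'm \<Rightarrow> complex ^ 'n \<Rightarrow> complex ^ 'n ^ 'm" where
  "outer w u = (\<chi> i j. w $ i * cnj (u $ j))"

definition two_columns :: "complex ^ 'm \<Rightarrow> complex ^ 'm \<Rightarrow> complex ^ 2 ^ 'm" where
  "two_columns a b = (\<chi> i. vector [a $ i, b $ i])"

section \<open>The multiqubit Clifford group\<close>

text \<open>
  The \<open>r\<close> tensor factors are indexed by a finite type \<open>'r\<close> with \<open>r = CARD('r)\<close>, so \<open>r \<ge> 1\<close> is
  arbitrary.  The computational basis of \<open>(\<complex>\<^sup>2)\<^sup>\<otimes>\<^sup>r\<close> is indexed by the bit strings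
  \<open>'r \<Rightarrow> bool\<close> (\<open>False\<close> is \<open>0\<close>, \<open>True\<close> is \<open>1\<close>, addition mod 2 is \<open>\<noteq>\<close>).
\<close>

type_synonym 'r qvec = "complex ^ ('r \<Rightarrow> bool)"
type_synonym 'r qmat = "complex ^ ('r \<Rightarrow> bool) ^ ('r \<Rightarrow> bool)"
type_synonym 'r vspace = "complex ^ 2 ^ ('r \<Rightarrow> bool)"

definition gate_H :: "bool \<Rightarrow> bool \<Rightarrow> complex" where
  "gate_H a b = complex_of_real (1 / sqrt 2) * (if a \<and> b then -1 else 1)"

definition gate_S :: "bool \<Rightarrow> bool \<Rightarrow> complex" where
  "gate_S a b = (if a \<noteq> b then 0 else if a then \<i> else 1)"

definition on_qubit :: "(bool \<Rightarrow> bool \<Rightarrow> complex) \<Rightarrow> 'r::finite \<Rightarrow> 'r qmat" where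
  "on_qubit A j = (\<chi> x y. if \<forall>l. l \<noteq> j \<longrightarrow> x l = y l then A (x j) (y j) else 0)"

definition CNOT :: "'r::finite \<Rightarrow> 'r \<Rightarrow> 'r qmat" where
  "CNOT j k = (\<chi> x y. if x = y(k := (y j \<noteq> y k)) then 1 else 0)"

inductive_set clifford_group :: "('r::finite) qmat set" where
  one: "mat 1 \<in> clifford_group"
| H: "on_qubit gate_H j \<in> clifford_group"
| S: "on_qubit gate_S j \<in> clifford_group"
| CNOT: "j \<noteq> k \<Longrightarrow> CNOT j k \<in> clifford_group"
| scalar: "mat (cis (pi / 4)) \<in> clifford_group"
| mult: "g \<in> clifford_group \<Longrightarrow> h \<in> clifford_group \<Longrightarrow> g ** h \<in> clifford_group"
| inv: "g \<in> clifford_group \<Longrightarrow> matrix_inv g \<in> clifford_group"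

definition clifford_orbit :: "('r::finite) vspace \<Rightarrow> 'r vspace set" where
  "clifford_orbit M = (\<lambda>g. g ** M) ` clifford_group"

definition orbit_measure :: "('r::finite) vspace \<Rightarrow> 'r vspace pmf" where
  "orbit_measure M = pmf_of_set (clifford_orbit M)"

section \<open>Spherical designs\<close>

definition polynomials_deg_le :: "nat \<Rightarrow> ('a::euclidean_space \<Rightarrow> real) set" where
  "polynomials_deg_le t =
    {p. \<exists>(A :: ('a \<Rightarrow> nat) set) c. finite A \<and> (\<forall>\<alpha>\<in>A. (\<Sum>b\<in>Basis. \<alpha> b) \<le> t) \<and>
        p = (\<lambda>x. \<Sum>\<alpha>\<in>A. c \<alpha> * (\<Prod>b\<in>Basis. inner x b ^ \<alpha> b))}"

text \<open>
  Normalized surface measure of the unit sphere, as the cone measure: the image of the uniform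
  distribution on the unit ball under the radial projection \<open>sgn x = x /\<^sub>R norm x\<close>.
\<close>

definition sphere_measure :: "'a::euclidean_space measure" where
  "sphere_measure = distr (uniform_measure lborel (ball 0 1)) borel sgn"

definition weighted_spherical_design :: "nat \<Rightarrow> 'a::euclidean_space pmf \<Rightarrow> bool" where
  "weighted_spherical_design t \<mu> \<longleftrightarrow>
    finite (set_pmf \<mu>) \<and> set_pmf \<mu> \<subseteq> sphere 0 1 \<and>
    (\<forall>p \<in> polynomials_deg_le t. measure_pmf.expectation \<mu> p = (\<integral>x. p x \<partial>sphere_measure))"

definition spherical_design :: "nat \<Rightarrow> 'a::euclidean_space set \<Rightarrow> bool" where
  "spherical_design t X \<longleftrightarrow>
    finite X \<and> X \<noteq> {} \<and> X \<subseteq> sphere 0 1 \<and> weighted_spherical_design t (pmf_of_set X)"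

section \<open>Defects and completions\<close>

definition E_space :: "(complex ^ 2 ^ 2) set" where
  "E_space = {B. conj_transpose B = B \<and> trace B = 0}"

definition E_inner :: "complex ^ 2 ^ 2 \<Rightarrow> complex ^ 2 ^ 2 \<Rightarrow> real" where
  "E_inner B C = Re (trace (B ** C))"

definition defect :: "complex ^ 2 ^ 'm \<Rightarrow> complex ^ 2 ^ 2" where
  "defect M = conj_transpose M ** M - mat (1 / 2)"

text \<open>
  The measure \<open>\<Sum>i\<in>I. v i \<mu>(G x\<^sub>i)\<close>, given by its point masses.  The constant \<open>embed_pmf\<close> is
  meaningful because the weights are nonnegative and sum to \<open>1\<close>; see \<open>pmf_orbit_mixture\<close>.
\<close>

definition orbit_mixture ::
  "'i set \<Rightarrow> ('i \<Rightarrow> real) \<Rightarrow> ('i \<Rightarrow> ('r::finite) vspace) \<Rightarrow> 'r vspace pmf" where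
  "orbit_mixture I v x = embed_pmf (\<lambda>M. \<Sum>i\<in>I. v i * pmf (orbit_measure (x i)) M)"

lemma pmf_orbit_mixture:
  assumes "finite I" and nonneg: "\<And>i. i \<in> I \<Longrightarrow> 0 \<le> v i" and one: "(\<Sum>i\<in>I. v i) = 1"
  shows "pmf (orbit_mixture I v x) M = (\<Sum>i\<in>I. v i * pmf (orbit_measure (x i)) M)"
  unfolding orbit_mixture_def
proof (rule pmf_embed_pmf)
  show "0 \<le> (\<Sum>i\<in>I. v i * pmf (orbit_measure (x i)) N)" for N
    by (intro sum_nonneg mult_nonneg_nonneg nonneg) auto
  have "(\<integral>\<^sup>+N. ennreal (\<Sum>i\<in>I. v i * pmf (orbit_measure (x i)) N) \<partial>count_space UNIV)
      = (\<integral>\<^sup>+N. (\<Sum>i\<in>I. ennreal (v i) * ennreal (pmf (orbit_measure (x i)) N)) \<partial>count_space UNIV)"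
  proof (intro nn_integral_cong)
    fix N
    have "ennreal (\<Sum>i\<in>I. v i * pmf (orbit_measure (x i)) N)
        = (\<Sum>i\<in>I. ennreal (v i * pmf (orbit_measure (x i)) N))"
      by (rule sum_ennreal[symmetric]) (simp add: nonneg)
    then show "ennreal (\<Sum>i\<in>I. v i * pmf (orbit_measure (x i)) N)
        = (\<Sum>i\<in>I. ennreal (v i) * ennreal (pmf (orbit_measure (x i)) N))"
      by (simp add: ennreal_mult nonneg cong: sum.cong)
  qed
  also have "\<dots> = (\<Sum>i\<in>I. ennreal (v i) * 1)"
    by (subst nn_integral_sum) (simp_all add: nn_integral_cmult nn_integral_pmf)
  also have "\<dots> = 1"
    by (simp add: sum_ennreal nonneg one)
  finally show "(\<integral>\<^sup>+N. ennreal (\<Sum>i\<in>I. v i * pmf (orbit_measure (x i)) N) \<partial>count_space UNIV) = 1" .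
qed

text \<open>
  The hypotheses of the correction bound for \<open>\<Sum>i\<in>I. v i \<mu>(G x\<^sub>i)\<close>; the constant \<open>q\<close> is the real
  dimension of the representation on column vectors.
\<close>

definition is_completion ::
  "'i set \<Rightarrow> ('i \<Rightarrow> real) \<Rightarrow> ('i \<Rightarrow> ('r::finite) vspace) \<Rightarrow> bool" where
  "is_completion I v x \<longleftrightarrow>
    finite I \<and> (\<forall>i\<in>I. 0 < v i) \<and> (\<Sum>i\<in>I. v i) = 1 \<and> (\<forall>i\<in>I. x i \<in> sphere 0 1) \<and>
    (\<exists>i\<in>I. spherical_design 2 (clifford_orbit (x i))) \<and>
    (\<Sum>i\<in>I. v i *\<^sub>R defect (x i)) = 0 \<and>
    (\<forall>B\<in>E_space. \<forall>C\<in>E_space.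
      (\<Sum>i\<in>I. v i * E_inner B (defect (x i)) * E_inner C (defect (x i)))
        = 1 / (2 * (real DIM('r qvec) + 1)) * E_inner B C)"

definition correction_weight :: "'i set \<Rightarrow> ('i \<Rightarrow> real) \<Rightarrow> ('i \<Rightarrow> ('r::finite) vspace) \<Rightarrow> real" where
  "correction_weight I v x = (\<Sum>i | i \<in> I \<and> defect (x i) \<noteq> 0. v i)"

text \<open>Distinct indices may describe the same orbit; such an orbit is counted once here.\<close>

definition correction_orbits :: "'i set \<Rightarrow> ('i \<Rightarrow> ('r::finite) vspace) \<Rightarrow> 'r vspace set set" where
  "correction_orbits I x = (\<lambda>i. clifford_orbit (x i)) ` {i \<in> I. defect (x i) \<noteq> 0}"

definition weight_optimal ::
  "'i set \<Rightarrow> ('i \<Rightarrow> real) \<Rightarrow> ('i \<Rightarrow> ('r::finite) vspace) \<Rightarrow> bool" where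
  "weight_optimal I v x \<longleftrightarrow>
    is_completion I v x \<and> correction_weight I v x = 3 / (2 ^ (CARD('r) + 1) + 1)"

section \<open>Regular tetrahedra\<close>

text \<open>The identification of the complex projective line with the unit sphere of \<open>E_space\<close>, on unit vectors.\<close>

definition bloch :: "complex ^ 2 \<Rightarrow> complex ^ 2 ^ 2" where
  "bloch u = sqrt 2 *\<^sub>R (outer u u - mat (1 / 2))"

definition regular_tetrahedron :: "'a::euclidean_space set \<Rightarrow> bool" where
  "regular_tetrahedron T \<longleftrightarrow>
    card T = 4 \<and> \<not> affine_dependent T \<and>
    (\<exists>a. \<forall>p\<in>T. \<forall>q\<in>T. p \<noteq> q \<longrightarrow> dist p q = a)"

end

(*
  The scalar e^(i pi/4) kills every moment of an orbit that is not balanced in M and its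
  conjugate, so up to degree 5 only the balanced moments of degree (2,2) matter.  Invariance under
  phase gates, bit flips, CNOT and Hadamard forces such a moment tensor to be a combination of the
  two permutations of tensor factors (the unitary 2-design property), hence the fourth moment of
  Re tr(A^* N) over the orbit of M depends only on tr(Q P) and det Q det P with P = M^* M and
  Q = A^* A.  In terms of the defect of M this is a quadratic polynomial, and the first- and
  second-order conditions on a completion turn its average into a multiple of |A|^4.  By
  polarization, an antipodal measure on the sphere whose fourth moments are c |a|^4 is a 5-design.

  The defects of a completion span the three-dimensional space E and satisfy a linear relation with
  positive coefficients, so there are at least four of them.  The norm of a defect is maximal for
  rank one matrices, which gives the weight bound.
*)
theory Submission
  imports Defs
begin

section \<open>Orthogonal invariance of the spherical measure\<close>

text \<open>A single Clifford orbit is in general not a 5-design: its fourth moment contains det Q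
  det P, and det Q is not a function of |A|. Put P = 1/2 + Z and Q = t/2 + Y with Z, Y traceless and
  t = |A|^2. Averaged over a mixture, the moment is a multiple of t^2 plus a multiple of |Y|^2. If s
  is the constant in sum v <B,Z><C,Z> = s <B,C>, the coefficient of |Y|^2 is, up to a common factor,
  (n + 1/2) s - 1/4, which vanishes exactly for s = 1/(4n + 2) = 1/(2(q + 1)) with q = 2n. This is
  the origin of the constant in the definition of a completion. The trace 3s over E is the mean
  squared defect; no squared defect exceeds 1/2, so the correction weight is at least 6s = 3/(2n +
  1).

  No integral over the sphere is evaluated. Orthogonal invariance makes its fourth moment a multiple
  of |a|^4, and total mass 1 forces the multiple, so any other measure on the sphere with moments of
  this form has the same ones. Finiteness of the group needs a proof because the group is given by
  generators, while orbit measures are uniform on finite sets.\<close>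

lemma nn_integral_lborel_affine:
  fixes f :: "'a::euclidean_space \<Rightarrow> ennreal" and t :: 'a
  assumes [measurable]: "f \<in> borel_measurable borel" and c: "\<bar>c\<bar> = 1"
  shows "(\<integral>\<^sup>+x. f (t + c *\<^sub>R x) \<partial>lborel) = (\<integral>\<^sup>+x. f x \<partial>lborel)"
proof -
  from c have "c \<noteq> 0" by auto
  from lborel_affine[OF this, of t]
  have "(\<integral>\<^sup>+x. f x \<partial>lborel) = (\<integral>\<^sup>+x. f x \<partial>density (distr lborel borel (\<lambda>x. t + c *\<^sub>R x)) (\<lambda>_. \<bar>c\<bar> ^ DIM('a)))"
    by simp
  also have "\<dots> = (\<integral>\<^sup>+x. f (t + c *\<^sub>R x) \<partial>lborel)"
    using c by (simp add: nn_integral_density nn_integral_distr)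
  finally show ?thesis by simp
qed

text \<open>Both sides are the integral of \<open>indicator A x * indicator B (x + y)\<close>, evaluated in either order.\<close>

lemma translation_invariant_measure_unique:
  fixes M :: "'a::euclidean_space measure"
  assumes sets[measurable_cong]: "sets M = sets borel" and "sigma_finite_measure M"
    and inv: "\<And>a. distr M borel (\<lambda>x. a + x) = M"
    and [measurable]: "A \<in> sets borel" "B \<in> sets borel"
  shows "emeasure M A * emeasure lborel B = emeasure M B * emeasure lborel A"
proof -
  interpret M: sigma_finite_measure M by fact
  interpret P: pair_sigma_finite M "lborel :: 'a measure" ..
  have space: "space M = UNIV" using sets_eq_imp_space_eq[OF sets] by simp
  have shift: "(\<integral>\<^sup>+x. f (a + x) \<partial>M) = (\<integral>\<^sup>+x. f x \<partial>M)" if "f \<in> borel_measurable borel" for f a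
    by (subst inv[of a, symmetric], subst nn_integral_distr) (use that in auto)
  have "emeasure M A * emeasure lborel B = (\<integral>\<^sup>+x. indicator A x * emeasure lborel B \<partial>M)"
    by (simp add: nn_integral_multc sets)
  also have "\<dots> = (\<integral>\<^sup>+x. \<integral>\<^sup>+y. indicator A x * indicator B (x + y) \<partial>lborel \<partial>M)"
  proof (rule nn_integral_cong)
    fix x
    show "indicator A x * emeasure lborel B = (\<integral>\<^sup>+y. indicator A x * indicator B (x + y) \<partial>lborel)"
      using nn_integral_lborel_affine[of "indicator B" 1 x] by (simp add: nn_integral_cmult)
  qed
  also have "\<dots> = (\<integral>\<^sup>+y. \<integral>\<^sup>+x. indicator A x * indicator B (x + y) \<partial>M \<partial>lborel)"
    by (rule P.Fubini'[symmetric, of "\<lambda>x y. indicator A x * indicator B (x + y)"]) measurable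
  also have "\<dots> = (\<integral>\<^sup>+y. \<integral>\<^sup>+x. indicator A (x - y) * indicator B x \<partial>M \<partial>lborel)"
  proof (rule nn_integral_cong)
    fix y
    show "(\<integral>\<^sup>+x. indicator A x * indicator B (x + y) \<partial>M) = (\<integral>\<^sup>+x. indicator A (x - y) * indicator B x \<partial>M)"
      by (subst shift[of "\<lambda>x. indicator A (x - y) * indicator B x" y, symmetric]) (auto simp: add.commute)
  qed
  also have "\<dots> = (\<integral>\<^sup>+x. \<integral>\<^sup>+y. indicator A (x - y) * indicator B x \<partial>lborel \<partial>M)"
    by (rule P.Fubini'[of "\<lambda>x y. indicator A (x - y) * indicator B x"]) measurable
  also have "\<dots> = (\<integral>\<^sup>+x. indicator B x * emeasure lborel A \<partial>M)"
  \<comment> \<open>The map from y to x - y is a reflection followed by a shift, hence the case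
    \<open>c = -1\<close> of the affine lemma.\<close>
  proof (rule nn_integral_cong)
    fix x
    show "(\<integral>\<^sup>+y. indicator A (x - y) * indicator B x \<partial>lborel) = indicator B x * emeasure lborel A"
      using nn_integral_lborel_affine[of "indicator A" "-1" x]
      by (subst nn_integral_multc) (auto simp: mult.commute)
  qed
  also have "\<dots> = emeasure M B * emeasure lborel A"
    by (simp add: nn_integral_multc sets)
  finally show ?thesis .
qed

lemma measurable_orthogonal_transformation:
  fixes T :: "'a::euclidean_space \<Rightarrow> 'a"
  assumes "orthogonal_transformation T"
  shows "T \<in> borel_measurable borel"
  using assms
  by (intro borel_measurable_continuous_onI linear_continuous_on)
     (simp add: orthogonal_transformation_linear linear_linear)

lemma emeasure_ball_pos_finite:
  "emeasure lborel (ball (0::'a::euclidean_space) 1) \<noteq> 0" "emeasure lborel (ball (0::'a) 1) \<noteq> \<infinity>"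
  using content_ball_pos[of 1 "0::'a"] emeasure_lborel_ball_finite[of "0::'a" 1]
  by (auto simp: measure_def)

text \<open>The image measure is again translation invariant, because translating by
  \<open>a\<close> after \<open>T\<close> is \<open>T\<close> after translating by
  \<open>S a\<close>. So it is proportional to Lebesgue measure, and the unit ball, which
  \<open>T\<close> preserves, shows that the factor is 1.\<close>

lemma lborel_distr_orthogonal:
  fixes T :: "'a::euclidean_space \<Rightarrow> 'a"
  assumes T: "orthogonal_transformation T"
  shows "distr lborel borel T = lborel"
proof -
  note [measurable] = measurable_orthogonal_transformation[OF T]
  let ?M = "distr lborel borel T"
  let ?b = "ball (0::'a) 1"
  obtain S where S: "S \<circ> T = id" "T \<circ> S = id" "orthogonal_transformation S"
    using T orthogonal_transformation_bij[OF T] orthogonal_transformation_inv[OF T]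
    by (metis bij_betw_def inj_iff surj_iff)
  note [measurable] = measurable_orthogonal_transformation[OF S(3)]
  have dM: "distr lborel borel (\<lambda>x. a + x) = lborel" for a :: 'a
    by (rule measure_eqI) (use nn_integral_lborel_affine[of "indicator _" 1 a] in
        \<open>auto simp: nn_integral_distr simp flip: nn_integral_indicator\<close>)
  have inv: "distr ?M borel (\<lambda>x. a + x) = ?M" for a
  proof -
    have "distr ?M borel (\<lambda>x. a + x) = distr lborel borel (\<lambda>x. a + T x)"
      by (simp add: distr_distr comp_def)
    also have "(\<lambda>x. a + T x) = T \<circ> (\<lambda>x. S a + x)"
      using S(2) orthogonal_transformation_linear[OF T]
      by (auto simp: fun_eq_iff linear_add)
    also have "distr lborel borel (T \<circ> (\<lambda>x. S a + x)) = distr (distr lborel borel (\<lambda>x. S a + x)) borel T"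
      by (simp add: distr_distr)
    finally show ?thesis by (simp add: dM)
  qed
  have ball: "emeasure ?M ?b = emeasure lborel ?b"
    using orthogonal_transformation_norm[OF T]
    by (simp add: emeasure_distr vimage_def ball_def)
  have sf: "sigma_finite_measure ?M"
  proof (rule sigma_finite_measure.intro, intro exI conjI)
    let ?A = "range (\<lambda>n::nat. ball (0::'a) (real n))"
    show "countable ?A" "?A \<subseteq> sets ?M" by auto
    show "\<Union>?A = space ?M" using reals_Archimedean2 by auto
    show "\<forall>a\<in>?A. emeasure ?M a \<noteq> \<infinity>"
      using orthogonal_transformation_norm[OF T] emeasure_lborel_ball_finite[of "0::'a"]
      by (auto simp: emeasure_distr vimage_def ball_def less_top)
  qed
  show ?thesis
  proof (rule measure_eqI)
    fix A assume "A \<in> sets ?M"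
    then have A: "A \<in> sets borel" by simp
    have "emeasure ?M A * emeasure lborel ?b = emeasure lborel A * emeasure lborel ?b"
      using translation_invariant_measure_unique[OF _ sf inv A, of ?b] by (simp add: ball mult.commute)
    then show "emeasure ?M A = emeasure lborel A"
      using emeasure_ball_pos_finite[where 'a='a]
      by (metis mult_divide_eq_ennreal infinity_ennreal_def)
  qed simp
qed

lemma space_sphere_measure [simp]: "space sphere_measure = UNIV"
  and sets_sphere_measure [simp, measurable_cong]: "sets sphere_measure = sets borel"
  by (simp_all add: sphere_measure_def)

lemma prob_space_sphere_measure: "prob_space (sphere_measure :: 'a::euclidean_space measure)"
  unfolding sphere_measure_def
  by (intro prob_space.prob_space_distr prob_space_uniform_measure emeasure_ball_pos_finite)
     (simp add: borel_measurable_sgn)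

lemma AE_sphere_measure: "AE x in sphere_measure. norm (x::'a::euclidean_space) = 1"
proof -
  have "AE x in lborel. x \<noteq> (0::'a)" by (rule AE_lborel_singleton)
  then show ?thesis unfolding sphere_measure_def
    by (subst AE_distr_iff) (auto intro!: AE_uniform_measureI simp: norm_sgn borel_measurable_sgn)
qed

text \<open>\<open>T\<close> preserves the uniform distribution on the ball and commutes with the
  radial projection \<open>sgn\<close>.\<close>

lemma distr_sphere_measure_orthogonal:
  fixes T :: "'a::euclidean_space \<Rightarrow> 'a"
  assumes T: "orthogonal_transformation T"
  shows "distr sphere_measure borel T = sphere_measure"
proof -
  note [measurable] = measurable_orthogonal_transformation[OF T]
  have lin: "linear T" using T by (rule orthogonal_transformation_linear)
  let ?U = "uniform_measure lborel (ball (0::'a) 1)"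
  have U: "distr ?U borel T = ?U"
  proof (rule measure_eqI)
    fix A assume "A \<in> sets (distr ?U borel T)"
    then have [measurable]: "A \<in> sets borel" by simp
    have "emeasure (distr ?U borel T) A
        = emeasure lborel (ball 0 1 \<inter> (T -` A)) / emeasure lborel (ball (0::'a) 1)"
      using measurable_sets_borel[OF measurable_orthogonal_transformation[OF T], of A]
      by (simp add: emeasure_distr)
    also have "ball 0 1 \<inter> (T -` A) = T -` (ball 0 1 \<inter> A)"
      using orthogonal_transformation_norm[OF T] by auto
    also have "emeasure lborel (T -` (ball 0 1 \<inter> A)) = emeasure (distr lborel borel T) (ball 0 1 \<inter> A)"
      by (simp add: emeasure_distr)
    finally show "emeasure (distr ?U borel T) A = emeasure ?U A"
      by (simp add: lborel_distr_orthogonal[OF T])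
  qed simp
  have "T \<circ> sgn = sgn \<circ> T"
    using orthogonal_transformation_norm[OF T] lin by (auto simp: fun_eq_iff sgn_div_norm linear_scale)
  then have "distr sphere_measure borel T = distr (distr ?U borel T) borel sgn"
    by (simp add: sphere_measure_def distr_distr borel_measurable_sgn)
  then show ?thesis by (simp add: U sphere_measure_def)
qed

section \<open>Moments and designs on the sphere\<close>

lemma orthogonal_transformation_exists_norm_eq:
  fixes a b :: "'a::euclidean_space"
  assumes "norm a = norm b"
  obtains T where "orthogonal_transformation T" "T a = b"
proof (cases "a = b")
  case True
  then show ?thesis using that[of "\<lambda>x. x"] by simp
next
  case False
  \<comment> \<open>the Householder reflection exchanging \<open>a\<close> and \<open>b\<close>\<close>
  define v where "v = a - b"
  define T where "T = (\<lambda>x. x - (2 * (x \<bullet> v) / (v \<bullet> v)) *\<^sub>R v)"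
  have v: "v \<bullet> v \<noteq> 0" using False by (simp add: v_def)
  have "linear T"
    by (rule linearI) (auto simp: T_def algebra_simps add_divide_distrib)
  moreover have "T x \<bullet> T y = x \<bullet> y" for x y
    using v by (simp add: T_def inner_diff_left inner_diff_right inner_commute[of v y] power2_eq_square field_simps)
  ultimately have "orthogonal_transformation T" by (simp add: orthogonal_transformation_def)
  moreover have "v \<bullet> v = 2 * (a \<bullet> v)"
    using assms by (simp add: v_def inner_diff_left inner_diff_right inner_commute norm_eq)
  then have "T a = a - v" using v by (simp add: T_def)
  then have "T a = b" by (simp add: v_def)
  ultimately show ?thesis using that by blast
qed

text \<open>An orthogonal map carries \<open>norm a *\<^sub>R e\<close> to \<open>a\<close>, so the
  moment sees only the length of \<open>a\<close>. The constant is left as an integral and never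
  computed.\<close>

lemma sphere_measure_inner_power:
  fixes a e :: "'a::euclidean_space"
  assumes "norm e = 1"
  shows "(\<integral>x. (a \<bullet> x) ^ k \<partial>sphere_measure) = (\<integral>x. (e \<bullet> x) ^ k \<partial>sphere_measure) * norm a ^ k"
proof -
  obtain T where T: "orthogonal_transformation T" "T (norm a *\<^sub>R e) = a"
    using orthogonal_transformation_exists_norm_eq[of "norm a *\<^sub>R e" a] assms by auto
  note [measurable] = measurable_orthogonal_transformation[OF T(1)]
  have "(\<integral>x. (a \<bullet> x) ^ k \<partial>sphere_measure) = (\<integral>x. (a \<bullet> x) ^ k \<partial>distr sphere_measure borel T)"
    by (simp add: distr_sphere_measure_orthogonal[OF T(1)])
  also have "\<dots> = (\<integral>x. (T (norm a *\<^sub>R e) \<bullet> T x) ^ k \<partial>sphere_measure)"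
    by (subst integral_distr) (auto simp: T(2))
  also have "\<dots> = (\<integral>x. (e \<bullet> x) ^ k * norm a ^ k \<partial>sphere_measure)"
    using T(1) by (simp add: orthogonal_transformation_def power_mult_distrib mult.commute)
  finally show ?thesis by simp
qed

text \<open>Replacing the multi-index by a list with repetitions turns monomials into products of
  linear forms, to which polarization applies.\<close>

lemma monomial_eq_prod_list:
  fixes \<alpha> :: "'a::real_inner \<Rightarrow> nat"
  assumes "finite S"
  obtains l where "length l = (\<Sum>b\<in>S. \<alpha> b)" "\<And>x. (\<Prod>b\<in>S. (x \<bullet> b) ^ \<alpha> b) = (\<Prod>a\<leftarrow>l. a \<bullet> x)"
proof -
  have "\<exists>l. length l = (\<Sum>b\<in>S. \<alpha> b) \<and> (\<forall>x. (\<Prod>b\<in>S. (x \<bullet> b) ^ \<alpha> b) = (\<Prod>a\<leftarrow>l. a \<bullet> x))"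
    using assms
  proof induction
    case empty
    then show ?case by simp
  next
    case (insert b S)
    then obtain l where "length l = (\<Sum>b\<in>S. \<alpha> b)" "\<And>x. (\<Prod>b\<in>S. (x \<bullet> b) ^ \<alpha> b) = (\<Prod>a\<leftarrow>l. a \<bullet> x)"
      by auto
    with insert.hyps show ?case
      by (intro exI[of _ "replicate (\<alpha> b) b @ l"]) (simp add: prod_list_replicate inner_commute)
  qed
  with that show ?thesis by blast
qed

text \<open>Covers the spherical measure and finitely supported measures at once, so that one moment
  computation serves both. Only measurability of the identity is asked, since a pmf carries the
  sigma-algebra of all sets.\<close>

locale sphere_prob_space = prob_space M for M :: "'a::euclidean_space measure" +
  assumes AE_norm: "AE x in M. norm x = 1"
    and measurable_id: "(\<lambda>x. x) \<in> borel_measurable M"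
begin

lemma integrable_continuous:
  fixes f :: "'a \<Rightarrow> real"
  assumes "continuous_on UNIV f"
  shows "integrable M f"
proof -
  have "compact (f ` sphere 0 1)"
    by (intro compact_continuous_image continuous_on_subset[OF assms]) auto
  then obtain B where B: "\<And>x. norm x = 1 \<Longrightarrow> \<bar>f x\<bar> \<le> B"
    by (metis bounded_iff compact_imp_bounded dist_0_norm imageI mem_sphere real_norm_def)
  have "f \<in> borel_measurable M"
    using measurable_compose[OF measurable_id borel_measurable_continuous_onI[OF assms]] .
  moreover have "AE x in M. norm (f x) \<le> B"
    using AE_norm by eventually_elim (simp add: B)
  ultimately show ?thesis by (intro integrable_const_bound)
qed

lemma integral_cong_sphere:
  fixes f g :: "'a \<Rightarrow> real"
  assumes "continuous_on UNIV f" "continuous_on UNIV g" "\<And>x. norm x = 1 \<Longrightarrow> f x = g x"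
  shows "integral\<^sup>L M f = integral\<^sup>L M g"
  using assms AE_norm integrable_continuous[OF assms(1)] integrable_continuous[OF assms(2)]
  by (intro integral_cong_AE) auto

text \<open>Inserting |x|^2 = 1 expresses a moment through moments of degree two higher. In this way
  the total mass determines unknown moment constants.\<close>

lemma integral_mult_norm_sq:
  fixes f :: "'a \<Rightarrow> real"
  assumes "continuous_on UNIV f"
  shows "integral\<^sup>L M f = (\<Sum>d\<in>Basis. \<integral>x. f x * ((d \<bullet> x) * (d \<bullet> x)) \<partial>M)"
proof -
  have "integral\<^sup>L M f = (\<integral>x. (\<Sum>d\<in>Basis. f x * ((d \<bullet> x) * (d \<bullet> x))) \<partial>M)"
  proof (rule integral_cong_sphere)
    fix x :: 'a assume "norm x = 1"
    then have "(\<Sum>d\<in>Basis. (d \<bullet> x) * (d \<bullet> x)) = 1"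
      using euclidean_inner[of x x] by (simp add: norm_eq_sqrt_inner inner_commute)
    then show "f x = (\<Sum>d\<in>Basis. f x * ((d \<bullet> x) * (d \<bullet> x)))"
      by (simp flip: sum_distrib_left)
  qed (intro continuous_intros assms)+
  also have "\<dots> = (\<Sum>d\<in>Basis. \<integral>x. f x * ((d \<bullet> x) * (d \<bullet> x)) \<partial>M)"
    by (intro Bochner_Integration.integral_sum integrable_continuous continuous_intros assms)
  finally show ?thesis .
qed

lemma integral_prod2:
  assumes c: "\<And>a. (\<integral>x. (a \<bullet> x) ^ 2 \<partial>M) = c * norm a ^ 2"
  shows "(\<integral>x. (a \<bullet> x) * (b \<bullet> x) \<partial>M) = (a \<bullet> b) / DIM('a)"
proof -
  have I: "integrable M (\<lambda>x. (v \<bullet> x) ^ 2)" for v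
    by (intro integrable_continuous continuous_intros)
  have *: "(\<integral>x. (a \<bullet> x) * (b \<bullet> x) \<partial>M) = c * (a \<bullet> b)" for a b
  proof -
    have "(\<integral>x. (a \<bullet> x) * (b \<bullet> x) \<partial>M) = (\<integral>x. (((a + b) \<bullet> x) ^ 2 - ((a - b) \<bullet> x) ^ 2) / 4 \<partial>M)"
      by (rule arg_cong[where f = "integral\<^sup>L M"])
         (simp add: fun_eq_iff inner_add_left inner_diff_left power2_eq_square algebra_simps)
    also have "\<dots> = (c * norm (a + b) ^ 2 - c * norm (a - b) ^ 2) / 4"
      by (simp add: I c)
    also have "\<dots> = c * (a \<bullet> b)"
      by (simp add: power2_norm_eq_inner inner_add_left inner_diff_left inner_add_right inner_diff_right
          inner_commute algebra_simps)
    finally show ?thesis .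
  qed
  \<comment> \<open>The case \<open>f = 1\<close> says that the total mass is \<open>c\<close> times
    the dimension, which eliminates \<open>c\<close>.\<close>
  have "1 = (\<Sum>d\<in>Basis. c * ((d::'a) \<bullet> d))"
    using integral_mult_norm_sq[of "\<lambda>_. 1"] by (simp add: prob_space *)
  then have "c * DIM('a) = 1" by (simp add: mult.commute)
  then have "c = 1 / DIM('a)" by (simp add: field_simps)
  with * show ?thesis by simp
qed

lemma integral_prod4:
  assumes c: "\<And>a. (\<integral>x. (a \<bullet> x) ^ 4 \<partial>M) = c * norm a ^ 4"
  shows "(\<integral>x. (a \<bullet> x) * (b \<bullet> x) * ((d \<bullet> x) * (e \<bullet> x)) \<partial>M)
      = ((a \<bullet> b) * (d \<bullet> e) + (a \<bullet> d) * (b \<bullet> e) + (a \<bullet> e) * (b \<bullet> d)) / (DIM('a) * (DIM('a) + 2))" (is ?thesis1)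
    and "(\<integral>x. (a \<bullet> x) * (b \<bullet> x) \<partial>M) = (a \<bullet> b) / DIM('a)" (is ?thesis2)
proof -
  have I: "integrable M (\<lambda>x. (v \<bullet> x) ^ 4)" for v
    by (intro integrable_continuous continuous_intros)
  have c': "(\<integral>x. (a \<bullet> x) ^ 4 \<partial>M) = c * (a \<bullet> a) ^ 2" for a
    by (simp add: c flip: power2_norm_eq_inner)
  have *: "(\<integral>x. (a \<bullet> x) * (b \<bullet> x) * ((d \<bullet> x) * (e \<bullet> x)) \<partial>M)
      = c / 3 * ((a \<bullet> b) * (d \<bullet> e) + (a \<bullet> d) * (b \<bullet> e) + (a \<bullet> e) * (b \<bullet> d))" for a b d e
  proof -
    \<comment> \<open>Polarization over the signs of \<open>b\<close>, \<open>d\<close> and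
      \<open>e\<close>: each of the eight fourth powers contributes 4! times the mixed product,
      whence 8 * 24 = 192.\<close>
    have "(\<integral>x. (a \<bullet> x) * (b \<bullet> x) * ((d \<bullet> x) * (e \<bullet> x)) \<partial>M)
      = (\<integral>x. (((a + b + d + e) \<bullet> x) ^ 4 - ((a + b + d - e) \<bullet> x) ^ 4
             - ((a + b - d + e) \<bullet> x) ^ 4 + ((a + b - d - e) \<bullet> x) ^ 4
             - ((a - b + d + e) \<bullet> x) ^ 4 + ((a - b + d - e) \<bullet> x) ^ 4
             + ((a - b - d + e) \<bullet> x) ^ 4 - ((a - b - d - e) \<bullet> x) ^ 4) / 192 \<partial>M)"
      by (rule arg_cong[where f = "integral\<^sup>L M"], rule ext) (simp add: inner_add_left inner_diff_left, algebra)
    also have "\<dots> = (c * ((a + b + d + e) \<bullet> (a + b + d + e)) ^ 2 - c * ((a + b + d - e) \<bullet> (a + b + d - e)) ^ 2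
             - c * ((a + b - d + e) \<bullet> (a + b - d + e)) ^ 2 + c * ((a + b - d - e) \<bullet> (a + b - d - e)) ^ 2
             - c * ((a - b + d + e) \<bullet> (a - b + d + e)) ^ 2 + c * ((a - b + d - e) \<bullet> (a - b + d - e)) ^ 2
             + c * ((a - b - d + e) \<bullet> (a - b - d + e)) ^ 2 - c * ((a - b - d - e) \<bullet> (a - b - d - e)) ^ 2) / 192"
      by (simp add: I c')
    also have "\<dots> = c / 3 * ((a \<bullet> b) * (d \<bullet> e) + (a \<bullet> d) * (b \<bullet> e) + (a \<bullet> e) * (b \<bullet> d))"
      by (simp add: inner_add_left inner_diff_left inner_add_right inner_diff_right
          inner_commute[of b a] inner_commute[of d a] inner_commute[of e a] inner_commute[of d b]
          inner_commute[of e b] inner_commute[of e d], algebra)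
    finally show ?thesis .
  qed
  have sum_basis: "(\<Sum>d\<in>Basis. (a \<bullet> d) * (b \<bullet> d)) = a \<bullet> b" for a b :: 'a
    by (simp add: euclidean_inner[of a b])
  \<comment> \<open>Contracting the last two arguments over the basis gives the second moments, with
    a factor \<open>DIM('a) + 2\<close>. A further contraction, with factor \<open>DIM('a)\<close>,
    gives the total mass.\<close>
  have **: "(\<integral>x. (a \<bullet> x) * (b \<bullet> x) \<partial>M) = c / 3 * (DIM('a) + 2) * (a \<bullet> b)" for a b
  proof -
    have "(\<integral>x. (a \<bullet> x) * (b \<bullet> x) \<partial>M) = (\<Sum>d\<in>Basis. c / 3 * ((a \<bullet> b) * (d \<bullet> d) + (a \<bullet> d) * (b \<bullet> d) + (a \<bullet> d) * (b \<bullet> d)))"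
      by (subst integral_mult_norm_sq) (auto intro!: continuous_intros simp: *)
    also have "\<dots> = c / 3 * (DIM('a) + 2) * (a \<bullet> b)"
      unfolding sum_distrib_left[symmetric] sum.distrib sum_basis by (simp add: algebra_simps)
    finally show ?thesis .
  qed
  have "1 = (\<Sum>d\<in>Basis. c / 3 * (DIM('a) + 2) * ((d::'a) \<bullet> d))"
    using integral_mult_norm_sq[of "\<lambda>_. 1"] by (simp add: prob_space **)
  then have c1: "c / 3 * (DIM('a) + 2) * DIM('a) = 1" by (simp add: ac_simps)
  have "real (DIM('a) * (DIM('a) + 2)) \<noteq> 0"
    unfolding of_nat_eq_0_iff by simp
  with c1 have c3: "c / 3 = 1 / (DIM('a) * (DIM('a) + 2))"
    by (subst nonzero_eq_divide_eq) (auto simp: algebra_simps)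
  show ?thesis1 by (simp add: * c3)
  have "c / 3 * (DIM('a) + 2) = 1 / DIM('a)"
    using c1 by (subst nonzero_eq_divide_eq) auto
  then show ?thesis2 by (simp add: **)
qed

end

lemma sphere_prob_space_sphere_measure: "sphere_prob_space sphere_measure"
  by (intro sphere_prob_space.intro sphere_prob_space_axioms.intro prob_space_sphere_measure AE_sphere_measure)
     auto

lemma sphere_prob_space_measure_pmf:
  "set_pmf \<mu> \<subseteq> sphere 0 1 \<Longrightarrow> sphere_prob_space (measure_pmf \<mu>)"
  by (intro sphere_prob_space.intro sphere_prob_space_axioms.intro prob_space_measure_pmf AE_pmfI) auto

section \<open>Design criteria in terms of moments\<close>

lemma prod_list_inner_minus:
  fixes l :: "'a::real_inner list"
  assumes "odd (length l)"
  shows "(\<Prod>a\<leftarrow>l. a \<bullet> (- x)) = - (\<Prod>a\<leftarrow>l. a \<bullet> x)"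
proof -
  have "(\<Prod>a\<leftarrow>l. a \<bullet> (- x)) = (- 1) ^ length l * (\<Prod>a\<leftarrow>l. a \<bullet> x)"
    by (induction l) (auto simp: algebra_simps)
  then show ?thesis using assms by simp
qed

lemma odd_moment_zero_sphere:
  fixes l :: "'a::euclidean_space list"
  assumes "odd (length l)"
  shows "(\<integral>x. (\<Prod>a\<leftarrow>l. a \<bullet> x) \<partial>sphere_measure) = 0"
proof -
  have T: "orthogonal_transformation (uminus :: 'a \<Rightarrow> 'a)"
    using orthogonal_transformation_neg[of "\<lambda>x. x"] by simp
  have [measurable]: "(\<lambda>x :: 'a. \<Prod>a\<leftarrow>l. a \<bullet> x) \<in> borel_measurable borel"
    by (induction l) auto
  have "(\<integral>x. (\<Prod>a\<leftarrow>l. a \<bullet> x) \<partial>sphere_measure) = (\<integral>x. (\<Prod>a\<leftarrow>l. a \<bullet> x) \<partial>distr sphere_measure borel uminus)"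
    by (simp add: distr_sphere_measure_orthogonal[OF T])
  also have "\<dots> = - (\<integral>x. (\<Prod>a\<leftarrow>l. a \<bullet> x) \<partial>sphere_measure)"
    by (subst integral_distr) (auto simp: prod_list_inner_minus[OF assms] simp del: inner_minus_right)
  finally show ?thesis by simp
qed

lemma odd_moment_zero_pmf:
  fixes l :: "'a::euclidean_space list"
  assumes "odd (length l)" "map_pmf uminus \<mu> = \<mu>"
  shows "measure_pmf.expectation \<mu> (\<lambda>x. \<Prod>a\<leftarrow>l. a \<bullet> x) = 0"
proof -
  have "measure_pmf.expectation \<mu> (\<lambda>x. \<Prod>a\<leftarrow>l. a \<bullet> x)
      = measure_pmf.expectation (map_pmf uminus \<mu>) (\<lambda>x. \<Prod>a\<leftarrow>l. a \<bullet> x)"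
    by (simp add: assms)
  also have "\<dots> = - measure_pmf.expectation \<mu> (\<lambda>x. \<Prod>a\<leftarrow>l. a \<bullet> x)"
    by (simp add: prod_list_inner_minus[OF assms(1)] del: inner_minus_right)
  finally show ?thesis by simp
qed

lemma weighted_spherical_designI:
  fixes \<mu> :: "'a::euclidean_space pmf"
  assumes fin: "finite (set_pmf \<mu>)" and sub: "set_pmf \<mu> \<subseteq> sphere 0 1"
    and mom: "\<And>l :: 'a list. length l \<le> t \<Longrightarrow>
      measure_pmf.expectation \<mu> (\<lambda>x. \<Prod>a\<leftarrow>l. a \<bullet> x) = (\<integral>x. (\<Prod>a\<leftarrow>l. a \<bullet> x) \<partial>sphere_measure)"
  shows "weighted_spherical_design t \<mu>"
  unfolding weighted_spherical_design_def
proof (intro conjI ballI fin sub)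
  interpret P: sphere_prob_space "measure_pmf \<mu>" using sub by (rule sphere_prob_space_measure_pmf)
  interpret S: sphere_prob_space "sphere_measure :: 'a measure" by (rule sphere_prob_space_sphere_measure)
  fix p :: "'a \<Rightarrow> real" assume "p \<in> polynomials_deg_le t"
  then obtain A :: "('a \<Rightarrow> nat) set" and c where A: "finite A" "\<And>\<alpha>. \<alpha> \<in> A \<Longrightarrow> (\<Sum>b\<in>Basis. \<alpha> b) \<le> t"
    and p: "p = (\<lambda>x. \<Sum>\<alpha>\<in>A. c \<alpha> * (\<Prod>b\<in>Basis. (x \<bullet> b) ^ \<alpha> b))"
    by (auto simp: polynomials_deg_le_def)
  have "measure_pmf.expectation \<mu> p
      = (\<Sum>\<alpha>\<in>A. c \<alpha> * measure_pmf.expectation \<mu> (\<lambda>x. \<Prod>b\<in>Basis. (x \<bullet> b) ^ \<alpha> b))"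
    unfolding p by (subst Bochner_Integration.integral_sum)
      (auto intro!: P.integrable_continuous continuous_intros)
  also have "\<dots> = (\<Sum>\<alpha>\<in>A. c \<alpha> * (\<integral>x. (\<Prod>b\<in>Basis. (x \<bullet> b) ^ \<alpha> b) \<partial>sphere_measure))"
  proof (rule sum.cong[OF refl])
    fix \<alpha> assume "\<alpha> \<in> A"
    obtain l where l: "length l = (\<Sum>b\<in>Basis. \<alpha> b)"
      "\<And>x :: 'a. (\<Prod>b\<in>Basis. (x \<bullet> b) ^ \<alpha> b) = (\<Prod>a\<leftarrow>l. a \<bullet> x)"
      using monomial_eq_prod_list[of "Basis :: 'a set" \<alpha>] by auto
    show "c \<alpha> * measure_pmf.expectation \<mu> (\<lambda>x. \<Prod>b\<in>Basis. (x \<bullet> b) ^ \<alpha> b)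
      = c \<alpha> * (\<integral>x. (\<Prod>b\<in>Basis. (x \<bullet> b) ^ \<alpha> b) \<partial>sphere_measure)"
      unfolding l(2) using mom[of l] A(2)[OF \<open>\<alpha> \<in> A\<close>] l(1) by simp
  qed
  also have "\<dots> = (\<integral>x. p x \<partial>sphere_measure)"
    unfolding p by (subst Bochner_Integration.integral_sum)
      (auto intro!: S.integrable_continuous continuous_intros)
  finally show "measure_pmf.expectation \<mu> p = (\<integral>x. p x \<partial>sphere_measure)" .
qed

lemma sphere_measure_inner_power_const:
  obtains c where "\<And>a :: 'a::euclidean_space. (\<integral>x. (a \<bullet> x) ^ k \<partial>sphere_measure) = c * norm a ^ k"
  using sphere_measure_inner_power[OF norm_Basis[OF SOME_Basis], of _ k] by blast

lemma weighted_spherical_design_3I: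
  fixes \<mu> :: "'a::euclidean_space pmf"
  assumes fin: "finite (set_pmf \<mu>)" and sub: "set_pmf \<mu> \<subseteq> sphere 0 1"
    and sym: "map_pmf uminus \<mu> = \<mu>"
    and c: "\<And>a. measure_pmf.expectation \<mu> (\<lambda>x. (a \<bullet> x) ^ 2) = c * norm a ^ 2"
  shows "weighted_spherical_design 3 \<mu>"
proof (rule weighted_spherical_designI[OF fin sub])
  interpret P: sphere_prob_space "measure_pmf \<mu>" using sub by (rule sphere_prob_space_measure_pmf)
  interpret S: sphere_prob_space "sphere_measure :: 'a measure" by (rule sphere_prob_space_sphere_measure)
  obtain c' where c': "\<And>a :: 'a. (\<integral>x. (a \<bullet> x) ^ 2 \<partial>sphere_measure) = c' * norm a ^ 2"
    using sphere_measure_inner_power_const[of 2, where 'a='a] by metis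
  fix l :: "'a list" assume "length l \<le> 3"
  then have "length l = 0 \<or> length l = 1 \<or> length l = 2 \<or> length l = 3"
    by linarith
  then consider "l = []" | "odd (length l)" | "length l = 2"
    by (elim disjE) auto
  then show "measure_pmf.expectation \<mu> (\<lambda>x. \<Prod>a\<leftarrow>l. a \<bullet> x) = (\<integral>x. (\<Prod>a\<leftarrow>l. a \<bullet> x) \<partial>sphere_measure)"
  proof cases
    case 3
    then obtain a b where "l = [a, b]" by (auto simp: numeral_2_eq_2 length_Suc_conv)
    then show ?thesis using P.integral_prod2[OF c, of a b] S.integral_prod2[OF c', of a b] by simp
  qed (simp_all add: odd_moment_zero_sphere odd_moment_zero_pmf sym S.prob_space[simplified])
qed

text \<open>The constants belonging to \<open>\<mu>\<close> and to the spherical measure need not be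
  compared: \<open>integral_prod4\<close> fixes both by normalization. This settles degrees 2 and 4;
  odd degrees vanish by antipodal symmetry.\<close>

lemma weighted_spherical_design_5I:
  fixes \<mu> :: "'a::euclidean_space pmf"
  assumes fin: "finite (set_pmf \<mu>)" and sub: "set_pmf \<mu> \<subseteq> sphere 0 1"
    and sym: "map_pmf uminus \<mu> = \<mu>"
    and c: "\<And>a. measure_pmf.expectation \<mu> (\<lambda>x. (a \<bullet> x) ^ 4) = c * norm a ^ 4"
  shows "weighted_spherical_design 5 \<mu>"
proof (rule weighted_spherical_designI[OF fin sub])
  interpret P: sphere_prob_space "measure_pmf \<mu>" using sub by (rule sphere_prob_space_measure_pmf)
  interpret S: sphere_prob_space "sphere_measure :: 'a measure" by (rule sphere_prob_space_sphere_measure)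
  obtain c' where c': "\<And>a :: 'a. (\<integral>x. (a \<bullet> x) ^ 4 \<partial>sphere_measure) = c' * norm a ^ 4"
    using sphere_measure_inner_power_const[of 4, where 'a='a] by metis
  fix l :: "'a list" assume "length l \<le> 5"
  then have "length l = 0 \<or> length l = 1 \<or> length l = 2 \<or> length l = 3 \<or> length l = 4 \<or> length l = 5"
    by linarith
  then consider "l = []" | "odd (length l)" | "length l = 2" | "length l = 4"
    by (elim disjE) auto
  then show "measure_pmf.expectation \<mu> (\<lambda>x. \<Prod>a\<leftarrow>l. a \<bullet> x) = (\<integral>x. (\<Prod>a\<leftarrow>l. a \<bullet> x) \<partial>sphere_measure)"
  proof cases
    case 3
    then obtain a b where "l = [a, b]" by (auto simp: numeral_2_eq_2 length_Suc_conv)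
    then show ?thesis using P.integral_prod4(2)[OF c, of a b] S.integral_prod4(2)[OF c', of a b] by simp
  next
    case 4
    then obtain a b d e where "l = [a, b, d, e]" by (auto simp: eval_nat_numeral length_Suc_conv)
    then show ?thesis using P.integral_prod4(1)[OF c, of a b d e] S.integral_prod4(1)[OF c', of a b d e]
      by (simp add: mult.assoc)
  qed (simp_all add: odd_moment_zero_sphere odd_moment_zero_pmf sym S.prob_space[simplified])
qed

section \<open>The multiqubit Clifford group is finite\<close>

definition gate_Z :: "bool \<Rightarrow> bool \<Rightarrow> complex" where
  "gate_Z a b = (if a \<noteq> b then 0 else if a then -1 else 1)"

definition gate_X :: "bool \<Rightarrow> bool \<Rightarrow> complex" where
  "gate_X a b = (if a = b then 0 else 1)"

lemma conj_transpose_nth [simp]: "conj_transpose A $ i $ j = cnj (A $ j $ i)"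
  by (simp add: conj_transpose_def)

lemma conj_transpose_mult: "conj_transpose (A ** B) = conj_transpose B ** conj_transpose A"
  by (simp add: vec_eq_iff matrix_matrix_mult_def mult.commute)

lemma conj_transpose_conj_transpose [simp]: "conj_transpose (conj_transpose A) = A"
  by (simp add: vec_eq_iff)

lemma conj_transpose_mat [simp]: "conj_transpose (mat a) = mat (cnj a)"
  by (auto simp: vec_eq_iff mat_def)

lemma on_qubit_mult_nth:
  "(on_qubit A j ** M) $ x $ c = (\<Sum>b\<in>UNIV. A (x j) b * M $ (x(j := b)) $ c)"
proof -
  have "(on_qubit A j ** M) $ x $ c
      = (\<Sum>y\<in>UNIV. (if \<forall>l. l \<noteq> j \<longrightarrow> x l = y l then A (x j) (y j) else 0) * M $ y $ c)"
    by (simp add: matrix_matrix_mult_def on_qubit_def)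
  also have "\<dots> = (\<Sum>y\<in>range (\<lambda>b. x(j := b)). A (x j) (y j) * M $ y $ c)"
  proof (rule sum.mono_neutral_cong_right)
    have "y \<in> range (\<lambda>b. x(j := b))" if "\<forall>l. l \<noteq> j \<longrightarrow> x l = y l" for y
      using that by (intro image_eqI[of _ _ "y j"]) (auto simp: fun_eq_iff)
    then show "\<forall>y\<in>UNIV - range (\<lambda>b. x(j := b)).
        (if \<forall>l. l \<noteq> j \<longrightarrow> x l = y l then A (x j) (y j) else 0) * M $ y $ c = 0"
      by auto
  qed auto
  also have "\<dots> = (\<Sum>b\<in>UNIV. A (x j) b * M $ (x(j := b)) $ c)"
  proof (subst sum.reindex)
    show "inj (\<lambda>b. x(j := b))" by (auto simp: inj_on_def dest: fun_cong[of _ _ j])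
  qed simp
  finally show ?thesis .
qed

lemma CNOT_mult_nth:
  assumes "j \<noteq> k"
  shows "(CNOT j k ** M) $ x $ c = M $ (x(k := (x j \<noteq> x k))) $ c"
proof -
  have "(CNOT j k ** M) $ x $ c = (\<Sum>y\<in>UNIV. (if x = y(k := (y j \<noteq> y k)) then 1 else 0) * M $ y $ c)"
    by (simp add: matrix_matrix_mult_def CNOT_def)
  also have "(\<lambda>y. x = y(k := (y j \<noteq> y k))) = (\<lambda>y. y = x(k := (x j \<noteq> x k)))"
    using assms by (auto simp: fun_eq_iff)
  finally show ?thesis by (simp add: if_distrib[of "\<lambda>a. a * _"] cong: if_cong)
qed

lemma mat_mult_nth: "(mat a ** M) $ x $ c = a * M $ x $ c"
  by (simp add: matrix_matrix_mult_def mat_def if_distrib[of "\<lambda>a. a * _"] cong: if_cong)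

lemma on_qubit_mult: "on_qubit A j ** on_qubit B j = on_qubit (\<lambda>a b. \<Sum>c\<in>UNIV. A a c * B c b) j"
proof -
  { fix x y :: "'a \<Rightarrow> bool"
    have "(on_qubit A j ** on_qubit B j) $ x $ y = on_qubit (\<lambda>a b. \<Sum>c\<in>UNIV. A a c * B c b) j $ x $ y"
    proof (cases "\<forall>l. l \<noteq> j \<longrightarrow> x l = y l")
      case True
      then have *: "\<forall>l. l \<noteq> j \<longrightarrow> (x(j := b)) l = y l" for b by simp
      show ?thesis
        unfolding on_qubit_mult_nth
        by (simp only: on_qubit_def vec_lambda_beta if_P[OF True] if_P[OF *] fun_upd_same)
    next
      case False
      then have *: "\<not> (\<forall>l. l \<noteq> j \<longrightarrow> (x(j := b)) l = y l)" for b by auto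
      show ?thesis
        unfolding on_qubit_mult_nth
        by (simp only: on_qubit_def vec_lambda_beta if_not_P[OF False] if_not_P[OF *]) simp
    qed }
  then show ?thesis by (simp add: vec_eq_iff)
qed

lemma on_qubit_id: "on_qubit (\<lambda>a b. if a = b then 1 else 0) j = mat 1"
  by (simp add: vec_eq_iff on_qubit_def mat_def fun_eq_iff) metis

lemma conj_transpose_on_qubit: "conj_transpose (on_qubit A j) = on_qubit (\<lambda>a b. cnj (A b a)) j"
  by (auto simp: vec_eq_iff on_qubit_def)

lemma sqrt_half_sq: "complex_of_real (1 / sqrt 2) * complex_of_real (1 / sqrt 2) = 1 / 2"
  by (simp flip: of_real_mult)

lemma H_squared: "on_qubit gate_H j ** on_qubit gate_H j = mat 1"
proof -
  have "(\<lambda>a b. \<Sum>c\<in>UNIV. gate_H a c * gate_H c b) = (\<lambda>a b. if a = b then 1 else 0)"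
    using sqrt_half_sq by (auto simp: fun_eq_iff gate_H_def UNIV_bool)
  then show ?thesis by (simp add: on_qubit_mult on_qubit_id)
qed

lemma S_squared: "on_qubit gate_S j ** on_qubit gate_S j = on_qubit gate_Z j"
proof -
  have "(\<lambda>a b. \<Sum>c\<in>UNIV. gate_S a c * gate_S c b) = gate_Z"
    by (auto simp: fun_eq_iff gate_S_def gate_Z_def UNIV_bool)
  then show ?thesis by (simp add: on_qubit_mult)
qed

lemma CNOT_squared:
  assumes "j \<noteq> k"
  shows "CNOT j k ** CNOT j k = mat 1"
  using assms by (auto simp: vec_eq_iff CNOT_mult_nth[OF assms], auto simp: CNOT_def mat_def fun_eq_iff)

lemma conj_transpose_CNOT:
  assumes "j \<noteq> k"
  shows "conj_transpose (CNOT j k) = CNOT j k"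
proof -
  have "(y = x(k := (x j \<noteq> x k))) = (x = y(k := (y j \<noteq> y k)))" for x y :: "'a \<Rightarrow> bool"
    using assms by (auto simp: fun_eq_iff)
  then show ?thesis by (auto simp: vec_eq_iff CNOT_def)
qed

lemma det_scalar_power: "det (mat (cis (pi / 4)) :: complex^'n^'n) ^ 8 = 1"
proof -
  have "cis (pi / 4) ^ 8 = cis (real 8 * (pi / 4))" by (rule Complex.DeMoivre)
  also have "real 8 * (pi / 4) = 2 * pi" by simp
  finally have "cis (pi / 4) ^ 8 = 1" by (simp only: cis_2pi)
  then show ?thesis
    by (simp add: det_diagonal mat_def) (metis mult.commute power_mult power_one)
qed

lemma left_inverse_imp_matrix_inv:
  fixes g :: "complex^'n^'n"
  assumes "h ** g = mat 1"
  shows "matrix_inv g = h" "g ** h = mat 1"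
proof -
  show *: "g ** h = mat 1" using assms matrix_left_right_inverse by blast
  then have "invertible g" using assms by (auto simp: invertible_def)
  then have "matrix_inv g ** g = mat 1"
    unfolding matrix_inv_def invertible_def by (rule someI2_ex) simp
  then show "matrix_inv g = h" using * by (metis matrix_mul_assoc matrix_mul_lid matrix_mul_rid)
qed

lemma clifford_unitary: "g \<in> clifford_group \<Longrightarrow> conj_transpose g ** g = mat 1"
proof (induction rule: clifford_group.induct)
  case (H j)
  have "(\<lambda>a b. cnj (gate_H b a)) = gate_H" by (auto simp: fun_eq_iff gate_H_def)
  then show ?case by (simp add: conj_transpose_on_qubit H_squared)
next
  case (S j)
  have "(\<lambda>a b. \<Sum>c\<in>UNIV. cnj (gate_S c a) * gate_S c b) = (\<lambda>a b. if a = b then 1 else 0)"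
    by (auto simp: fun_eq_iff gate_S_def UNIV_bool)
  then show ?case by (simp add: conj_transpose_on_qubit on_qubit_mult on_qubit_id)
next
  case (CNOT j k)
  then show ?case by (simp add: conj_transpose_CNOT CNOT_squared)
next
  case scalar
  then show ?case
    by (simp add: vec_eq_iff mat_mult_nth) (simp add: mat_def cis_cnj cis_mult)
next
  case (mult g h)
  have "conj_transpose (g ** h) ** (g ** h) = conj_transpose h ** (conj_transpose g ** g) ** h"
    by (simp add: conj_transpose_mult matrix_mul_assoc)
  then show ?case by (simp add: mult.IH)
next
  case (inv g)
  then show ?case
    using left_inverse_imp_matrix_inv[OF inv.IH] by simp
qed simp

lemma clifford_unitary': "g \<in> clifford_group \<Longrightarrow> g ** conj_transpose g = mat 1"
  by (rule left_inverse_imp_matrix_inv(2)[OF clifford_unitary])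

lemma clifford_conj_transpose: "g \<in> clifford_group \<Longrightarrow> conj_transpose g \<in> clifford_group"
  using left_inverse_imp_matrix_inv(1)[OF clifford_unitary] clifford_group.inv by metis

text \<open>The determinants of the generators have orders dividing 2 (H and CNOT), 4 (S) and 8 (the
  scalar). The bound limits which scalar matrices the group can contain.\<close>

lemma clifford_det_power: "g \<in> clifford_group \<Longrightarrow> det g ^ 8 = 1"
proof (induction rule: clifford_group.induct)
  case (H j)
  have "det (on_qubit gate_H j) ^ 2 = 1"
    using arg_cong[OF H_squared[of j], of det] by (simp add: det_mul power2_eq_square)
  then have "(det (on_qubit gate_H j) ^ 2) ^ 4 = 1" by simp
  then show ?case by (simp flip: power_mult)
next
  case (S j)
  have "(\<lambda>a b. \<Sum>c\<in>UNIV. gate_Z a c * gate_Z c b) = (\<lambda>a b. if a = b then 1 else 0)"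
    by (auto simp: fun_eq_iff gate_Z_def UNIV_bool)
  then have "det (on_qubit gate_S j ** on_qubit gate_S j ** (on_qubit gate_S j ** on_qubit gate_S j)) = 1"
    unfolding S_squared unfolding on_qubit_mult by (simp only: on_qubit_id det_I)
  then have "det (on_qubit gate_S j) ^ 4 = 1" by (simp add: det_mul power4_eq_xxxx mult.assoc)
  then have "(det (on_qubit gate_S j) ^ 4) ^ 2 = 1" by simp
  then show ?case by (simp flip: power_mult)
next
  case (CNOT j k)
  then have "det (CNOT j k) ^ 2 = 1"
    using arg_cong[OF CNOT_squared[of j k], of det] by (simp add: det_mul power2_eq_square)
  then have "(det (CNOT j k) ^ 2) ^ 4 = 1" by simp
  then show ?case by (simp flip: power_mult)
next
  case scalar
  then show ?case by (rule det_scalar_power)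
next
  case (mult g h)
  then show ?case by (simp add: det_mul power_mult_distrib)
next
  case (inv g)
  have "det (matrix_inv g) * det g = 1"
    using clifford_unitary[OF inv.hyps] left_inverse_imp_matrix_inv(1)[OF clifford_unitary[OF inv.hyps]]
    by (metis det_I det_mul)
  then have "det (matrix_inv g) ^ 8 * det g ^ 8 = 1" by (metis power_mult_distrib power_one)
  with inv.IH show ?case by simp
qed simp

section \<open>Pauli matrices and their conjugates under Clifford gates\<close>

definition pauli_sign :: "('r::finite \<Rightarrow> bool) \<Rightarrow> ('r \<Rightarrow> bool) \<Rightarrow> complex" where
  "pauli_sign b y = (\<Prod>l\<in>UNIV. if b l \<and> y l then -1 else 1)"

definition bit_add :: "('r \<Rightarrow> bool) \<Rightarrow> ('r \<Rightarrow> bool) \<Rightarrow> 'r \<Rightarrow> bool" where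
  "bit_add x a = (\<lambda>l. x l \<noteq> a l)"

text \<open>This is s X^a Z^b: the character (-1)^(b.y) acts first, then the shift by
  \<open>a\<close>.\<close>

definition pauli :: "complex \<Rightarrow> ('r::finite \<Rightarrow> bool) \<Rightarrow> ('r \<Rightarrow> bool) \<Rightarrow> 'r qmat" where
  "pauli s a b = (\<chi> x y. if x = bit_add y a then s * pauli_sign b y else 0)"

text \<open>The phases \<open>\<i>\<close> and \<open>-\<i>\<close> occur because conjugation by the
  phase gate takes X to i X Z. With all four phases the set is finite and stable under conjugation
  by the group.\<close>

definition paulis :: "('r::finite) qmat set" where
  "paulis = (\<lambda>(s, a, b). pauli s a b) ` ({1, -1, \<i>, -\<i>} \<times> UNIV)"

lemma finite_paulis: "finite paulis"
  by (simp add: paulis_def)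

lemma pauliI: "s \<in> {1, -1, \<i>, -\<i>} \<Longrightarrow> pauli s a b \<in> paulis"
  unfolding paulis_def by (rule image_eqI[of _ _ "(s, a, b)"]) auto

lemma bit_add_cancel [simp]: "bit_add (bit_add x a) a = x"
  by (auto simp: bit_add_def)

lemma bit_add_eq_iff: "x = bit_add y a \<longleftrightarrow> y = bit_add x a"
  by (metis bit_add_cancel)

lemma pauli_mult_nth: "(pauli s a b ** M) $ x $ c = s * pauli_sign b (bit_add x a) * M $ (bit_add x a) $ c"
  by (simp add: matrix_matrix_mult_def pauli_def bit_add_eq_iff[of x] if_distrib[of "\<lambda>a. a * _"] cong: if_cong)

lemma mult_pauli_nth: "(M ** pauli s a b) $ x $ y = M $ x $ (bit_add y a) * (s * pauli_sign b y)"
  by (simp add: matrix_matrix_mult_def pauli_def if_distrib[of "\<lambda>a. _ * a"] cong: if_cong)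

lemma pauli_sign_split:
  "pauli_sign b y = (if b j \<and> y j then -1 else 1) * (\<Prod>l\<in>UNIV - {j}. if b l \<and> y l then -1 else 1)"
  unfolding pauli_sign_def by (rule prod.remove) auto

lemma pauli_sign_split2:
  "j \<noteq> k \<Longrightarrow> pauli_sign b y = (if b j \<and> y j then -1 else 1) * (if b k \<and> y k then -1 else 1) * 
     (\<Prod>l\<in>UNIV - {j} - {k}. if b l \<and> y l then -1 else 1)"
  unfolding pauli_sign_split[of b y j] mult.assoc
  by (rule arg_cong[where f = "(*) _"], rule prod.remove) auto

text \<open>Hadamard exchanges X and Z on qubit \<open>j\<close>. When both are present, restoring
  the order X before Z costs the sign.\<close>

lemma H_pauli:
  "on_qubit gate_H j ** pauli s a b
    = pauli (s * (if a j \<and> b j then -1 else 1)) (a(j := b j)) (b(j := a j)) ** on_qubit gate_H j"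
proof -
  { fix x y :: "'a \<Rightarrow> bool"
    let ?a = "a(j := b j)" and ?b = "b(j := a j)"
    have "on_qubit gate_H j $ x $ bit_add y a * (s * pauli_sign b y)
      = s * (if a j \<and> b j then -1 else 1) * pauli_sign ?b (bit_add x ?a) * on_qubit gate_H j $ bit_add x ?a $ y"
    proof (cases "\<forall>l. l \<noteq> j \<longrightarrow> x l = (y l \<noteq> a l)")
      case True
      have "(\<Prod>l\<in>UNIV - {j}. if ?b l \<and> bit_add x ?a l then -1 else 1) = (\<Prod>l\<in>UNIV - {j}. if b l \<and> y l then -1 else (1::complex))"
        using True by (intro prod.cong) (auto simp: bit_add_def)
      then show ?thesis
        unfolding pauli_sign_split[of _ _ j] using True
        by (auto simp: on_qubit_def bit_add_def gate_H_def)
    next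
      case False
      then have "\<not> (\<forall>l. l \<noteq> j \<longrightarrow> (x l \<noteq> ?a l) = y l)" by auto
      with False show ?thesis by (auto simp: on_qubit_def bit_add_def)
    qed }
  then show ?thesis by (simp add: vec_eq_iff mult_pauli_nth pauli_mult_nth)
qed

text \<open>The phase gate commutes with Z and takes X to i X Z, so only an X on qubit
  \<open>j\<close> changes anything.\<close>

lemma S_pauli:
  "on_qubit gate_S j ** pauli s a b
    = pauli (if a j then \<i> * s else s) a (b(j := (b j \<noteq> a j))) ** on_qubit gate_S j"
proof -
  { fix x y :: "'a \<Rightarrow> bool"
    let ?b = "b(j := (b j \<noteq> a j))"
    have "on_qubit gate_S j $ x $ bit_add y a * (s * pauli_sign b y)
      = (if a j then \<i> * s else s) * pauli_sign ?b (bit_add x a) * on_qubit gate_S j $ bit_add x a $ y"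
    proof (cases "x = bit_add y a")
      case True
      have "(\<Prod>l\<in>UNIV - {j}. if ?b l \<and> y l then -1 else 1) = (\<Prod>l\<in>UNIV - {j}. if b l \<and> y l then -1 else (1::complex))"
        by (intro prod.cong) auto
      then show ?thesis
        unfolding pauli_sign_split[of _ _ j] using True
        by (auto simp: on_qubit_def gate_S_def) (auto simp: bit_add_def)
    next
      case False
      have "on_qubit gate_S j $ u $ v = 0" if "u \<noteq> v" for u v :: "'a \<Rightarrow> bool"
        using that by (auto simp: on_qubit_def gate_S_def fun_eq_iff)
      with False show ?thesis by (metis bit_add_eq_iff mult_zero_left mult_zero_right)
    qed }
  then show ?thesis by (simp add: vec_eq_iff mult_pauli_nth pauli_mult_nth)
qed

text \<open>X spreads from the control to the target and Z from the target to the control, without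
  any phase.\<close>

lemma CNOT_pauli:
  assumes "j \<noteq> k"
  shows "CNOT j k ** pauli s a b
    = pauli s (a(k := (a j \<noteq> a k))) (b(j := (b j \<noteq> b k))) ** CNOT j k"
proof -
  { fix x y :: "'a \<Rightarrow> bool"
    let ?a = "a(k := (a j \<noteq> a k))" and ?b = "b(j := (b j \<noteq> b k))"
    have "bit_add (y(k := (y j \<noteq> y k))) ?a = (bit_add y a)(k := (bit_add y a j \<noteq> bit_add y a k))"
      by (rule ext) (use assms in \<open>auto simp: bit_add_def\<close>)
    then have iff: "bit_add x ?a = y(k := (y j \<noteq> y k)) \<longleftrightarrow> x = (bit_add y a)(k := (bit_add y a j \<noteq> bit_add y a k))"
      by (metis bit_add_cancel)
    have "CNOT j k $ x $ bit_add y a * (s * pauli_sign b y)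
      = s * pauli_sign ?b (bit_add x ?a) * CNOT j k $ bit_add x ?a $ y"
    proof (cases "bit_add x ?a = y(k := (y j \<noteq> y k))")
      case True
      then have x: "x = (bit_add y a)(k := (bit_add y a j \<noteq> bit_add y a k))"
        by (simp only: iff)
      have "(\<Prod>l\<in>UNIV - {j} - {k}. if ?b l \<and> (y(k := (y j \<noteq> y k))) l then -1 else 1)
          = (\<Prod>l\<in>UNIV - {j} - {k}. if b l \<and> y l then -1 else (1::complex))"
        by (intro prod.cong) auto
      then have "pauli_sign ?b (y(k := (y j \<noteq> y k))) = pauli_sign b y"
        unfolding pauli_sign_split2[OF assms] using assms by auto
      with True x show ?thesis by (simp add: CNOT_def)
    next
      case False
      then have "x \<noteq> (bit_add y a)(k := (bit_add y a j \<noteq> bit_add y a k))"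
        by (simp only: iff not_False_eq_True)
      with False show ?thesis by (simp add: CNOT_def)
    qed }
  then show ?thesis by (simp add: vec_eq_iff mult_pauli_nth pauli_mult_nth)
qed

lemma clifford_normalizes_paulis:
  "g \<in> clifford_group \<Longrightarrow> P \<in> paulis \<Longrightarrow> g ** P ** conj_transpose g \<in> paulis"
proof (induction arbitrary: P rule: clifford_group.induct)
  case one
  then show ?case by simp
next
  case (H j)
  then obtain s a b where P: "P = pauli s a b" "s \<in> {1, -1, \<i>, -\<i>}" by (auto simp: paulis_def)
  show ?case
    unfolding P(1) H_pauli matrix_mul_assoc[symmetric] clifford_unitary'[OF clifford_group.H] matrix_mul_rid
    using P(2) by (intro pauliI) auto
next
  case (S j)
  then obtain s a b where P: "P = pauli s a b" "s \<in> {1, -1, \<i>, -\<i>}" by (auto simp: paulis_def)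
  show ?case
    unfolding P(1) S_pauli matrix_mul_assoc[symmetric] clifford_unitary'[OF clifford_group.S] matrix_mul_rid
    using P(2) by (intro pauliI) auto
next
  case (CNOT j k)
  then obtain s a b where P: "P = pauli s a b" "s \<in> {1, -1, \<i>, -\<i>}" by (auto simp: paulis_def)
  show ?case
    unfolding P(1) CNOT_pauli[OF CNOT(1)] matrix_mul_assoc[symmetric] clifford_unitary'[OF clifford_group.CNOT[OF CNOT(1)]] matrix_mul_rid
    using P(2) by (intro pauliI) auto
next
  case scalar
  have "mat (cis (pi / 4)) ** P ** conj_transpose (mat (cis (pi / 4))) = P ** (mat (cis (pi / 4)) ** conj_transpose (mat (cis (pi / 4))))"
    unfolding matrix_mul_assoc
    by (rule arg_cong[where f = "\<lambda>A. A ** _"])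
       (simp add: vec_eq_iff mat_mult_nth, simp add: matrix_matrix_mult_def mat_def if_distrib[of "\<lambda>a. _ * a"] cong: if_cong)
  then show ?case
    using scalar by (simp only: clifford_unitary'[OF clifford_group.scalar] matrix_mul_rid)
next
  case (mult g h)
  have "g ** h ** P ** conj_transpose (g ** h) = g ** (h ** P ** conj_transpose h) ** conj_transpose g"
    by (simp add: conj_transpose_mult matrix_mul_assoc)
  then show ?case using mult by simp
next
  case (inv g)
  let ?h = "conj_transpose g"
  have gh: "g ** ?h = mat 1" "?h ** g = mat 1"
    using clifford_unitary[OF inv.hyps] clifford_unitary'[OF inv.hyps] by auto
  let ?F = "\<lambda>P. g ** P ** ?h"
  have hF: "?h ** ?F P ** g = P" for P
  proof -
    have "?h ** ?F P ** g = (?h ** g) ** P ** (?h ** g)" by (simp add: matrix_mul_assoc)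
    then show ?thesis by (simp add: gh)
  qed
  \<comment> \<open>Conjugation by \<open>g\<close> injects a finite set into itself, hence is onto,
    so conjugation by the inverse preserves the set too.\<close>
  have "inj_on ?F paulis" by (rule inj_on_inverseI[of _ "\<lambda>Q. ?h ** Q ** g"]) (rule hF)
  moreover have "?F ` paulis \<subseteq> paulis" using inv.IH by auto
  ultimately have "?F ` paulis = paulis" by (simp add: finite_paulis endo_inj_surj)
  then obtain Q where "Q \<in> paulis" "P = ?F Q" using inv.prems by blast
  then have "?h ** P ** g \<in> paulis" using hF by simp
  then show ?case using left_inverse_imp_matrix_inv(1)[OF gh(2)] by simp
qed

text \<open>Commuting with Z on a qubit where two strings differ kills the off-diagonal entry;
  commuting with the shifts equates all diagonal entries.\<close>

lemma commutes_paulis_scalar: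
  assumes "\<And>P. P \<in> paulis \<Longrightarrow> k ** P = P ** k"
  obtains c where "k = mat c"
proof -
  have zero: "k $ x $ y = 0" if xy: "x \<noteq> y" for x y
  proof -
    obtain l where l: "x l \<noteq> y l" using xy by (auto simp: fun_eq_iff)
    let ?b = "\<lambda>i. i = l"
    have s: "pauli_sign ?b z = (if z l then -1 else 1)" for z
      unfolding pauli_sign_split[of _ _ l] by (simp add: prod.neutral)
    have "k ** pauli 1 (\<lambda>_. False) ?b = pauli 1 (\<lambda>_. False) ?b ** k"
      by (intro assms pauliI) simp
    then have "k $ x $ y * (if y l then -1 else 1) = (if x l then -1 else 1) * k $ x $ y"
      by (auto simp: vec_eq_iff mult_pauli_nth pauli_mult_nth bit_add_def s dest!: spec[of _ x] spec[of _ y])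
    then show ?thesis using l by (auto split: if_splits)
  qed
  have const: "k $ x $ x = k $ (\<lambda>_. False) $ (\<lambda>_. False)" for x
  proof -
    have s: "pauli_sign (\<lambda>_. False) z = 1" for z
      by (simp add: pauli_sign_def)
    have "k ** pauli 1 x (\<lambda>_. False) = pauli 1 x (\<lambda>_. False) ** k"
      by (intro assms pauliI) simp
    then have "(k ** pauli 1 x (\<lambda>_. False)) $ x $ (\<lambda>_. False) = (pauli 1 x (\<lambda>_. False) ** k) $ x $ (\<lambda>_. False)"
      by simp
    then show ?thesis by (simp add: mult_pauli_nth pauli_mult_nth bit_add_def s)
  qed
  have "k = mat (k $ (\<lambda>_. False) $ (\<lambda>_. False))"
    by (auto simp: vec_eq_iff mat_def zero) (rule const)
  then show ?thesis by (rule that)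
qed

text \<open>
  An element is determined up to a scalar by its action on the Pauli matrices by conjugation, and the
  scalars in the group are roots of unity because all determinants are.
\<close>

lemma finite_clifford_group: "finite (clifford_group :: ('r::finite) qmat set)"
proof -
  let ?F = "\<lambda>g. restrict (\<lambda>P. g ** P ** conj_transpose g) paulis"
  let ?n = "CARD('r \<Rightarrow> bool)"
  let ?R = "{c::complex. c ^ (?n * 8) = 1}"
  \<comment> \<open>One representative for each action on the Pauli matrices. The group will be
    covered by these representatives times scalars from \<open>?R\<close>.\<close>
  define pick where "pick f = (SOME g. g \<in> clifford_group \<and> ?F g = f)" for f :: "'r qmat \<Rightarrow> 'r qmat"
  have "?F ` clifford_group \<subseteq> paulis \<rightarrow>\<^sub>E paulis"
    using clifford_normalizes_paulis by auto
  then have fin: "finite (?F ` clifford_group)"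
    by (rule finite_subset) (simp add: finite_PiE finite_paulis)
  have R: "finite ?R"
    by (rule finite_nth_roots) simp
  have "clifford_group \<subseteq> (\<lambda>(c, f). pick f ** mat c) ` (?R \<times> ?F ` clifford_group)"
  proof
    fix g :: "'r qmat" assume g: "g \<in> clifford_group"
    define h where "h = pick (?F g)"
    have "h \<in> clifford_group \<and> ?F h = ?F g"
      unfolding h_def pick_def by (rule someI[of _ g]) (simp add: g)
    then have h: "h \<in> clifford_group" "?F h = ?F g" by auto
    note u = clifford_unitary[OF g] clifford_unitary'[OF g] clifford_unitary[OF h(1)] clifford_unitary'[OF h(1)]
    define k where "k = conj_transpose h ** g"
    have kG: "k \<in> clifford_group"
      unfolding k_def by (intro clifford_group.mult clifford_conj_transpose g h)
    \<comment> \<open>\<open>g\<close> and its representative \<open>h\<close> conjugate Pauli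
      matrices alike, so their quotient \<open>k\<close> centralizes them.\<close>
    have "k ** P = P ** k" if "P \<in> paulis" for P
    proof -
      have eq: "h ** P ** conj_transpose h = g ** P ** conj_transpose g"
        using fun_cong[OF h(2), of P] that by simp
      have "P ** k = (conj_transpose h ** h) ** P ** (conj_transpose h ** g)"
        by (simp add: u k_def)
      also have "\<dots> = conj_transpose h ** (h ** P ** conj_transpose h) ** g"
        by (simp add: matrix_mul_assoc)
      also have "\<dots> = (conj_transpose h ** g) ** P ** (conj_transpose g ** g)"
        by (simp add: eq matrix_mul_assoc)
      finally show ?thesis by (simp add: u k_def)
    qed
    then obtain c where c: "k = mat c" by (rule commutes_paulis_scalar)
    \<comment> \<open>Since eighth powers of determinants in the group are 1, \<open>c\<close> is a
      root of unity of order dividing 8 times the matrix size.\<close>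
    have "det k = c ^ ?n" unfolding c by (simp add: det_diagonal mat_def)
    then have "c \<in> ?R" using clifford_det_power[OF kG] by (simp add: power_mult)
    moreover have "g = h ** mat c"
      unfolding c[symmetric] k_def matrix_mul_assoc u by simp
    ultimately show "g \<in> (\<lambda>(c, f). pick f ** mat c) ` (?R \<times> ?F ` clifford_group)"
      using g by (intro image_eqI[of _ _ "(c, ?F g)"]) (auto simp: h_def)
  qed
  then show ?thesis
    by (rule finite_subset) (intro finite_imageI finite_cartesian_product R fin)
qed

section \<open>Orbits\<close>

lemma finite_clifford_orbit: "finite (clifford_orbit M)"
  by (simp add: clifford_orbit_def finite_clifford_group)

lemma clifford_orbit_self: "M \<in> clifford_orbit M"
  unfolding clifford_orbit_def by (rule image_eqI[of _ _ "mat 1"]) (simp_all add: clifford_group.one)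

lemma clifford_cancel:
  assumes "g \<in> clifford_group"
  shows "conj_transpose g ** (g ** N) = N" "g ** (conj_transpose g ** N) = N"
  by (simp_all add: matrix_mul_assoc clifford_unitary clifford_unitary' assms)

lemma clifford_orbit_mult: "g \<in> clifford_group \<Longrightarrow> N \<in> clifford_orbit M \<Longrightarrow> g ** N \<in> clifford_orbit M"
  by (auto simp: clifford_orbit_def matrix_mul_assoc intro: clifford_group.mult)

lemma bij_betw_clifford_orbit:
  assumes "g \<in> clifford_group"
  shows "bij_betw (\<lambda>N. g ** N) (clifford_orbit M) (clifford_orbit M)"
  by (rule bij_betwI[where g = "\<lambda>N. conj_transpose g ** N"])
     (auto simp: clifford_cancel assms clifford_orbit_mult clifford_conj_transpose)

text \<open>Every invariance argument is this reindexing. Summing over the orbit and not over the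
  group keeps stabilizers out of the formulas.\<close>

lemma sum_clifford_orbit:
  assumes "g \<in> clifford_group"
  shows "(\<Sum>N\<in>clifford_orbit M. f (g ** N)) = (\<Sum>N\<in>clifford_orbit M. f N)"
  by (rule sum.reindex_bij_betw[OF bij_betw_clifford_orbit[OF assms]])

lemma gram_clifford_orbit:
  assumes "N \<in> clifford_orbit M"
  shows "conj_transpose N ** N = conj_transpose M ** M"
proof -
  obtain g where "g \<in> clifford_group" "N = g ** M" using assms by (auto simp: clifford_orbit_def)
  then show ?thesis by (simp add: conj_transpose_mult clifford_cancel flip: matrix_mul_assoc)
qed

lemma defect_clifford_orbit: "N \<in> clifford_orbit M \<Longrightarrow> defect N = defect M"
  by (simp add: defect_def gram_clifford_orbit)

lemma norm_clifford_orbit: "N \<in> clifford_orbit M \<Longrightarrow> norm N = norm M"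
  by (simp add: norm_eq_sqrt_inner inner_eq_Re_trace gram_clifford_orbit)

section \<open>Gates acting on rows, and the functions of bit strings they leave invariant\<close>

lemma gram_nth: "(conj_transpose M ** N) $ a $ b = (\<Sum>x\<in>UNIV. cnj (M $ x $ a) * N $ x $ b)"
  by (simp add: matrix_matrix_mult_def)

lemma clifford_Z: "on_qubit gate_Z j \<in> clifford_group"
  using clifford_group.mult[OF clifford_group.S clifford_group.S, of j j] by (simp only: S_squared)

lemma clifford_X: "on_qubit gate_X j \<in> clifford_group"
proof -
  have "(\<lambda>a b. \<Sum>c\<in>UNIV. (\<Sum>d\<in>UNIV. gate_H a d * gate_Z d c) * gate_H c b) = gate_X"
    using sqrt_half_sq by (auto simp: fun_eq_iff gate_H_def gate_X_def gate_Z_def UNIV_bool)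
  then have "on_qubit gate_H j ** on_qubit gate_Z j ** on_qubit gate_H j
      = on_qubit gate_X j"
    unfolding on_qubit_mult by (simp only:)
  with clifford_group.mult[OF clifford_group.mult[OF clifford_group.H clifford_Z] clifford_group.H, of j j j]
  show ?thesis by (simp only:)
qed

lemma Z_mult_nth:
  "(on_qubit gate_Z j ** N) $ x $ c = (if x j then -1 else 1) * N $ x $ c"
  by (auto simp: gate_Z_def on_qubit_mult_nth UNIV_bool fun_upd_idem)

lemma X_mult_nth:
  "(on_qubit gate_X j ** N) $ x $ c = N $ (x(j := (\<not> x j))) $ c"
  by (auto simp: gate_X_def on_qubit_mult_nth UNIV_bool)

lemma S_mult_nth:
  "(on_qubit gate_S j ** N) $ x $ c = (if x j then \<i> else 1) * N $ x $ c"
  by (auto simp: on_qubit_mult_nth gate_S_def UNIV_bool fun_upd_idem)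

lemma H_mult_nth:
  "(on_qubit gate_H j ** N) $ x $ c = complex_of_real (1 / sqrt 2) *
    (N $ (x(j := False)) $ c + (if x j then -1 else 1) * N $ (x(j := True)) $ c)"
  by (auto simp: on_qubit_mult_nth gate_H_def UNIV_bool algebra_simps)

lemma flip_invariant_const:
  fixes f :: "('r::finite \<Rightarrow> bool) \<Rightarrow> 'b"
  assumes "\<And>l x. f (x(l := (\<not> x l))) = f x"
  shows "f x = f (\<lambda>_. False)"
proof (induction "card {l. x l}" arbitrary: x)
  case 0
  then have "x = (\<lambda>_. False)" by (auto simp: fun_eq_iff)
  then show ?case by simp
next
  case (Suc m)
  then obtain l where l: "x l" by (metis (mono_tags) card.empty empty_Collect_eq nat.simps(3))
  have "{i. (x(l := (\<not> x l))) i} = {i. x i} - {l}" using l by auto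
  then have "card {i. (x(l := (\<not> x l))) i} = m" using Suc(2) l by simp
  with Suc(1)[of "x(l := (\<not> x l))"] show ?case using assms by simp
qed

text \<open>With bit \<open>j\<close> set, CNOT gates controlled by \<open>j\<close> switch on the
  remaining bits one at a time. So all nonzero strings are equivalent.\<close>

lemma CNOT_invariant_const:
  fixes f :: "('r::finite \<Rightarrow> bool) \<Rightarrow> 'b"
  assumes inv: "\<And>j k x. j \<noteq> k \<Longrightarrow> f (x(k := (x j \<noteq> x k))) = f x" and "x j"
  shows "f x = f (\<lambda>_. True)"
  using \<open>x j\<close>
proof (induction "card {l. \<not> x l}" arbitrary: x)
  case 0
  then have "x = (\<lambda>_. True)" by (auto simp: fun_eq_iff)
  then show ?case by simp
next
  case (Suc m)
  then obtain l where l: "\<not> x l" by (metis (mono_tags) card.empty empty_Collect_eq nat.simps(3))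
  with Suc.prems have jl: "j \<noteq> l" by auto
  have "{i. \<not> (x(l := (x j \<noteq> x l))) i} = {i. \<not> x i} - {l}" using l Suc.prems by auto
  then have "card {i. \<not> (x(l := (x j \<noteq> x l))) i} = m" using Suc(2) l by simp
  with Suc(1)[of "x(l := (x j \<noteq> x l))"] show ?case using inv[OF jl, of x] jl Suc.prems by simp
qed

section \<open>Second and fourth moments\<close>

definition moment2 :: "('r::finite) vspace \<Rightarrow> 2 \<Rightarrow> 2 \<Rightarrow> ('r \<Rightarrow> bool) \<Rightarrow> ('r \<Rightarrow> bool) \<Rightarrow> complex" where
  "moment2 M a c x z = (\<Sum>N\<in>clifford_orbit M. N $ x $ a * cnj (N $ z $ c))"

text \<open>The tensor square of N paired with that of its conjugate, summed over the orbit. Column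
  indices come first: with them fixed, this is a function of the four bit strings on which the gates
  act.\<close>

definition moment4 :: "('r::finite) vspace \<Rightarrow> 2 \<Rightarrow> 2 \<Rightarrow> 2 \<Rightarrow> 2 \<Rightarrow>
    ('r \<Rightarrow> bool) \<Rightarrow> ('r \<Rightarrow> bool) \<Rightarrow> ('r \<Rightarrow> bool) \<Rightarrow> ('r \<Rightarrow> bool) \<Rightarrow> complex" where
  "moment4 M a b c d x y z w =
    (\<Sum>N\<in>clifford_orbit M. N $ x $ a * N $ y $ b * cnj (N $ z $ c) * cnj (N $ w $ d))"

text \<open>A sign flip on a qubit where \<open>x\<close> and \<open>z\<close> differ negates the
  entry, and bit flips identify all diagonal entries.\<close>

lemma moment2_eq:
  fixes M :: "('r::finite) vspace"
  shows "moment2 M a c x z = (if x = z then moment2 M a c (\<lambda>_. False) (\<lambda>_. False) else 0)"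
proof (cases "x = z")
  case True
  have "moment2 M a c (x(l := (\<not> x l))) (x(l := (\<not> x l))) = moment2 M a c x x" for l x
    unfolding moment2_def by (subst sum_clifford_orbit[OF clifford_X[of l], symmetric]) (simp add: X_mult_nth)
  from flip_invariant_const[of "\<lambda>x. moment2 M a c x x", OF this] True show ?thesis by simp
next
  case False
  then obtain l where "x l \<noteq> z l" by (auto simp: fun_eq_iff)
  then have "moment2 M a c x z = - moment2 M a c x z"
    unfolding moment2_def
    by (subst sum_clifford_orbit[OF clifford_Z[of l], symmetric]) (auto simp: Z_mult_nth sum_negf)
  with False show ?thesis by simp
qed

lemma moment2_CARD:
  fixes M :: "('r::finite) vspace"
  shows "of_nat CARD('r \<Rightarrow> bool) * moment2 M a c x x
    = of_nat (card (clifford_orbit M)) * (conj_transpose M ** M) $ c $ a"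
proof -
  have "moment2 M a c z z = moment2 M a c x x" for z
    using moment2_eq[of M a c x x] moment2_eq[of M a c z z] by simp
  then have "(\<Sum>z\<in>UNIV. moment2 M a c z z) = (\<Sum>z\<in>(UNIV :: ('r \<Rightarrow> bool) set). moment2 M a c x x)"
    by (rule sum.cong[OF refl])
  then have "of_nat CARD('r \<Rightarrow> bool) * moment2 M a c x x = (\<Sum>z\<in>UNIV. moment2 M a c z z)"
    by (simp only: sum_constant)
  also have "\<dots> = (\<Sum>N\<in>clifford_orbit M. (conj_transpose N ** N) $ c $ a)"
    unfolding moment2_def gram_nth by (subst sum.swap) (simp add: mult.commute)
  also have "\<dots> = of_nat (card (clifford_orbit M)) * (conj_transpose M ** M) $ c $ a"
    by (simp add: gram_clifford_orbit)
  finally show ?thesis .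
qed

section \<open>Shape of the fourth moment tensor\<close>

context
  fixes M :: "('r::finite) vspace" and a b c d :: 2
begin

abbreviation (input) "m4 \<equiv> moment4 M a b c d"

lemma moment4_CNOT:
  assumes "j \<noteq> k"
  shows "m4 (x(k := (x j \<noteq> x k))) (y(k := (y j \<noteq> y k))) (z(k := (z j \<noteq> z k))) (w(k := (w j \<noteq> w k)))
    = m4 x y z w"
  unfolding moment4_def
  by (subst sum_clifford_orbit[OF clifford_group.CNOT[OF assms], symmetric]) (simp add: CNOT_mult_nth[OF assms])

text \<open>Bit flips translate all four strings simultaneously, so the first may be moved to
  zero.\<close>

lemma moment4_translate:
  "m4 x y z w = m4 (\<lambda>_. False) (bit_add y x) (bit_add z x) (bit_add w x)"
proof -
  let ?f = "\<lambda>t. m4 (bit_add x t) (bit_add y t) (bit_add z t) (bit_add w t)"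
  have upd: "bit_add u (t(l := (\<not> t l))) = (bit_add u t)(l := (\<not> bit_add u t l))" for u t :: "'r \<Rightarrow> bool" and l
    by (rule ext) (auto simp: bit_add_def)
  have "?f (t(l := (\<not> t l))) = ?f t" for l t
    unfolding moment4_def upd
    by (subst sum_clifford_orbit[OF clifford_X[of l], symmetric]) (simp add: X_mult_nth)
  then have "?f x = ?f (\<lambda>_. False)" by (rule flip_invariant_const)
  moreover have "bit_add x x = (\<lambda>_. False)" "bit_add u (\<lambda>_. False) = u" for u :: "'r \<Rightarrow> bool"
    by (simp_all add: bit_add_def)
  ultimately show ?thesis by simp
qed

text \<open>The phase gate on qubit \<open>l\<close> multiplies the moment by i to the power x + y -
  z - w of the bits at \<open>l\<close>. This exponent lies between -2 and 2, so the factor is 1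
  only if the bits balance.\<close>

lemma moment4_zero:
  assumes "of_bool (x l) + of_bool (y l) \<noteq> (of_bool (z l) + of_bool (w l) :: nat)"
  shows "m4 x y z w = 0"
proof -
  let ?s = "\<lambda>b. if b then \<i> else 1"
  have "m4 x y z w = (\<Sum>N\<in>clifford_orbit M. (?s (x l) * ?s (y l) * cnj (?s (z l)) * cnj (?s (w l))) *
      (N $ x $ a * N $ y $ b * cnj (N $ z $ c) * cnj (N $ w $ d)))"
    unfolding moment4_def
    by (subst sum_clifford_orbit[OF clifford_group.S[of l], symmetric]) (simp add: S_mult_nth mult_ac)
  also have "\<dots> = (?s (x l) * ?s (y l) * cnj (?s (z l)) * cnj (?s (w l))) * m4 x y z w"
    by (simp add: moment4_def sum_distrib_left)
  finally have "(1 - ?s (x l) * ?s (y l) * cnj (?s (z l)) * cnj (?s (w l))) * m4 x y z w = 0"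
    by (simp add: algebra_simps)
  moreover have "1 - ?s (x l) * ?s (y l) * cnj (?s (z l)) * cnj (?s (w l)) \<noteq> 0"
    using assms by (auto simp: complex_eq_iff split: if_splits)
  ultimately show ?thesis by simp
qed

text \<open>
  By the phase gates the supports of \<open>z\<close> and \<open>w\<close> are disjoint; if both were nonempty, a CNOT from one
  to the other would make them overlap.
\<close>

lemma moment4_nonzero_imp:
  assumes "m4 (\<lambda>_. False) y z w \<noteq> 0"
  shows "(y = w \<and> z = (\<lambda>_. False)) \<or> (y = z \<and> w = (\<lambda>_. False))"
proof -
  have *: "of_bool (y l) = (of_bool (z l) + of_bool (w l) :: nat)" for l
    by (rule ccontr) (use moment4_zero[of "\<lambda>_. False" l y z w] assms in simp)
  have y: "(y l \<longleftrightarrow> z l \<or> w l) \<and> \<not> (z l \<and> w l)" for l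
    using *[of l] by (cases "y l"; cases "z l"; cases "w l"; simp)
  have "z = (\<lambda>_. False) \<or> w = (\<lambda>_. False)"
  proof (rule ccontr)
    assume "\<not> (z = (\<lambda>_. False) \<or> w = (\<lambda>_. False))"
    then obtain j k where jk: "z j" "w k" by (auto simp: fun_eq_iff)
    with y have jk': "j \<noteq> k" "\<not> z k" "\<not> w j" by auto
    have "m4 (\<lambda>_. False) y z w
      = m4 ((\<lambda>_. False)(k := (False \<noteq> False))) (y(k := (y j \<noteq> y k))) (z(k := (z j \<noteq> z k))) (w(k := (w j \<noteq> w k)))"
      using moment4_CNOT[OF jk'(1), of "\<lambda>_. False" y z w] by simp
    also have "\<dots> = 0"
      by (rule moment4_zero[of _ k]) (use jk jk' y in auto)
    finally show False using assms by simp
  qed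
  with y show ?thesis by (auto simp: fun_eq_iff)
qed

text \<open>Six of the sixteen patterns are balanced; they are grouped into three complementary
  pairs, since a bit flip will equate the members of each pair.\<close>

lemma sum_balanced_bits:
  fixes f :: "bool \<Rightarrow> bool \<Rightarrow> bool \<Rightarrow> bool \<Rightarrow> complex"
  assumes "\<And>p q r s. of_bool p + of_bool q \<noteq> (of_bool r + of_bool s :: nat) \<Longrightarrow> f p q r s = 0"
  shows "(\<Sum>p\<in>UNIV. \<Sum>q\<in>UNIV. \<Sum>r\<in>UNIV. \<Sum>s\<in>UNIV. f p q r s)
    = f False False False False + f True True True True + (f False True False True + f True False True False)
      + (f False True True False + f True False False True)"
  by (simp add: UNIV_bool assms)

text \<open>Phase gates, bit flips and CNOT leave three free values: m for equal strings, and g, h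
  for the two pairings. One Hadamard gate supplies the missing relation: summing over the six
  balanced patterns gives 4m = 2m + 2g + 2h.\<close>

lemma moment4_H:
  "m4 (\<lambda>_. False) (\<lambda>_. False) (\<lambda>_. False) (\<lambda>_. False)
    = m4 (\<lambda>_. False) (\<lambda>_. True) (\<lambda>_. False) (\<lambda>_. True) + m4 (\<lambda>_. False) (\<lambda>_. True) (\<lambda>_. True) (\<lambda>_. False)"
proof -
  \<comment> \<open>Types are inhabited, so there is a qubit to act on.\<close>
  fix l :: 'r
  let ?o = "\<lambda>_::'r. False"
  let ?e = "?o(l := True)"
  let ?X = "\<lambda>p q r s. m4 (?o(l := p)) (?o(l := q)) (?o(l := r)) (?o(l := s))"
  have o: "?o(l := False) = ?o" by auto
  have "4 * m4 ?o ?o ?o ?o = (\<Sum>p\<in>UNIV. \<Sum>q\<in>UNIV. \<Sum>r\<in>UNIV. \<Sum>s\<in>UNIV. ?X p q r s)"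
  proof -
    let ?h = "complex_of_real (1 / sqrt 2)"
    have h: "?h * ?h * ?h * ?h = 1 / 4" using sqrt_half_sq by (simp add: mult.assoc)
    have "m4 ?o ?o ?o ?o = (\<Sum>N\<in>clifford_orbit M. (?h * ?h * ?h * ?h) *
        (\<Sum>p\<in>UNIV. \<Sum>q\<in>UNIV. \<Sum>r\<in>UNIV. \<Sum>s\<in>UNIV.
          N $ (?o(l := p)) $ a * N $ (?o(l := q)) $ b * cnj (N $ (?o(l := r)) $ c) * cnj (N $ (?o(l := s)) $ d)))"
      unfolding moment4_def
      by (subst sum_clifford_orbit[OF clifford_group.H[of l], symmetric])
         (rule sum.cong[OF refl], simp add: H_mult_nth UNIV_bool del: of_real_divide, simp add: algebra_simps)
    also have "\<dots> = 1 / 4 * (\<Sum>N\<in>clifford_orbit M. \<Sum>p\<in>UNIV. \<Sum>q\<in>UNIV. \<Sum>r\<in>UNIV. \<Sum>s\<in>UNIV.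
          N $ (?o(l := p)) $ a * N $ (?o(l := q)) $ b * cnj (N $ (?o(l := r)) $ c) * cnj (N $ (?o(l := s)) $ d))"
      unfolding h by (rule sum_distrib_left[symmetric])
    also have "\<dots> = 1 / 4 * (\<Sum>p\<in>UNIV. \<Sum>q\<in>UNIV. \<Sum>r\<in>UNIV. \<Sum>s\<in>UNIV. ?X p q r s)"
      by (rule arg_cong[where f = "(*) _"]) (simp add: UNIV_bool sum.distrib moment4_def)
    finally have "m4 ?o ?o ?o ?o = 1 / 4 * (\<Sum>p\<in>UNIV. \<Sum>q\<in>UNIV. \<Sum>r\<in>UNIV. \<Sum>s\<in>UNIV. ?X p q r s)" .
    moreover have "m = 1 / 4 * s \<Longrightarrow> 4 * m = s" for m s :: complex by (simp add: mult.commute)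
    ultimately show ?thesis by blast
  qed
  also have "\<dots> = ?X False False False False + ?X True True True True
      + (?X False True False True + ?X True False True False)
      + (?X False True True False + ?X True False False True)"
  proof (rule sum_balanced_bits)
    show "?X p q r s = 0" if "of_bool p + of_bool q \<noteq> (of_bool r + of_bool s :: nat)" for p q r s
      by (rule moment4_zero[of _ l]) (use that in simp)
  qed
  finally have X4: "4 * m4 ?o ?o ?o ?o = ?X False False False False + ?X True True True True
      + (?X False True False True + ?X True False True False)
      + (?X False True True False + ?X True False False True)" .
  have tr: "?X p q r s = ?X (\<not> p) (\<not> q) (\<not> r) (\<not> s)" for p q r s
  proof -
    have "bit_add (?o(l := u)) (?o(l := v)) = bit_add (?o(l := (\<not> u))) (?o(l := (\<not> v)))" for u v
      by (auto simp: bit_add_def)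
    then show ?thesis by (subst (1 2) moment4_translate) simp
  qed
  \<comment> \<open>CNOT gates controlled by \<open>l\<close> fix the zero string and carry the
    string with the single bit \<open>l\<close> to the all-ones string, which represents all nonzero
    strings.\<close>
  have 1: "?X False True False True = m4 ?o (\<lambda>_. True) ?o (\<lambda>_. True)"
  proof -
    have "(\<lambda>x. m4 ?o x ?o x) ?e = m4 ?o (\<lambda>_. True) ?o (\<lambda>_. True)"
      using moment4_CNOT[of _ _ ?o _ ?o] by (intro CNOT_invariant_const[of "\<lambda>x. m4 ?o x ?o x" _ l]) (simp_all add: fun_upd_idem)
    then show ?thesis by (simp add: o)
  qed
  have 2: "?X False True True False = m4 ?o (\<lambda>_. True) (\<lambda>_. True) ?o"
  proof -
    have "(\<lambda>x. m4 ?o x x ?o) ?e = m4 ?o (\<lambda>_. True) (\<lambda>_. True) ?o"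
      using moment4_CNOT[of _ _ ?o _ _ ?o] by (intro CNOT_invariant_const[of "\<lambda>x. m4 ?o x x ?o" _ l]) (simp_all add: fun_upd_idem)
    then show ?thesis by (simp add: o)
  qed
  have 3: "?X True True True True = m4 ?o ?o ?o ?o"
    using tr[of True True True True] by (simp only: not_True_eq_False o)
  have 4: "?X True False True False = m4 ?o (\<lambda>_. True) ?o (\<lambda>_. True)"
    using tr[of True False True False] 1 by (simp only: not_True_eq_False not_False_eq_True)
  have 5: "?X True False False True = m4 ?o (\<lambda>_. True) (\<lambda>_. True) ?o"
    using tr[of True False False True] 2 by (simp only: not_True_eq_False not_False_eq_True)
  have "m = g + h" if "4 * m = m + m + (g + g) + (h + h)" for m g h :: complex
  proof -
    from that have "2 * m = 2 * (g + h)" by (simp add: algebra_simps)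
    then show ?thesis by (simp only: mult_cancel_left) simp
  qed
  then show ?thesis using X4 unfolding 1 2 3 4 5 unfolding o by blast
qed

text \<open>After translation to x = 0 only the two pairings survive, each constant over nonzero
  strings. If all strings vanish both indicators are 1, and \<open>moment4_H\<close> says that the
  two coefficients then add up to the right value.\<close>

lemma moment4_eq:
  "m4 x y z w = m4 (\<lambda>_. False) (\<lambda>_. True) (\<lambda>_. False) (\<lambda>_. True) * (if x = z \<and> y = w then 1 else 0)
    + m4 (\<lambda>_. False) (\<lambda>_. True) (\<lambda>_. True) (\<lambda>_. False) * (if x = w \<and> y = z then 1 else 0)"
proof -
  let ?o = "\<lambda>_::'r. False" and ?l = "\<lambda>_::'r. True"
  have 1: "m4 ?o u ?o u = m4 ?o ?l ?o ?l" if u: "u \<noteq> ?o" for u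
  proof -
    obtain j where "u j" using u by (auto simp: fun_eq_iff)
    then show ?thesis
      using moment4_CNOT[of _ _ ?o _ ?o] by (intro CNOT_invariant_const[of "\<lambda>x. m4 ?o x ?o x" _ j]) (simp_all add: fun_upd_idem)
  qed
  have 2: "m4 ?o u u ?o = m4 ?o ?l ?l ?o" if u: "u \<noteq> ?o" for u
  proof -
    obtain j where "u j" using u by (auto simp: fun_eq_iff)
    then show ?thesis
      using moment4_CNOT[of _ _ ?o _ _ ?o] by (intro CNOT_invariant_const[of "\<lambda>x. m4 ?o x x ?o" _ j]) (simp_all add: fun_upd_idem)
  qed
  have main: "m4 ?o y z w = m4 ?o ?l ?o ?l * (if ?o = z \<and> y = w then 1 else 0)
    + m4 ?o ?l ?l ?o * (if ?o = w \<and> y = z then 1 else 0)" for y z w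
  proof -
    consider "y = ?o" "z = ?o" "w = ?o" | "y \<noteq> ?o" "y = w" "z = ?o" | "y \<noteq> ?o" "y = z" "w = ?o"
      | "\<not> (?o = z \<and> y = w)" "\<not> (?o = w \<and> y = z)" by blast
    then show ?thesis
    proof cases
      case 1
      then show ?thesis using moment4_H by simp
    next
      case 2
      then have c: "\<not> (?o = w \<and> y = z)" "?o = z \<and> y = w" by auto
      have "m4 ?o y z w = m4 ?o ?l ?o ?l"
        using 1[OF 2(1)] by (simp only: 2(3) 2(2)[symmetric])
      then show ?thesis
        by (simp only: if_not_P[OF c(1)] if_P[OF c(2)] mult_1_right mult_zero_right add_0_right)
    next
      case 3
      then have c: "\<not> (?o = z \<and> y = w)" "?o = w \<and> y = z" by auto
      have "m4 ?o y z w = m4 ?o ?l ?l ?o"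
        using 2[OF 3(1)] by (simp only: 3(3) 3(2)[symmetric])
      then show ?thesis
        by (simp only: if_not_P[OF c(1)] if_P[OF c(2)] mult_1_right mult_zero_right add_0_left)
    next
      case 4
      then have "m4 ?o y z w = 0" using moment4_nonzero_imp[of y z w] by blast
      then show ?thesis by (simp only: if_not_P[OF 4(1)] if_not_P[OF 4(2)]) simp
    qed
  qed
  have o: "?o = bit_add u x \<longleftrightarrow> x = u" for u x :: "'r \<Rightarrow> bool"
    by (auto simp: bit_add_def fun_eq_iff)
  have i: "bit_add u x = bit_add v x \<longleftrightarrow> u = v" for u v x :: "'r \<Rightarrow> bool"
    by (metis bit_add_cancel)
  show ?thesis
    by (subst moment4_translate, subst main) (simp only: o i)
qed

end

section \<open>Contracting the moments with a test matrix\<close>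

lemma sum4_delta:
  fixes p q r s :: "'n::finite \<Rightarrow> complex"
  shows "(\<Sum>x\<in>UNIV. \<Sum>y\<in>UNIV. \<Sum>z\<in>UNIV. \<Sum>w\<in>UNIV. p x * q y * r z * s w *
      (\<gamma> * (if x = z \<and> y = w then 1 else 0) + \<beta> * (if x = w \<and> y = z then 1 else 0)))
    = \<gamma> * ((\<Sum>x\<in>UNIV. p x * r x) * (\<Sum>y\<in>UNIV. q y * s y)) + \<beta> * ((\<Sum>x\<in>UNIV. p x * s x) * (\<Sum>y\<in>UNIV. q y * r y))"
proof -
  have 1: "(\<Sum>w\<in>UNIV. f w * (if x = z \<and> y = w then 1 else 0)) = (if x = z then f y else 0)"
    "(\<Sum>w\<in>UNIV. f w * (if x = w \<and> y = z then 1 else 0)) = (if y = z then f x else 0)" for f :: "'n \<Rightarrow> complex" and x y z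
    by (auto simp: if_distrib[of "\<lambda>a. _ * a"] cong: if_cong)
  have "(\<Sum>z\<in>UNIV. \<Sum>w\<in>UNIV. p x * q y * r z * s w *
      (\<gamma> * (if x = z \<and> y = w then 1 else 0) + \<beta> * (if x = w \<and> y = z then 1 else 0)))
      = \<gamma> * ((p x * r x) * (q y * s y)) + \<beta> * ((p x * s x) * (q y * r y))" for x y
  proof -
    have "(\<Sum>z\<in>UNIV. \<Sum>w\<in>UNIV. p x * q y * r z * s w *
      (\<gamma> * (if x = z \<and> y = w then 1 else 0) + \<beta> * (if x = w \<and> y = z then 1 else 0)))
      = (\<Sum>z\<in>UNIV. (\<Sum>w\<in>UNIV. (\<gamma> * p x * q y * r z * s w) * (if x = z \<and> y = w then 1 else 0))
         + (\<Sum>w\<in>UNIV. (\<beta> * p x * q y * r z * s w) * (if x = w \<and> y = z then 1 else 0)))"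
      unfolding sum.distrib[symmetric]
      by (intro sum.cong refl) (simp only: distrib_left mult_ac)
    also have "\<dots> = \<gamma> * ((p x * r x) * (q y * s y)) + \<beta> * ((p x * s x) * (q y * r y))"
      unfolding 1 sum.distrib by (simp add: mult_ac)
    finally show ?thesis .
  qed
  then show ?thesis
    by (simp add: sum.distrib sum_product flip: sum_distrib_left)
qed

lemma sum_times4:
  fixes p q r s :: "'n::finite \<Rightarrow> complex"
  shows "(\<Sum>x\<in>UNIV. p x) * (\<Sum>x\<in>UNIV. q x) * (\<Sum>x\<in>UNIV. r x) * (\<Sum>x\<in>UNIV. s x)
    = (\<Sum>x\<in>UNIV. \<Sum>y\<in>UNIV. \<Sum>z\<in>UNIV. \<Sum>w\<in>UNIV. p x * q y * r z * s w)"
  by (simp only: sum_distrib_left[symmetric] sum_distrib_right[symmetric])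

context
  fixes M :: "('r::finite) vspace" and a b c d :: 2
begin

text \<open>Summing the row indices along either pairing yields products of Gram entries, which are
  constant on the orbit. The resulting two by two system in \<gamma> and \<beta> is solved with n^3
  - n kept on the left, so no division occurs. This is the Weingarten formula of degree two.\<close>

lemma moment4_coefficients:
  fixes n m :: complex
  defines "n \<equiv> of_nat CARD('r \<Rightarrow> bool)" and "m \<equiv> of_nat (card (clifford_orbit M))"
    and "P \<equiv> conj_transpose M ** M"
  obtains \<gamma> \<beta> where
    "\<And>x y z w. moment4 M a b c d x y z w = \<gamma> * (if x = z \<and> y = w then 1 else 0) + \<beta> * (if x = w \<and> y = z then 1 else 0)"
    "(n ^ 3 - n) * \<gamma> = m * (n * (P $ c $ a * P $ d $ b) - P $ d $ a * P $ c $ b)"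
    "(n ^ 3 - n) * \<beta> = m * (n * (P $ d $ a * P $ c $ b) - P $ c $ a * P $ d $ b)"
proof -
  obtain \<gamma> \<beta> where eq: "\<And>x y z w. moment4 M a b c d x y z w
    = \<gamma> * (if x = z \<and> y = w then 1 else 0) + \<beta> * (if x = w \<and> y = z then 1 else 0)"
    using moment4_eq[of M a b c d] by blast
  have *: "(\<Sum>x\<in>UNIV. \<Sum>y\<in>UNIV. \<Sum>N\<in>clifford_orbit M. f N x * g N y)
      = (\<Sum>N\<in>clifford_orbit M. (\<Sum>x\<in>UNIV. f N x) * (\<Sum>y\<in>UNIV. g N y))"
    for f g :: "'r vspace \<Rightarrow> ('r \<Rightarrow> bool) \<Rightarrow> complex"
  proof -
    have "(\<Sum>x\<in>UNIV. \<Sum>y\<in>UNIV. \<Sum>N\<in>clifford_orbit M. f N x * g N y)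
        = (\<Sum>x\<in>UNIV. \<Sum>N\<in>clifford_orbit M. \<Sum>y\<in>UNIV. f N x * g N y)"
      by (rule sum.cong[OF refl]) (rule sum.swap)
    also have "\<dots> = (\<Sum>N\<in>clifford_orbit M. \<Sum>x\<in>UNIV. \<Sum>y\<in>UNIV. f N x * g N y)"
      by (rule sum.swap)
    finally show ?thesis by (simp add: sum_product)
  qed
  have "(\<Sum>x\<in>UNIV. \<Sum>y\<in>UNIV. moment4 M a b c d x y x y)
      = (\<Sum>x\<in>UNIV. \<Sum>y\<in>UNIV. \<Sum>N\<in>clifford_orbit M. (cnj (N $ x $ c) * N $ x $ a) * (cnj (N $ y $ d) * N $ y $ b))"
    by (simp add: moment4_def mult_ac)
  also have "\<dots> = (\<Sum>N\<in>clifford_orbit M. (conj_transpose N ** N) $ c $ a * (conj_transpose N ** N) $ d $ b)"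
    unfolding * gram_nth ..
  also have "\<dots> = m * (P $ c $ a * P $ d $ b)"
    by (simp add: gram_clifford_orbit m_def P_def)
  finally have 1: "(\<Sum>x\<in>UNIV. \<Sum>y\<in>UNIV. moment4 M a b c d x y x y) = m * (P $ c $ a * P $ d $ b)" .
  have "(\<Sum>x\<in>UNIV. \<Sum>y\<in>UNIV. moment4 M a b c d x y y x)
      = (\<Sum>x\<in>UNIV. \<Sum>y\<in>UNIV. \<Sum>N\<in>clifford_orbit M. (cnj (N $ x $ d) * N $ x $ a) * (cnj (N $ y $ c) * N $ y $ b))"
    by (simp add: moment4_def mult_ac)
  also have "\<dots> = (\<Sum>N\<in>clifford_orbit M. (conj_transpose N ** N) $ d $ a * (conj_transpose N ** N) $ c $ b)"
    unfolding * gram_nth ..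
  also have "\<dots> = m * (P $ d $ a * P $ c $ b)"
    by (simp add: gram_clifford_orbit m_def P_def)
  finally have 2: "(\<Sum>x\<in>UNIV. \<Sum>y\<in>UNIV. moment4 M a b c d x y y x) = m * (P $ d $ a * P $ c $ b)" .
  have delta: "(\<Sum>y\<in>UNIV. s + t * (if x = y \<and> y = x then 1 else 0)) = n * s + t"
    "(\<Sum>y\<in>UNIV. s * (if x = y \<and> y = x then 1 else 0) + t) = s + n * t" for s t :: complex and x :: "'r \<Rightarrow> bool"
    by (simp_all add: sum.distrib n_def if_distrib[of "\<lambda>a. _ * a"] cong: if_cong conj_cong)
  have 3: "n * (n * \<gamma> + \<beta>) = m * (P $ c $ a * P $ d $ b)"
  proof -
    have "(\<Sum>y\<in>UNIV. moment4 M a b c d x y x y) = n * \<gamma> + \<beta>" for x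
      using delta(1)[of \<gamma> \<beta> x] by (simp add: eq)
    then show ?thesis using 1 by (simp add: n_def)
  qed
  have 4: "n * (\<gamma> + n * \<beta>) = m * (P $ d $ a * P $ c $ b)"
  proof -
    have "(\<Sum>y\<in>UNIV. moment4 M a b c d x y y x) = \<gamma> + n * \<beta>" for x
      using delta(2)[of \<gamma> x \<beta>] by (simp add: eq)
    then show ?thesis using 2 by (simp add: n_def)
  qed
  show ?thesis
  proof (rule that[OF eq])
    have "(n ^ 3 - n) * \<gamma> = n * (n * (n * \<gamma> + \<beta>)) - n * (\<gamma> + n * \<beta>)"
      "(n ^ 3 - n) * \<beta> = n * (n * (\<gamma> + n * \<beta>)) - n * (n * \<gamma> + \<beta>)"
      by (simp_all add: algebra_simps power3_eq_cube)
    then show "(n ^ 3 - n) * \<gamma> = m * (n * (P $ c $ a * P $ d $ b) - P $ d $ a * P $ c $ b)"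
      "(n ^ 3 - n) * \<beta> = m * (n * (P $ d $ a * P $ c $ b) - P $ c $ a * P $ d $ b)"
      unfolding 3 4 by (simp_all add: algebra_simps)
  qed
qed

lemma sum_linear_forms4:
  fixes A :: "'r vspace" and n m :: complex and Q :: "complex^2^2"
  defines "n \<equiv> of_nat CARD('r \<Rightarrow> bool)" and "m \<equiv> of_nat (card (clifford_orbit M))"
    and "P \<equiv> conj_transpose M ** M" and "Q \<equiv> conj_transpose A ** A"
    and "\<zeta> \<equiv> \<lambda>N e. (conj_transpose A ** N) $ e $ (e::2)"
  shows "(n ^ 3 - n) * (\<Sum>N\<in>clifford_orbit M. \<zeta> N a * \<zeta> N b * cnj (\<zeta> N c) * cnj (\<zeta> N d))
    = m * ((n * (P $ c $ a * P $ d $ b) - P $ d $ a * P $ c $ b) * (Q $ a $ c * Q $ b $ d)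
         + (n * (P $ d $ a * P $ c $ b) - P $ c $ a * P $ d $ b) * (Q $ a $ d * Q $ b $ c))"
proof -
  obtain \<gamma> \<beta> where eq: "\<And>x y z w. moment4 M a b c d x y z w
    = \<gamma> * (if x = z \<and> y = w then 1 else 0) + \<beta> * (if x = w \<and> y = z then 1 else 0)"
    and g: "(n ^ 3 - n) * \<gamma> = m * (n * (P $ c $ a * P $ d $ b) - P $ d $ a * P $ c $ b)"
    and b: "(n ^ 3 - n) * \<beta> = m * (n * (P $ d $ a * P $ c $ b) - P $ c $ a * P $ d $ b)"
    using moment4_coefficients unfolding n_def m_def P_def by blast
  have "(\<Sum>N\<in>clifford_orbit M. \<zeta> N a * \<zeta> N b * cnj (\<zeta> N c) * cnj (\<zeta> N d))
    = (\<Sum>N\<in>clifford_orbit M. \<Sum>x\<in>UNIV. \<Sum>y\<in>UNIV. \<Sum>z\<in>UNIV. \<Sum>w\<in>UNIV.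
        cnj (A $ x $ a) * cnj (A $ y $ b) * A $ z $ c * A $ w $ d *
          (N $ x $ a * N $ y $ b * cnj (N $ z $ c) * cnj (N $ w $ d)))"
    unfolding \<zeta>_def gram_nth cnj_sum sum_times4 by (simp add: mult_ac)
  also have "\<dots> = (\<Sum>x\<in>UNIV. \<Sum>y\<in>UNIV. \<Sum>z\<in>UNIV. \<Sum>w\<in>UNIV. \<Sum>N\<in>clifford_orbit M.
        cnj (A $ x $ a) * cnj (A $ y $ b) * A $ z $ c * A $ w $ d *
          (N $ x $ a * N $ y $ b * cnj (N $ z $ c) * cnj (N $ w $ d)))"
    by (subst sum.swap, rule sum.cong[OF refl])+ (rule refl)
  also have "\<dots> = (\<Sum>x\<in>UNIV. \<Sum>y\<in>UNIV. \<Sum>z\<in>UNIV. \<Sum>w\<in>UNIV.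
        cnj (A $ x $ a) * cnj (A $ y $ b) * A $ z $ c * A $ w $ d * moment4 M a b c d x y z w)"
    by (simp only: moment4_def sum_distrib_left)
  also have "\<dots> = \<gamma> * (Q $ a $ c * Q $ b $ d) + \<beta> * (Q $ a $ d * Q $ b $ c)"
    unfolding eq sum4_delta by (simp add: Q_def gram_nth)
  finally have "(n ^ 3 - n) * (\<Sum>N\<in>clifford_orbit M. \<zeta> N a * \<zeta> N b * cnj (\<zeta> N c) * cnj (\<zeta> N d))
    = ((n ^ 3 - n) * \<gamma>) * (Q $ a $ c * Q $ b $ d) + ((n ^ 3 - n) * \<beta>) * (Q $ a $ d * Q $ b $ c)"
    by (simp only: distrib_left mult.assoc)
  then show ?thesis unfolding g b by (simp only: distrib_left mult.assoc)
qed

end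

text \<open>Summing over columns produces tr(QP)^2 and tr(QPQP). For two by two matrices the latter
  is tr(QP)^2 - 2 det Q det P, which turns 2n tr(QP)^2 - 2 tr(QPQP) into the stated form.\<close>

lemma sum_trace4:
  fixes M A :: "('r::finite) vspace" and n m :: complex
  defines "n \<equiv> of_nat CARD('r \<Rightarrow> bool)" and "m \<equiv> of_nat (card (clifford_orbit M))"
    and "P \<equiv> conj_transpose M ** M" and "Q \<equiv> conj_transpose A ** A"
    and "\<zeta> \<equiv> \<lambda>N. trace (conj_transpose A ** N)"
  shows "(n ^ 3 - n) * (\<Sum>N\<in>clifford_orbit M. \<zeta> N * \<zeta> N * cnj (\<zeta> N) * cnj (\<zeta> N))
    = m * (2 * (n - 1) * (trace (Q ** P))\<^sup>2 + 4 * det P * det Q)"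
proof -
  let ?z = "\<lambda>N e. (conj_transpose A ** N) $ e $ (e::2)"
  let ?F = "\<lambda>a b c d. m * ((n * (P $ c $ a * P $ d $ b) - P $ d $ a * P $ c $ b) * (Q $ a $ c * Q $ b $ d)
         + (n * (P $ d $ a * P $ c $ b) - P $ c $ a * P $ d $ b) * (Q $ a $ d * Q $ b $ c))"
  have "(\<Sum>N\<in>clifford_orbit M. \<zeta> N * \<zeta> N * cnj (\<zeta> N) * cnj (\<zeta> N))
    = (\<Sum>N\<in>clifford_orbit M. \<Sum>a\<in>UNIV. \<Sum>b\<in>UNIV. \<Sum>c\<in>UNIV. \<Sum>d\<in>UNIV. ?z N a * ?z N b * cnj (?z N c) * cnj (?z N d))"
    unfolding \<zeta>_def trace_def cnj_sum sum_times4 ..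
  also have "\<dots> = (\<Sum>a\<in>UNIV. \<Sum>b\<in>UNIV. \<Sum>c\<in>UNIV. \<Sum>d\<in>UNIV. \<Sum>N\<in>clifford_orbit M. ?z N a * ?z N b * cnj (?z N c) * cnj (?z N d))"
    by (subst sum.swap, rule sum.cong[OF refl])+ (rule refl)
  finally have "(n ^ 3 - n) * (\<Sum>N\<in>clifford_orbit M. \<zeta> N * \<zeta> N * cnj (\<zeta> N) * cnj (\<zeta> N))
    = (\<Sum>a\<in>UNIV. \<Sum>b\<in>UNIV. \<Sum>c\<in>UNIV. \<Sum>d\<in>UNIV. ?F a b c d)"
    unfolding n_def m_def P_def Q_def sum_linear_forms4[symmetric] by (simp only: sum_distrib_left)
  also have "\<dots> = m * (2 * (n - 1) * (trace (Q ** P))\<^sup>2 + 4 * det P * det Q)"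
    unfolding sum_2 trace_def det_2 matrix_matrix_mult_def by (simp only: vec_lambda_beta sum_2) algebra
  finally show ?thesis .
qed

lemma sum_trace2:
  fixes M A :: "('r::finite) vspace"
  defines "\<zeta> \<equiv> \<lambda>N. trace (conj_transpose A ** N)"
  shows "of_nat CARD('r \<Rightarrow> bool) * (\<Sum>N\<in>clifford_orbit M. \<zeta> N * cnj (\<zeta> N))
    = of_nat (card (clifford_orbit M)) * trace (conj_transpose A ** A ** (conj_transpose M ** M))"
proof -
  let ?o = "\<lambda>_::'r. False"
  have "(\<Sum>N\<in>clifford_orbit M. \<zeta> N * cnj (\<zeta> N))
    = (\<Sum>N\<in>clifford_orbit M. \<Sum>a\<in>UNIV. \<Sum>c\<in>UNIV. \<Sum>x\<in>UNIV. \<Sum>z\<in>UNIV.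
        cnj (A $ x $ a) * A $ z $ c * (N $ x $ a * cnj (N $ z $ c)))"
    unfolding \<zeta>_def trace_def gram_nth cnj_sum sum_product by (simp add: mult_ac)
  also have "\<dots> = (\<Sum>a\<in>UNIV. \<Sum>c\<in>UNIV. \<Sum>x\<in>UNIV. \<Sum>z\<in>UNIV. \<Sum>N\<in>clifford_orbit M.
        cnj (A $ x $ a) * A $ z $ c * (N $ x $ a * cnj (N $ z $ c)))"
    by (subst sum.swap, rule sum.cong[OF refl])+ (rule refl)
  also have "\<dots> = (\<Sum>a\<in>UNIV. \<Sum>c\<in>UNIV. \<Sum>x\<in>UNIV. \<Sum>z\<in>UNIV. cnj (A $ x $ a) * A $ z $ c * moment2 M a c x z)"
    by (simp only: moment2_def sum_distrib_left)
  also have "\<dots> = (\<Sum>a\<in>UNIV. \<Sum>c\<in>UNIV. (conj_transpose A ** A) $ a $ c * moment2 M a c ?o ?o)"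
    by (subst moment2_eq) (simp add: gram_nth sum_distrib_right if_distrib[of "\<lambda>a. _ * a"] cong: if_cong)
  finally have "of_nat CARD('r \<Rightarrow> bool) * (\<Sum>N\<in>clifford_orbit M. \<zeta> N * cnj (\<zeta> N))
    = (\<Sum>a\<in>UNIV. \<Sum>c\<in>UNIV. (conj_transpose A ** A) $ a $ c * (of_nat CARD('r \<Rightarrow> bool) * moment2 M a c ?o ?o))"
    by (simp only: sum_distrib_left mult.left_commute)
  also have "\<dots> = of_nat (card (clifford_orbit M)) * trace (conj_transpose A ** A ** (conj_transpose M ** M))"
    unfolding moment2_CARD trace_def matrix_matrix_mult_def[of "conj_transpose A ** A"]
    by (simp add: sum_distrib_left mult_ac)
  finally show ?thesis .
qed

section \<open>From complex traces to real linear forms\<close>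

lemma mat_mult_mat: "mat a ** mat b = (mat (a * b) :: complex^'n^'n)"
  by (simp add: vec_eq_iff mat_mult_nth) (simp add: mat_def)

lemma inner_mat_mult: "A \<bullet> (mat c ** N) = Re (c * trace (conj_transpose A ** N))"
proof -
  have "trace (conj_transpose A ** (mat c ** N)) = c * trace (conj_transpose A ** N)"
    unfolding trace_def gram_nth mat_mult_nth by (simp add: sum_distrib_left mult_ac)
  then show ?thesis by (simp only: inner_eq_Re_trace)
qed

lemma clifford_scalars:
  "mat (cis (pi / 4)) \<in> clifford_group" "mat \<i> \<in> clifford_group" "mat (\<i> * cis (pi / 4)) \<in> clifford_group"
  "mat (- 1) \<in> clifford_group"
proof -
  show 1: "mat (cis (pi / 4)) \<in> clifford_group" by (rule clifford_group.scalar)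
  have "cis (pi / 4) * cis (pi / 4) = cis (pi / 2)" by (simp add: cis_mult)
  then show 2: "mat \<i> \<in> clifford_group"
    using clifford_group.mult[OF 1 1] by (simp add: mat_mult_mat)
  show "mat (\<i> * cis (pi / 4)) \<in> clifford_group" "mat (- 1) \<in> clifford_group"
    using clifford_group.mult[OF 2 1] clifford_group.mult[OF 2 2] by (simp_all add: mat_mult_mat)
qed

lemma cis_pi_quarter: "cis (pi / 4) = complex_of_real (1 / sqrt 2) * (1 + \<i>)"
  by (simp add: complex_eq_iff cos_45 sin_45 real_div_sqrt field_simps)

text \<open>The scalar i lies in the group, and Re(z)^2 + Re(iz)^2 = |z|^2.\<close>

lemma sum_inner2:
  fixes A M :: "('r::finite) vspace"
  shows "2 * (\<Sum>N\<in>clifford_orbit M. (A \<bullet> N) ^ 2) = (\<Sum>N\<in>clifford_orbit M. (cmod (trace (conj_transpose A ** N)))\<^sup>2)"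
proof -
  let ?z = "\<lambda>N. trace (conj_transpose A ** N)"
  have 1: "(\<Sum>N\<in>clifford_orbit M. (A \<bullet> N) ^ 2) = (\<Sum>N\<in>clifford_orbit M. Re (c * ?z N) ^ 2)"
    if "(mat c :: 'r qmat) \<in> clifford_group" for c
    by (subst sum_clifford_orbit[OF that, symmetric]) (simp only: inner_mat_mult)
  have "2 * (\<Sum>N\<in>clifford_orbit M. (A \<bullet> N) ^ 2) = (\<Sum>N\<in>clifford_orbit M. Re (1 * ?z N) ^ 2 + Re (\<i> * ?z N) ^ 2)"
    using 1[OF clifford_group.one] 1[OF clifford_scalars(2)] by (simp add: sum.distrib)
  then show ?thesis by (simp add: cmod_power2)
qed

text \<open>Averages over the phases \<open>1\<close>, \<open>\<i>\<close>, \<open>cis (pi / 4)\<close> and \<open>\<i> * cis (pi / 4)\<close>.\<close>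

lemma sum_inner4:
  fixes A M :: "('r::finite) vspace"
  shows "8 * (\<Sum>N\<in>clifford_orbit M. (A \<bullet> N) ^ 4) = 3 * (\<Sum>N\<in>clifford_orbit M. (cmod (trace (conj_transpose A ** N))) ^ 4)"
proof -
  let ?z = "\<lambda>N. trace (conj_transpose A ** N)"
  let ?S = "\<Sum>N\<in>clifford_orbit M. (A \<bullet> N) ^ 4"
  have 1: "?S = (\<Sum>N\<in>clifford_orbit M. Re (c * ?z N) ^ 4)" if "(mat c :: 'r qmat) \<in> clifford_group" for c
    by (subst sum_clifford_orbit[OF that, symmetric]) (simp only: inner_mat_mult)
  \<comment> \<open>Up to sign these four phases are all eighth roots of unity, enough to average a
    quartic form exactly: the mean of the fourth power of the cosine is 3/8.\<close>
  have *: "2 * (Re (1 * z) ^ 4 + Re (\<i> * z) ^ 4 + Re (cis (pi / 4) * z) ^ 4 + Re (\<i> * cis (pi / 4) * z) ^ 4) = 3 * cmod z ^ 4" for z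
  proof -
    let ?x = "Re z" and ?y = "Im z"
    have s: "(1 / sqrt 2) ^ 4 = (1 / 4 :: real)"
      by (simp add: power_divide power4_eq_xxxx)
    have "Re (cis (pi / 4) * z) = 1 / sqrt 2 * (?x - ?y)" "Re (\<i> * cis (pi / 4) * z) = 1 / sqrt 2 * (- ?x - ?y)"
      unfolding cis_pi_quarter by (simp_all add: field_simps)
    then have 4: "Re (cis (pi / 4) * z) ^ 4 = 1 / 4 * (?x - ?y) ^ 4" "Re (\<i> * cis (pi / 4) * z) ^ 4 = 1 / 4 * (- ?x - ?y) ^ 4"
      by (simp_all only: power_mult_distrib s)
    have 2: "Re (1 * z) = ?x" "Re (\<i> * z) = - ?y" by simp_all
    have 3: "cmod z ^ 4 = (?x\<^sup>2 + ?y\<^sup>2)\<^sup>2"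
      by (simp flip: cmod_power2)
    have "2 * (x ^ 4 + (- y) ^ 4 + 1 / 4 * (x - y) ^ 4 + 1 / 4 * (- x - y) ^ 4) = 3 * (x\<^sup>2 + y\<^sup>2)\<^sup>2"
      for x y :: real
      by (simp add: power4_eq_xxxx power2_eq_square algebra_simps)
    then show ?thesis unfolding 2 3 4 .
  qed
  have "2 * (?S + ?S + ?S + ?S) = (\<Sum>N\<in>clifford_orbit M. 3 * cmod (?z N) ^ 4)"
    unfolding *[symmetric] sum_distrib_left[symmetric] sum.distrib
    using 1[OF clifford_group.one] 1[OF clifford_scalars(2)] 1[OF clifford_scalars(1)] 1[OF clifford_scalars(3)]
    by (simp only:)
  then show ?thesis by (simp add: sum_distrib_left)
qed

lemma cnj_trace: "cnj (trace A) = trace (conj_transpose A)"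
  by (simp add: trace_def)

lemma trace_gram_gram_real:
  fixes A :: "complex^2^'a" and M :: "complex^2^'b"
  shows "trace (conj_transpose A ** A ** (conj_transpose M ** M))
    = complex_of_real (Re (trace (conj_transpose A ** A ** (conj_transpose M ** M))))"
proof -
  have "cnj (trace (conj_transpose A ** A ** (conj_transpose M ** M)))
      = trace (conj_transpose M ** M ** (conj_transpose A ** A))"
    by (simp add: cnj_trace conj_transpose_mult)
  also have "\<dots> = trace (conj_transpose A ** A ** (conj_transpose M ** M))"
    by (rule trace_mul_sym)
  finally show ?thesis by (simp add: complex_eq_iff)
qed

lemma det_gram_real:
  fixes A :: "complex^2^'a"
  shows "det (conj_transpose A ** A) = complex_of_real (Re (det (conj_transpose A ** A)))"
proof -
  have "cnj ((conj_transpose A ** A) $ a $ b) = (conj_transpose A ** A) $ b $ a" for a b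
    by (simp add: gram_nth mult.commute)
  then have "cnj (det (conj_transpose A ** A)) = det (conj_transpose A ** A)"
    by (simp add: det_2 mult.commute)
  then show ?thesis by (simp add: complex_eq_iff)
qed

lemma sum_orbit_inner4:
  fixes M A :: "('r::finite) vspace" and n :: real
  defines "n \<equiv> real CARD('r \<Rightarrow> bool)"
    and "P \<equiv> conj_transpose M ** M" and "Q \<equiv> conj_transpose A ** A"
  shows "4 * (n ^ 3 - n) * (\<Sum>N\<in>clifford_orbit M. (A \<bullet> N) ^ 4)
    = 3 * card (clifford_orbit M) * ((n - 1) * (Re (trace (Q ** P)))\<^sup>2 + 2 * Re (det P) * Re (det Q))"
proof -
  let ?m = "real (card (clifford_orbit M))"
  let ?z = "\<lambda>N. trace (conj_transpose A ** N)"
  have z: "complex_of_real (cmod z) ^ 4 = z * z * cnj z * cnj z" for z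
  proof -
    have "complex_of_real (cmod z) ^ 4 = (complex_of_real (cmod z ^ 2)) ^ 2" by simp
    also have "\<dots> = (z * cnj z) ^ 2" by (simp only: complex_norm_square)
    finally show ?thesis by (simp add: power2_eq_square mult_ac)
  qed
  have "complex_of_real ((n ^ 3 - n) * (\<Sum>N\<in>clifford_orbit M. cmod (?z N) ^ 4))
     = complex_of_real (?m * (2 * (n - 1) * (Re (trace (Q ** P)))\<^sup>2 + 4 * Re (det P) * Re (det Q)))"
    using sum_trace4[where M = M and A = A]
    unfolding P_def Q_def of_real_mult of_real_add of_real_diff of_real_power of_real_sum z
      trace_gram_gram_real[symmetric] det_gram_real[symmetric] n_def
    by simp
  then have "(n ^ 3 - n) * (\<Sum>N\<in>clifford_orbit M. cmod (?z N) ^ 4)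
     = ?m * (2 * (n - 1) * (Re (trace (Q ** P)))\<^sup>2 + 4 * Re (det P) * Re (det Q))"
    by (simp only: of_real_eq_iff)
  moreover have "8 * (n ^ 3 - n) * (\<Sum>N\<in>clifford_orbit M. (A \<bullet> N) ^ 4)
    = 3 * ((n ^ 3 - n) * (\<Sum>N\<in>clifford_orbit M. cmod (?z N) ^ 4))"
    using sum_inner4[where M = M and A = A] by (simp add: algebra_simps)
  ultimately show ?thesis by (simp add: algebra_simps)
qed

lemma sum_orbit_inner2:
  fixes M A :: "('r::finite) vspace"
  shows "2 * real CARD('r \<Rightarrow> bool) * (\<Sum>N\<in>clifford_orbit M. (A \<bullet> N)\<^sup>2)
    = card (clifford_orbit M) * Re (trace (conj_transpose A ** A ** (conj_transpose M ** M)))"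
proof -
  let ?z = "\<lambda>N. trace (conj_transpose A ** N)"
  have "complex_of_real (real CARD('r \<Rightarrow> bool) * (\<Sum>N\<in>clifford_orbit M. (cmod (?z N))\<^sup>2))
    = complex_of_real (card (clifford_orbit M) * Re (trace (conj_transpose A ** A ** (conj_transpose M ** M))))"
    using sum_trace2[where M = M and A = A]
    unfolding of_real_mult of_real_sum of_real_power[symmetric] complex_norm_square trace_gram_gram_real[symmetric]
    by simp
  then have "real CARD('r \<Rightarrow> bool) * (\<Sum>N\<in>clifford_orbit M. (cmod (?z N))\<^sup>2)
    = card (clifford_orbit M) * Re (trace (conj_transpose A ** A ** (conj_transpose M ** M)))"
    by (simp only: of_real_eq_iff)
  then show ?thesis unfolding sum_inner2[symmetric] by (simp only: mult_ac)
qed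

section \<open>The space of defects\<close>

lemma E_spaceE:
  assumes "B \<in> E_space"
  obtains t u where "B $ 1 $ 1 = complex_of_real t" "B $ 2 $ 2 = - complex_of_real t" "B $ 1 $ 2 = u" "B $ 2 $ 1 = cnj u"
proof -
  have h: "cnj (B $ j $ i) = B $ i $ j" for i j
    using assms by (metis (mono_tags, lifting) E_space_def conj_transpose_nth mem_Collect_eq)
  have "B $ 1 $ 1 = complex_of_real (Re (B $ 1 $ 1))"
    using h[of 1 1] by (simp add: complex_eq_iff)
  moreover have "B $ 2 $ 2 = - B $ 1 $ 1"
    using assms by (simp add: E_space_def trace_def sum_2 eq_neg_iff_add_eq_0 add.commute)
  ultimately show ?thesis using that[of "Re (B $ 1 $ 1)" "B $ 1 $ 2"] h[of 1 2] by simp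
qed

lemma subspace_E_space: "subspace E_space"
proof -
  have "trace (c *\<^sub>R A) = c *\<^sub>R trace A" for c and A :: "complex ^ 2 ^ 2"
    by (simp add: trace_def scaleR_sum_right)
  moreover have "conj_transpose (A + B) = conj_transpose A + conj_transpose B"
    "conj_transpose (c *\<^sub>R A) = c *\<^sub>R conj_transpose A" for c and A B :: "complex ^ 2 ^ 2"
    by (simp_all add: vec_eq_iff)
  moreover have "conj_transpose 0 = (0 :: complex ^ 2 ^ 2)" by (simp add: vec_eq_iff)
  ultimately show ?thesis by (simp add: subspace_def E_space_def trace_add) (simp add: trace_def)
qed

lemma E_inner_eq_inner: "B \<in> E_space \<Longrightarrow> E_inner B C = B \<bullet> C"
  by (simp add: E_inner_def inner_eq_Re_trace E_space_def)

text \<open>The Pauli matrices Z, X, Y scaled to unit length, an orthonormal basis of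
  \<open>E_space\<close> for k = 0, 1, 2. Larger indices repeat Y.\<close>

definition pauli_vec :: "nat \<Rightarrow> complex ^ 2 ^ 2" where
  "pauli_vec k = (1 / sqrt 2) *\<^sub>R
    (if k = 0 then vector [vector [1, 0], vector [0, - 1]]
     else if k = 1 then vector [vector [0, 1], vector [1, 0]]
     else vector [vector [0, - \<i>], vector [\<i>, 0]])"

lemma pauli_vec_E: "pauli_vec k \<in> E_space"
  by (auto simp: pauli_vec_def E_space_def vec_eq_iff forall_2 trace_def sum_2)

lemma pauli_vec_inner:
  assumes "k < 3" "l < 3"
  shows "pauli_vec k \<bullet> pauli_vec l = (if k = l then 1 else 0)"
  using assms by (auto simp: less_Suc_eq numeral_3_eq_3 pauli_vec_def inner_vec_def sum_2)

lemma E_space_expand: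
  assumes "B \<in> E_space"
  shows "B = (\<Sum>k<3. (B \<bullet> pauli_vec k) *\<^sub>R pauli_vec k)"
proof -
  obtain t u where B: "B $ 1 $ 1 = complex_of_real t" "B $ 2 $ 2 = - complex_of_real t" "B $ 1 $ 2 = u" "B $ 2 $ 1 = cnj u"
    using E_spaceE[OF assms] by blast
  have s: "(B \<bullet> ((1 / sqrt 2) *\<^sub>R W)) *\<^sub>R ((1 / sqrt 2) *\<^sub>R W) = ((B \<bullet> W) / 2) *\<^sub>R W" for W :: "complex ^ 2 ^ 2"
    by simp
  have W: "B \<bullet> vector [vector [1, 0], vector [0, - 1]] = 2 * t" "B \<bullet> vector [vector [0, 1], vector [1, 0]] = 2 * Re u"
    "B \<bullet> vector [vector [0, - \<i>], vector [\<i>, 0]] = - 2 * Im u"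
    by (simp_all add: inner_vec_def sum_2 B)
  have "{..<3::nat} = {0, 1, 2}" by auto
  then have "(\<Sum>k<3. (B \<bullet> pauli_vec k) *\<^sub>R pauli_vec k)
      = (2 * t / 2) *\<^sub>R vector [vector [1, 0], vector [0, - 1]] + ((2 * Re u / 2) *\<^sub>R vector [vector [0, 1], vector [1, 0]]
        + (- 2 * Im u / 2) *\<^sub>R vector [vector [0, - \<i>], vector [\<i>, 0]])"
    unfolding pauli_vec_def s by (simp add: W)
  also have "\<dots> = B"
    by (simp add: vec_eq_iff forall_2 B complex_eq_iff)
  finally show ?thesis by simp
qed

lemma E_space_inner_expand:
  assumes "B \<in> E_space"
  shows "B \<bullet> C = (\<Sum>k<3. (pauli_vec k \<bullet> B) * (pauli_vec k \<bullet> C))"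
  by (subst E_space_expand[OF assms]) (simp add: inner_sum_left inner_sum_right inner_commute)

lemma dim_E_space: "dim E_space = 3"
proof (rule dim_unique)
  let ?S = "pauli_vec ` {..<3}"
  show "?S \<subseteq> E_space" using pauli_vec_E by auto
  show "E_space \<subseteq> span ?S"
  proof
    fix B assume "B \<in> E_space"
    show "B \<in> span ?S"
      by (subst E_space_expand[OF \<open>B \<in> E_space\<close>]) (intro span_sum span_scale span_base imageI)
  qed
  have nz: "k < 3 \<Longrightarrow> pauli_vec k \<noteq> 0" for k
    using pauli_vec_inner[of k k] by auto
  have inj: "inj_on pauli_vec {..<3}"
  proof (rule inj_onI)
    fix k l assume "k \<in> {..<3}" "l \<in> {..<3}" "pauli_vec k = pauli_vec l"
    then show "k = l" using pauli_vec_inner[of k l] pauli_vec_inner[of l l] by (auto split: if_splits)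
  qed
  show "independent ?S"
    by (rule pairwise_orthogonal_independent)
       (use nz in \<open>force simp: pairwise_def orthogonal_def pauli_vec_inner\<close>)+
  show "card ?S = 3" by (simp add: card_image inj)
qed

text \<open>A traceless Hermitian two by two matrix has eigenvalues e and -e and squared norm 2 e^2,
  so the determinant is (s + e)(s - e).\<close>

lemma det_mat_plus_E_space:
  assumes "Z \<in> E_space"
  shows "Re (det (mat (complex_of_real s) + Z)) = s\<^sup>2 - (Z \<bullet> Z) / 2"
proof -
  obtain t u where "Z $ 1 $ 1 = complex_of_real t" "Z $ 2 $ 2 = - complex_of_real t" "Z $ 1 $ 2 = u" "Z $ 2 $ 1 = cnj u"
    using E_spaceE[OF assms] by blast
  then show ?thesis
    by (simp add: det_2 mat_def inner_vec_def sum_2 inner_complex_def power2_eq_square algebra_simps)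
qed

text \<open>The mixed terms drop out because scalar and traceless parts are orthogonal for the trace
  form.\<close>

lemma trace_mat_plus_E_space:
  assumes "Y \<in> E_space" "Z \<in> E_space"
  shows "Re (trace ((mat (complex_of_real s) + Y) ** (mat (complex_of_real r) + Z))) = 2 * s * r + Y \<bullet> Z"
proof -
  obtain t u where "Z $ 1 $ 1 = complex_of_real t" "Z $ 2 $ 2 = - complex_of_real t" "Z $ 1 $ 2 = u" "Z $ 2 $ 1 = cnj u"
    using E_spaceE[OF assms(2)] by blast
  moreover obtain t' u' where "Y $ 1 $ 1 = complex_of_real t'" "Y $ 2 $ 2 = - complex_of_real t'" "Y $ 1 $ 2 = u'" "Y $ 2 $ 1 = cnj u'"
    using E_spaceE[OF assms(1)] by blast
  ultimately show ?thesis
    by (simp add: trace_def matrix_matrix_mult_def mat_def inner_vec_def sum_2 inner_complex_def algebra_simps)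
qed

section \<open>Gram matrices and the size of a defect\<close>

lemma trace_gram: "trace (conj_transpose A ** A) = complex_of_real ((norm A)\<^sup>2)"
proof -
  have "cnj (trace (conj_transpose A ** A)) = trace (conj_transpose A ** A)"
    by (simp add: cnj_trace conj_transpose_mult)
  moreover have "Re (trace (conj_transpose A ** A)) = (norm A)\<^sup>2"
    by (simp add: power2_norm_eq_inner inner_eq_Re_trace)
  ultimately show ?thesis by (simp add: complex_eq_iff)
qed

lemma gram_decomposition:
  fixes A :: "complex ^ 2 ^ 'm"
  obtains Y where "Y \<in> E_space" "conj_transpose A ** A = mat (complex_of_real ((norm A)\<^sup>2 / 2)) + Y"
proof (rule that)
  let ?Y = "conj_transpose A ** A - mat (complex_of_real ((norm A)\<^sup>2 / 2))"
  have "conj_transpose (conj_transpose A ** A) = conj_transpose A ** A"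
    by (simp add: conj_transpose_mult)
  then have "conj_transpose ?Y = ?Y"
    by (simp add: vec_eq_iff mat_def)
  moreover have "trace ?Y = 0"
    by (simp add: trace_sub trace_gram) (simp add: trace_def mat_def sum_2)
  ultimately show "?Y \<in> E_space" by (simp add: E_space_def)
qed simp

lemma gram_eq_defect: "conj_transpose M ** M = mat (complex_of_real (1 / 2)) + defect M"
  by (simp add: defect_def)

lemma defect_E_space:
  assumes "norm M = 1"
  shows "defect M \<in> E_space"
proof -
  obtain Y where "Y \<in> E_space" "conj_transpose M ** M = mat (complex_of_real ((norm M)\<^sup>2 / 2)) + Y"
    by (rule gram_decomposition)
  with assms show ?thesis by (simp add: defect_def)
qed

text \<open>This is the Cauchy-Schwarz inequality for the two columns.\<close>

lemma det_gram_nonneg: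
  fixes M :: "complex ^ 2 ^ 'm"
  shows "0 \<le> Re (det (conj_transpose M ** M))"
proof -
  let ?P = "conj_transpose M ** M"
  let ?L = "\<lambda>a. L2_set (\<lambda>x. cmod (M $ x $ a)) UNIV"
  have d: "?P $ a $ a = complex_of_real ((?L a)\<^sup>2)" for a
  proof -
    have "(?L a)\<^sup>2 = (\<Sum>x\<in>UNIV. (cmod (M $ x $ a))\<^sup>2)"
      by (simp add: L2_set_def sum_nonneg)
    then show ?thesis
      unfolding gram_nth by (simp only: of_real_sum complex_norm_square mult.commute)
  qed
  have "?P $ 2 $ 1 = cnj (?P $ 1 $ 2)" by (simp add: gram_nth mult.commute)
  then have "?P $ 1 $ 2 * ?P $ 2 $ 1 = complex_of_real ((cmod (?P $ 1 $ 2))\<^sup>2)"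
    by (simp only: complex_norm_square)
  then have "Re (det ?P) = (?L 1)\<^sup>2 * (?L 2)\<^sup>2 - (cmod (?P $ 1 $ 2))\<^sup>2"
    by (simp add: det_2 d del: of_real_power)
  moreover have "cmod (?P $ 1 $ 2) \<le> ?L 1 * ?L 2"
  proof -
    have "cmod (?P $ 1 $ 2) \<le> (\<Sum>x\<in>UNIV. \<bar>cmod (M $ x $ 1)\<bar> * \<bar>cmod (M $ x $ 2)\<bar>)"
      unfolding gram_nth by (rule order_trans[OF norm_sum]) (simp add: norm_mult)
    also have "\<dots> \<le> ?L 1 * ?L 2" by (rule L2_set_mult_ineq)
    finally show ?thesis .
  qed
  then have "(cmod (?P $ 1 $ 2))\<^sup>2 \<le> (?L 1)\<^sup>2 * (?L 2)\<^sup>2"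
    unfolding power_mult_distrib[symmetric] by (intro power_mono) auto
  ultimately show ?thesis by simp
qed

text \<open>The Gram determinant equals 1/4 minus half the squared defect. Equality therefore means
  linearly dependent columns.\<close>

lemma defect_inner_le:
  assumes "norm M = 1"
  shows "defect M \<bullet> defect M \<le> 1 / 2"
  using det_gram_nonneg[of M] det_mat_plus_E_space[OF defect_E_space[OF assms], of "1 / 2"]
  by (simp add: gram_eq_defect power2_eq_square)

section \<open>Completions\<close>

lemma DIM_qvec: "real DIM(('r::finite) qvec) + 1 = 2 * 2 ^ CARD('r) + 1"
  by (simp add: card_fun)

text \<open>The third fact is the first one summed over an orthonormal basis, so its numerator 3 is
  the dimension of \<open>E_space\<close>.\<close>

lemma completion_inner:
  fixes x :: "'i \<Rightarrow> ('r::finite) vspace"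
  assumes "is_completion I v x"
  shows "B \<in> E_space \<Longrightarrow> C \<in> E_space \<Longrightarrow>
      (\<Sum>i\<in>I. v i * (B \<bullet> defect (x i)) * (C \<bullet> defect (x i))) = (B \<bullet> C) / (2 * (2 * 2 ^ CARD('r) + 1))"
    and "B \<in> E_space \<Longrightarrow> (\<Sum>i\<in>I. v i * (B \<bullet> defect (x i))) = 0"
    and "(\<Sum>i\<in>I. v i * (defect (x i) \<bullet> defect (x i))) = 3 / (2 * (2 * 2 ^ CARD('r) + 1))"
proof -
  have E: "i \<in> I \<Longrightarrow> defect (x i) \<in> E_space" for i
    using assms by (intro defect_E_space) (auto simp: is_completion_def)
  show 1: "(\<Sum>i\<in>I. v i * (B \<bullet> defect (x i)) * (C \<bullet> defect (x i))) = (B \<bullet> C) / (2 * (2 * 2 ^ CARD('r) + 1))"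
    if "B \<in> E_space" "C \<in> E_space" for B C
  proof -
    have "(\<Sum>i\<in>I. v i * E_inner B (defect (x i)) * E_inner C (defect (x i)))
        = 1 / (2 * (real DIM('r qvec) + 1)) * E_inner B C"
      using assms that by (auto simp: is_completion_def)
    then show ?thesis unfolding DIM_qvec using that by (simp add: E_inner_eq_inner)
  qed
  have "(\<Sum>i\<in>I. v i * (B \<bullet> defect (x i))) = B \<bullet> (\<Sum>i\<in>I. v i *\<^sub>R defect (x i))"
    by (simp add: inner_sum_right)
  then show "(\<Sum>i\<in>I. v i * (B \<bullet> defect (x i))) = 0"
    using assms by (simp add: is_completion_def)
  have "(\<Sum>i\<in>I. v i * (defect (x i) \<bullet> defect (x i)))
      = (\<Sum>i\<in>I. \<Sum>k<3. v i * (pauli_vec k \<bullet> defect (x i)) * (pauli_vec k \<bullet> defect (x i)))"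
    by (intro sum.cong refl) (simp add: E_space_inner_expand[OF E] sum_distrib_left mult.assoc)
  also have "\<dots> = (\<Sum>k<3. (pauli_vec k \<bullet> pauli_vec k) / (2 * (2 * 2 ^ CARD('r) + 1)))"
    by (subst sum.swap) (simp add: 1 pauli_vec_E)
  also have "\<dots> = 3 / (2 * (2 * 2 ^ CARD('r) + 1))"
    by (simp add: pauli_vec_inner)
  finally show "(\<Sum>i\<in>I. v i * (defect (x i) \<bullet> defect (x i))) = 3 / (2 * (2 * 2 ^ CARD('r) + 1))" .
qed

text \<open>The mean squared defect is prescribed, and each correction orbit contributes at most
  half its weight to it.\<close>

lemma correction_weight_ge:
  fixes x :: "'i \<Rightarrow> ('r::finite) vspace"
  assumes "is_completion I v x"
  shows "3 / (2 * 2 ^ CARD('r) + 1) \<le> correction_weight I v x"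
proof -
  have fin: "finite I" and v: "\<And>i. i \<in> I \<Longrightarrow> 0 < v i" and n: "\<And>i. i \<in> I \<Longrightarrow> norm (x i) = 1"
    using assms by (auto simp: is_completion_def)
  have "3 / (2 * 2 ^ CARD('r) + 1) / 2 = (\<Sum>i\<in>I. v i * (defect (x i) \<bullet> defect (x i)))"
    by (simp only: completion_inner(3)[OF assms] divide_divide_eq_left mult.commute)
  also have "\<dots> = (\<Sum>i | i \<in> I \<and> defect (x i) \<noteq> 0. v i * (defect (x i) \<bullet> defect (x i)))"
    by (rule sum.mono_neutral_right[OF fin]) auto
  also have "\<dots> \<le> (\<Sum>i | i \<in> I \<and> defect (x i) \<noteq> 0. v i * (1 / 2))"
    by (intro sum_mono mult_left_mono defect_inner_le) (use v n in \<open>auto intro: less_imp_le\<close>)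
  also have "\<dots> = correction_weight I v x / 2"
    by (simp add: correction_weight_def sum_divide_distrib)
  finally show ?thesis by (subst (asm) divide_le_cancel) simp
qed

lemma card_correction_orbits_ge:
  fixes x :: "'i \<Rightarrow> ('r::finite) vspace"
  assumes "is_completion I v x"
  shows "4 \<le> card (correction_orbits I x)"
proof -
  have fin: "finite I" and v: "\<And>i. i \<in> I \<Longrightarrow> 0 < v i" and n: "\<And>i. i \<in> I \<Longrightarrow> norm (x i) = 1"
    and sum0: "(\<Sum>i\<in>I. v i *\<^sub>R defect (x i)) = 0"
    using assms by (auto simp: is_completion_def)
  define J where "J = {i \<in> I. defect (x i) \<noteq> 0}"
  define D where "D = (\<lambda>i. defect (x i)) ` J"
  have finJ: "finite J" and finD: "finite D" using fin by (auto simp: J_def D_def)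
  have DE: "D \<subseteq> E_space" using n by (auto simp: D_def J_def intro: defect_E_space)
  \<comment> \<open>Otherwise some nonzero \<open>B\<close> in \<open>E_space\<close> is orthogonal
    to every defect, and the second-order condition at the pair \<open>B\<close>, \<open>B\<close>
    has left side 0 and a positive right side.\<close>
  have ED: "E_space \<subseteq> span D"
  proof (rule ccontr)
    assume nsub: "\<not> E_space \<subseteq> span D"
    have sp: "span E_space = E_space" using subspace_E_space by (rule span_eq_iff[THEN iffD2])
    have "span D \<subseteq> E_space" using DE span_mono[OF DE] sp by simp
    with nsub have "span D \<subset> span E_space" unfolding sp by blast
    then obtain B where B: "B \<noteq> 0" "B \<in> E_space" "\<And>y. y \<in> span D \<Longrightarrow> orthogonal B y"
      using orthogonal_to_subspace_exists_gen[of D E_space] sp by metis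
    have "B \<bullet> defect (x i) = 0" if "i \<in> I" for i
    proof (cases "defect (x i) = 0")
      case False
      then have "defect (x i) \<in> span D" using that by (intro span_base) (auto simp: D_def J_def)
      then show ?thesis using B(3) by (simp add: orthogonal_def)
    qed simp
    then have "(B \<bullet> B) / (2 * (2 * 2 ^ CARD('r) + 1)) = 0"
      using completion_inner(1)[OF assms B(2) B(2)] by simp
    moreover have "2 * (2 * 2 ^ CARD('r) + 1) \<noteq> (0::real)"
      by (rule less_imp_neq[symmetric]) (intro mult_pos_pos add_pos_pos, auto)
    ultimately show False using B(1) by simp
  qed
  have "\<not> card D \<le> 3"
  proof
    assume "card D \<le> 3"
    \<comment> \<open>A spanning set of at most three vectors in a three-dimensional space is
      independent, which the vanishing positive combination of defects contradicts.\<close>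
    then have ind: "independent D"
      by (intro card_le_dim_spanning[OF DE ED finD]) (simp add: dim_E_space)
    have "D \<noteq> {}"
    proof
      assume "D = {}"
      then have "dim E_space \<le> 0" using dim_le_card[OF ED finD] by simp
      then show False by (simp add: dim_E_space)
    qed
    then obtain e where e: "e \<in> D" by auto
    \<comment> \<open>Several indices may share a defect; their collected weights are still
      positive.\<close>
    let ?c = "\<lambda>d. \<Sum>i | i \<in> J \<and> defect (x i) = d. v i"
    have "0 = (\<Sum>i\<in>I. v i *\<^sub>R defect (x i))" by (simp add: sum0)
    also have "\<dots> = (\<Sum>i\<in>J. v i *\<^sub>R defect (x i))"
      unfolding J_def by (rule sum.mono_neutral_right[OF fin]) auto
    also have "\<dots> = (\<Sum>d\<in>D. \<Sum>i | i \<in> J \<and> defect (x i) = d. v i *\<^sub>R defect (x i))"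
      unfolding D_def by (rule sum.image_gen[OF finJ])
    also have "\<dots> = (\<Sum>d\<in>D. ?c d *\<^sub>R d)"
      by (intro sum.cong refl) (simp add: scaleR_sum_left)
    finally have "(\<Sum>d\<in>D. ?c d *\<^sub>R d) = 0" by simp
    from independentD[OF ind finD order_refl this e] have "?c e = 0" .
    moreover have "0 < ?c e"
      using e fin v by (intro sum_pos) (auto simp: D_def J_def)
    ultimately show False by simp
  qed
  then have "4 \<le> card D" by simp
  \<comment> \<open>The defect is constant on an orbit, so it is a function of the orbit and any
    member chosen by \<open>SOME\<close> computes it. Hence there are at least as many orbits as
    defects.\<close>
  also have "D = (\<lambda>S. defect (SOME N. N \<in> S)) ` correction_orbits I x"
  proof -
    have "defect (SOME N. N \<in> clifford_orbit M) = defect M" for M :: "'r vspace"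
      by (intro defect_clifford_orbit someI[of "\<lambda>N. N \<in> clifford_orbit M" M] clifford_orbit_self)
    then show ?thesis by (simp add: D_def correction_orbits_def J_def image_image)
  qed
  also have "card \<dots> \<le> card (correction_orbits I x)"
    using fin by (intro card_image_le) (simp add: correction_orbits_def)
  finally show ?thesis .
qed

section \<open>Regular tetrahedra\<close>

text \<open>Equal distances between unit vectors mean a common inner product c. The sum of the
  vertices has the same inner product 1 + 3c with each of them, so it is orthogonal to their
  differences; by affine independence these span \<open>V\<close>. Hence the sum is zero and c =
  -1/3, and the frame operator multiplies each vertex by 1 - c = 4/3.\<close>

lemma regular_tetrahedron_frame:
  fixes T :: "'a::euclidean_space set"
  assumes T: "regular_tetrahedron T" and V: "subspace V" "dim V = 3" "T \<subseteq> V"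
    and unit: "\<And>t. t \<in> T \<Longrightarrow> t \<bullet> t = 1"
  shows "\<Sum>T = 0" and "B \<in> V \<Longrightarrow> (\<Sum>t\<in>T. (B \<bullet> t) *\<^sub>R t) = (4 / 3) *\<^sub>R B"
proof -
  have card: "card T = 4" and ind: "\<not> affine_dependent T"
    using T by (auto simp: regular_tetrahedron_def)
  then have fin: "finite T" by (simp add: card_ge_0_finite)
  obtain a where a: "\<And>p q. p \<in> T \<Longrightarrow> q \<in> T \<Longrightarrow> p \<noteq> q \<Longrightarrow> dist p q = a"
    using T by (auto simp: regular_tetrahedron_def)
  define c where "c = 1 - a\<^sup>2 / 2"
  have c: "p \<bullet> q = c" if "p \<in> T" "q \<in> T" "p \<noteq> q" for p q
  proof -
    have "a\<^sup>2 = (p - q) \<bullet> (p - q)"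
      using a[OF that] by (simp add: dist_norm power2_norm_eq_inner[symmetric])
    then show ?thesis
      using unit[OF that(1)] unit[OF that(2)]
      by (simp add: c_def inner_diff_left inner_diff_right inner_commute[of q p] field_simps)
  qed
  have sc: "(\<Sum>q\<in>T. p \<bullet> q) = 1 + 3 * c" if "p \<in> T" for p
  proof -
    have "(\<Sum>q\<in>T. p \<bullet> q) = p \<bullet> p + (\<Sum>q\<in>T - {p}. p \<bullet> q)"
      using fin that by (rule sum.remove)
    also have "(\<Sum>q\<in>T - {p}. p \<bullet> q) = (\<Sum>q\<in>T - {p}. c)"
      using that by (intro sum.cong) (auto simp: c)
    finally show ?thesis using that card by (simp add: unit fin)
  qed
  obtain p where p: "p \<in> T" using card by fastforce
  define D where "D = (\<lambda>x. - p + x) ` (T - {p})"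
  have "independent D"
    using ind affine_dependent_iff_dependent2[OF p] by (simp add: D_def)
  moreover have "D \<subseteq> V"
    using V p by (auto simp: D_def intro!: subspace_diff)
  moreover have "card D = 3"
    using card p fin by (simp add: D_def card_image)
  ultimately have VD: "V \<subseteq> span D"
    using V(2) by (intro card_ge_dim_independent) auto
  let ?s = "\<Sum>T"
  have sV: "?s \<in> V" using V by (intro subspace_sum) auto
  have sT: "q \<bullet> ?s = 1 + 3 * c" if "q \<in> T" for q
    using sc[OF that] by (simp add: inner_sum_right)
  have "?s \<bullet> d = 0" if "d \<in> D" for d
    using that p sT by (auto simp: D_def inner_commute[of ?s] inner_diff_left)
  then have "orthogonal ?s y" if "y \<in> span D" for y
    using that by (intro orthogonal_to_span[OF that]) (auto simp: orthogonal_def inner_commute)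
  then have "orthogonal ?s ?s" using sV VD by blast
  then show s0: "\<Sum>T = 0" by (simp add: orthogonal_def)
  have c3: "c = - 1 / 3"
    using sT[OF p] s0 by simp
  have VT: "V \<subseteq> span T"
  proof -
    have "D \<subseteq> span T"
      using p unfolding D_def by (auto intro!: span_diff intro: span_base)
    then show ?thesis using VD by (meson order_trans span_minimal subspace_span)
  qed
  let ?f = "\<lambda>B. \<Sum>t\<in>T. (B \<bullet> t) *\<^sub>R t"
  have fT: "?f q = (4 / 3) *\<^sub>R q" if "q \<in> T" for q
  proof -
    \<comment> \<open>Every vertex gets coefficient c, and \<open>q\<close> itself an additional 1 -
      c.\<close>
    have "?f q = (\<Sum>t\<in>T. (if t = q then (1 - c) *\<^sub>R t else 0) + c *\<^sub>R t)"
      using that by (intro sum.cong refl) (auto simp: c unit algebra_simps)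
    also have "\<dots> = (1 - c) *\<^sub>R q + c *\<^sub>R ?s"
      using that fin by (simp add: sum.distrib scaleR_sum_right)
    finally show ?thesis by (simp add: s0 c3)
  qed
  have sub: "subspace {B. ?f B = (4 / 3) *\<^sub>R B}"
    by (auto simp: subspace_def inner_add_left scaleR_add_left sum.distrib scaleR_add_right
        scaleR_left_commute scaleR_sum_right[symmetric] simp flip: scaleR_scaleR)
  have "span T \<subseteq> {B. ?f B = (4 / 3) *\<^sub>R B}"
    using fT sub by (intro span_minimal) auto
  then show "B \<in> V \<Longrightarrow> ?f B = (4 / 3) *\<^sub>R B" using VT by blast
qed

section \<open>Mixtures of orbit measures\<close>

lemma pmf_orbit_measure:
  "pmf (orbit_measure M) N = indicator (clifford_orbit M) N / card (clifford_orbit M)"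
  unfolding orbit_measure_def
  using finite_clifford_orbit clifford_orbit_self by (intro pmf_of_set) auto

lemma card_clifford_orbit_pos: "0 < card (clifford_orbit M)"
  using finite_clifford_orbit clifford_orbit_self by (auto simp: card_gt_0_iff)

lemma pmf_orbit_measure_mult:
  assumes "g \<in> clifford_group"
  shows "pmf (orbit_measure M) (g ** N) = pmf (orbit_measure M) N"
proof -
  have "g ** N \<in> clifford_orbit M \<longleftrightarrow> N \<in> clifford_orbit M"
    using clifford_orbit_mult[OF assms, of N M]
      clifford_orbit_mult[OF clifford_conj_transpose[OF assms], of "g ** N" M]
    by (auto simp: clifford_cancel[OF assms])
  then show ?thesis by (simp add: pmf_orbit_measure indicator_def)
qed

context
  fixes I :: "'i set" and v :: "'i \<Rightarrow> real" and x :: "'i \<Rightarrow> ('r::finite) vspace"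
  assumes fin: "finite I" and v_pos: "\<And>i. i \<in> I \<Longrightarrow> 0 < v i" and v_sum: "(\<Sum>i\<in>I. v i) = 1"
begin

lemma pmf_mixture: "pmf (orbit_mixture I v x) N = (\<Sum>i\<in>I. v i * pmf (orbit_measure (x i)) N)"
  by (rule pmf_orbit_mixture[OF fin _ v_sum]) (use v_pos in \<open>auto intro: less_imp_le\<close>)

lemma set_pmf_mixture: "set_pmf (orbit_mixture I v x) \<subseteq> (\<Union>i\<in>I. clifford_orbit (x i))"
proof
  fix N assume "N \<in> set_pmf (orbit_mixture I v x)"
  then have "(\<Sum>i\<in>I. v i * pmf (orbit_measure (x i)) N) \<noteq> 0"
    by (simp add: set_pmf_iff pmf_mixture)
  then obtain i where "i \<in> I" "pmf (orbit_measure (x i)) N \<noteq> 0"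
    by (metis (mono_tags, lifting) mult_zero_right sum.neutral)
  then show "N \<in> (\<Union>i\<in>I. clifford_orbit (x i))"
    by (auto simp: pmf_orbit_measure indicator_def split: if_splits)
qed

lemma finite_set_pmf_mixture: "finite (set_pmf (orbit_mixture I v x))"
  by (rule finite_subset[OF set_pmf_mixture]) (simp add: fin finite_clifford_orbit)

lemma map_pmf_mixture:
  assumes "g \<in> clifford_group"
  shows "map_pmf (\<lambda>N. g ** N) (orbit_mixture I v x) = orbit_mixture I v x"
proof (rule pmf_eqI)
  fix N
  have inj: "inj (\<lambda>N :: 'r vspace. g ** N)"
    by (rule inj_on_inverseI[of _ "\<lambda>N. conj_transpose g ** N"]) (simp add: clifford_cancel[OF assms])
  have "pmf (map_pmf (\<lambda>N. g ** N) (orbit_mixture I v x)) (g ** (conj_transpose g ** N))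
      = pmf (orbit_mixture I v x) (conj_transpose g ** N)"
    by (rule pmf_map_inj'[OF inj])
  then show "pmf (map_pmf (\<lambda>N. g ** N) (orbit_mixture I v x)) N = pmf (orbit_mixture I v x) N"
    by (simp add: clifford_cancel[OF assms] pmf_mixture pmf_orbit_measure_mult[OF clifford_conj_transpose[OF assms]])
qed

text \<open>The expectation is computed on the union of the orbits; where orbits of different
  indices coincide, their masses add.\<close>

lemma expectation_mixture:
  "measure_pmf.expectation (orbit_mixture I v x) f
    = (\<Sum>i\<in>I. v i / card (clifford_orbit (x i)) * (\<Sum>N\<in>clifford_orbit (x i). f N))" for f :: "'r vspace \<Rightarrow> real"
proof -
  let ?A = "\<Union>i\<in>I. clifford_orbit (x i)"
  have finA: "finite ?A" using fin by (simp add: finite_clifford_orbit)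
  have "measure_pmf.expectation (orbit_mixture I v x) f = (\<Sum>N\<in>?A. f N * pmf (orbit_mixture I v x) N)"
    by (rule integral_measure_pmf_real[OF finA]) (use set_pmf_mixture in auto)
  also have "\<dots> = (\<Sum>i\<in>I. \<Sum>N\<in>?A. f N * (v i * pmf (orbit_measure (x i)) N))"
    unfolding pmf_mixture sum_distrib_left by (rule sum.swap)
  also have "\<dots> = (\<Sum>i\<in>I. \<Sum>N\<in>clifford_orbit (x i). v i / card (clifford_orbit (x i)) * f N)"
  proof (rule sum.cong[OF refl])
    fix i assume "i \<in> I"
    then show "(\<Sum>N\<in>?A. f N * (v i * pmf (orbit_measure (x i)) N))
        = (\<Sum>N\<in>clifford_orbit (x i). v i / card (clifford_orbit (x i)) * f N)"
      by (intro sum.mono_neutral_cong_right finA) (auto simp: pmf_orbit_measure)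
  qed
  finally show ?thesis by (simp only: sum_distrib_left)
qed

end

lemma uminus_eq_mat_mult: "uminus = (\<lambda>N :: ('r::finite) vspace. mat (- 1) ** N)"
  by (simp add: fun_eq_iff vec_eq_iff mat_mult_nth)

lemma completion_design_5:
  fixes x :: "'i \<Rightarrow> ('r::finite) vspace"
  assumes "is_completion I v x"
  shows "weighted_spherical_design 5 (orbit_mixture I v x)"
proof -
  let ?\<mu> = "orbit_mixture I v x"
  have fin: "finite I" and v: "\<And>i. i \<in> I \<Longrightarrow> 0 < v i" and v1: "(\<Sum>i\<in>I. v i) = 1"
    and nx: "\<And>i. i \<in> I \<Longrightarrow> norm (x i) = 1"
    using assms by (auto simp: is_completion_def)
  note mix = fin v v1
  have E: "measure_pmf.expectation ?\<mu> f
    = (\<Sum>i\<in>I. v i / card (clifford_orbit (x i)) * (\<Sum>N\<in>clifford_orbit (x i). f N))" for f :: "'r vspace \<Rightarrow> real"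
    by (rule expectation_mixture[OF mix])
  define n where "n = real CARD('r \<Rightarrow> bool)"
  have n2: "n = 2 ^ CARD('r)" by (simp add: n_def card_fun)
  have n1: "1 < n" unfolding n2 by simp
  have n3: "n ^ 3 - n = n * (n\<^sup>2 - 1)" by (simp add: algebra_simps power2_eq_square power3_eq_cube)
  show ?thesis
  proof (rule weighted_spherical_design_5I)
    show "finite (set_pmf ?\<mu>)" by (rule finite_set_pmf_mixture[OF mix])
    show "set_pmf ?\<mu> \<subseteq> sphere 0 1"
      using set_pmf_mixture[OF mix, of x] nx by (auto simp: norm_clifford_orbit subset_iff)
    show "map_pmf uminus ?\<mu> = ?\<mu>"
      unfolding uminus_eq_mat_mult by (rule map_pmf_mixture[OF mix clifford_scalars(4)])
  next
    fix A :: "'r vspace"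
    obtain Y where Y: "Y \<in> E_space" "conj_transpose A ** A = mat (complex_of_real ((norm A)\<^sup>2 / 2)) + Y"
      by (rule gram_decomposition)
    define t where "t = (norm A)\<^sup>2"
    define y where "y = Y \<bullet> Y"
    let ?Z = "\<lambda>i. defect (x i)"
    \<comment> \<open>The right side of \<open>sum_orbit_inner4\<close> with both Gram matrices
      split into scalar and traceless parts: the trace becomes
      \<open>t / 2 + Y \<bullet> ?Z i\<close>, and the two determinants become 1/4 - |Z|^2/2 and
      t^2/4 - |Y|^2/2.\<close>
    let ?F = "\<lambda>i. (n - 1) * (t / 2 + Y \<bullet> ?Z i)\<^sup>2 + 2 * (1 / 4 - (?Z i \<bullet> ?Z i) / 2) * (t\<^sup>2 / 4 - y / 2)"
    have orb: "v i / card (clifford_orbit (x i)) * (4 * (n ^ 3 - n) * (\<Sum>N\<in>clifford_orbit (x i). (A \<bullet> N) ^ 4)) = 3 * (v i * ?F i)"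
      if i: "i \<in> I" for i
    proof -
      have Z: "?Z i \<in> E_space" using nx[OF i] by (rule defect_E_space)
      have tr: "Re (trace (conj_transpose A ** A ** (conj_transpose (x i) ** x i))) = t / 2 + Y \<bullet> ?Z i"
        unfolding Y(2) gram_eq_defect[of "x i"] trace_mat_plus_E_space[OF Y(1) Z] by (simp add: t_def)
      have dQ: "Re (det (conj_transpose A ** A)) = t\<^sup>2 / 4 - y / 2"
        unfolding Y(2) det_mat_plus_E_space[OF Y(1)] by (simp add: t_def y_def power_divide)
      have dP: "Re (det (conj_transpose (x i) ** x i)) = 1 / 4 - (?Z i \<bullet> ?Z i) / 2"
        unfolding gram_eq_defect det_mat_plus_E_space[OF Z] by (simp add: power_divide)
      have "4 * (n ^ 3 - n) * (\<Sum>N\<in>clifford_orbit (x i). (A \<bullet> N) ^ 4) = 3 * card (clifford_orbit (x i)) * ?F i"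
        unfolding n_def sum_orbit_inner4 tr dP dQ ..
      then show ?thesis using card_clifford_orbit_pos[of "x i"] by simp
    qed
    let ?k = "2 * (2 * n + 1)"
    have k: "?k > 0" using n1 by simp
    note m = completion_inner[OF assms, folded n2]
    have "(\<Sum>i\<in>I. v i * ?F i) = (\<Sum>i\<in>I. ((n - 1) * t\<^sup>2 / 4 + (t\<^sup>2 / 4 - y / 2) / 2) * v i + (n - 1) * t * (v i * (Y \<bullet> ?Z i))
        + (n - 1) * (v i * (Y \<bullet> ?Z i) * (Y \<bullet> ?Z i)) - (t\<^sup>2 / 4 - y / 2) * (v i * (?Z i \<bullet> ?Z i)))"
      by (intro sum.cong refl) (simp add: field_simps power2_eq_square)
    also have "\<dots> = (n - 1) * t\<^sup>2 / 4 + (t\<^sup>2 / 4 - y / 2) / 2 + (n - 1) * (y / ?k) - (t\<^sup>2 / 4 - y / 2) * (3 / ?k)"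
      unfolding sum.distrib sum_subtractf sum_distrib_left[symmetric] m(1)[OF Y(1) Y(1)] m(2)[OF Y(1)] m(3) v1 y_def
      by simp
    also have "\<dots> = (n ^ 2 - 1) * t\<^sup>2 / ?k"
    proof -
      \<comment> \<open>With the reciprocal as a variable subject to a linear equation, the claim is
        a polynomial identity in T = t^2/4 and W = y/2, doubled to clear halves. The terms in W
        collect to W ((2n + 1) i - 1/2) = 0.\<close>
      define i where "i = 1 / ?k"
      have i: "(4 * n + 2) * i = 1" using k by (simp add: i_def)
      have dbl: "2 * ((n - 1) * T + (T - W) / 2 + (n - 1) * (2 * W * i) - (T - W) * (3 * i)) = 2 * ((n\<^sup>2 - 1) * (4 * T) * i)" for T W
        using i by (simp add: algebra_simps) algebra
      have "(n - 1) * T + (T - W) / 2 + (n - 1) * (2 * W * i) - (T - W) * (3 * i) = (n\<^sup>2 - 1) * (4 * T) * i" for T W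
        by (rule iffD1[OF mult_left_cancel dbl]) simp
      from this[of "t\<^sup>2 / 4" "y / 2"] show ?thesis by (simp add: i_def)
    qed
    \<comment> \<open>the contributions of \<open>y\<close> cancel, so no term in \<open>det Q\<close> is left\<close>
    finally have F: "(\<Sum>i\<in>I. v i * ?F i) = (n ^ 2 - 1) * t\<^sup>2 / ?k" .
    have "4 * (n ^ 3 - n) * measure_pmf.expectation ?\<mu> (\<lambda>N. (A \<bullet> N) ^ 4)
      = (\<Sum>i\<in>I. 4 * (n ^ 3 - n) * (v i / card (clifford_orbit (x i)) * (\<Sum>N\<in>clifford_orbit (x i). (A \<bullet> N) ^ 4)))"
      unfolding E by (rule sum_distrib_left)
    also have "\<dots> = (\<Sum>i\<in>I. 3 * (v i * ?F i))"
      by (rule sum.cong[OF refl]) (subst mult.left_commute, rule orb)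
    also have "\<dots> = 3 * (\<Sum>i\<in>I. v i * ?F i)"
      by (rule sum_distrib_left[symmetric])
    also have "\<dots> = 4 * (n ^ 3 - n) * (3 / (4 * n * ?k) * t\<^sup>2)"
    proof -
      have "3 * (p * T / k) = 4 * (n * p) * (3 / (4 * n * k) * T)" if "k > 0" for k p T
        using n1 that by (simp add: field_simps)
      from this[OF k] show ?thesis
        unfolding F by (simp only: n3)
    qed
    finally have "4 * (n ^ 3 - n) * measure_pmf.expectation ?\<mu> (\<lambda>N. (A \<bullet> N) ^ 4) = 4 * (n ^ 3 - n) * (3 / (4 * n * ?k) * t\<^sup>2)" .
    \<comment> \<open>There is at least one qubit, so n > 1 and the factor n^3 - n can be
      cancelled.\<close>
    moreover have "0 < n * (n\<^sup>2 - 1)"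
      using n1 one_less_power[OF n1 pos2] by (intro mult_pos_pos) linarith+
    then have "4 * (n ^ 3 - n) \<noteq> 0" unfolding n3 by linarith
    ultimately have "measure_pmf.expectation ?\<mu> (\<lambda>N. (A \<bullet> N) ^ 4) = 3 / (4 * n * ?k) * t\<^sup>2"
      by (simp only: mult_cancel_left) simp
    then show "measure_pmf.expectation ?\<mu> (\<lambda>N. (A \<bullet> N) ^ 4) = 3 / (4 * n * ?k) * norm A ^ 4"
      by (simp add: t_def flip: power_mult)
  qed
qed

text \<open>Makes the results on mixtures available for a single orbit.\<close>

lemma orbit_measure_eq_mixture: "orbit_measure M = orbit_mixture {()} (\<lambda>_. 1) (\<lambda>_. M)"
  by (rule pmf_eqI) (subst pmf_mixture, auto)

lemma weighted_spherical_design_mono: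
  "s \<le> t \<Longrightarrow> weighted_spherical_design t \<mu> \<Longrightarrow> weighted_spherical_design s \<mu>"
  unfolding weighted_spherical_design_def polynomials_deg_le_def by (blast intro: order_trans)

text \<open>With Gram matrix 1/2 the trace in \<open>sum_orbit_inner2\<close> depends on
  \<open>A\<close> only through its norm. The scalar -1 in the group makes the orbit antipodal, so
  it even has strength 3.\<close>

lemma balanced_orbit_design_2:
  fixes M :: "('r::finite) vspace"
  assumes "norm M = 1" "defect M = 0"
  shows "spherical_design 2 (clifford_orbit M)"
proof -
  have mix: "finite {()}" "\<And>i. i \<in> {()} \<Longrightarrow> 0 < (1::real)" "(\<Sum>i\<in>{()}. 1) = (1::real)" by auto
  let ?n = "real CARD('r \<Rightarrow> bool)"
  have sub: "clifford_orbit M \<subseteq> sphere 0 1"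
    using assms by (auto simp: norm_clifford_orbit)
  have "weighted_spherical_design 3 (orbit_measure M)"
  proof (rule weighted_spherical_design_3I)
    show "finite (set_pmf (orbit_measure M))" "set_pmf (orbit_measure M) \<subseteq> sphere 0 1"
      using set_pmf_mixture[OF mix, where x = "\<lambda>_. M"] finite_set_pmf_mixture[OF mix, where x = "\<lambda>_. M"] sub
      unfolding orbit_measure_eq_mixture by auto
    show "map_pmf uminus (orbit_measure M) = orbit_measure M"
      unfolding uminus_eq_mat_mult orbit_measure_eq_mixture by (rule map_pmf_mixture[OF mix clifford_scalars(4)])
  next
    fix A :: "'r vspace"
    let ?m = "real (card (clifford_orbit M))"
    obtain Y where Y: "Y \<in> E_space" "conj_transpose A ** A = mat (complex_of_real ((norm A)\<^sup>2 / 2)) + Y"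
      by (rule gram_decomposition)
    have "Re (trace (conj_transpose A ** A ** (conj_transpose M ** M))) = (norm A)\<^sup>2 / 2"
      unfolding Y(2) gram_eq_defect[of M] trace_mat_plus_E_space[OF Y(1) defect_E_space[OF assms(1)]]
      by (simp add: assms(2))
    then have "2 * ?n * (\<Sum>N\<in>clifford_orbit M. (A \<bullet> N)\<^sup>2) = ?m * ((norm A)\<^sup>2 / 2)"
      using sum_orbit_inner2[of A M] by simp
    moreover have pos: "?n > 0" "?m > 0" using card_clifford_orbit_pos by (auto simp: card_fun)
    ultimately have S: "(\<Sum>N\<in>clifford_orbit M. (A \<bullet> N)\<^sup>2) = ?m * (1 / (4 * ?n) * (norm A)\<^sup>2)"
      by (simp add: field_simps)
    have "measure_pmf.expectation (orbit_measure M) (\<lambda>N. (A \<bullet> N)\<^sup>2)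
        = 1 / ?m * (\<Sum>N\<in>clifford_orbit M. (A \<bullet> N)\<^sup>2)"
      unfolding orbit_measure_eq_mixture by (subst expectation_mixture) auto
    then show "measure_pmf.expectation (orbit_measure M) (\<lambda>N. (A \<bullet> N)\<^sup>2) = 1 / (4 * ?n) * (norm A)\<^sup>2"
      unfolding S using pos(2) by simp
  qed
  then have "weighted_spherical_design 2 (pmf_of_set (clifford_orbit M))"
    unfolding orbit_measure_def by (rule weighted_spherical_design_mono[rotated]) simp
  then show ?thesis
    using sub finite_clifford_orbit clifford_orbit_self by (auto simp: spherical_design_def)
qed

section \<open>Tetrahedral completions\<close>

lemma hermitian_inner_self: "hermitian_inner a a = complex_of_real ((norm a)\<^sup>2)"
proof -
  have "(norm a)\<^sup>2 = (\<Sum>i\<in>UNIV. (cmod (a $ i))\<^sup>2)"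
    by (simp add: norm_vec_def L2_set_def sum_nonneg)
  then show ?thesis
    unfolding hermitian_inner_def by (simp only: of_real_sum complex_norm_square mult.commute)
qed

lemma gram_outer:
  assumes "norm w = 1"
  shows "conj_transpose (outer w u) ** outer w u = outer u u"
proof -
  have "(conj_transpose (outer w u) ** outer w u) $ a $ b = u $ a * cnj (u $ b) * hermitian_inner w w" for a b
    unfolding gram_nth hermitian_inner_def sum_distrib_left
    by (intro sum.cong refl) (simp add: outer_def mult_ac)
  then show ?thesis
    by (simp add: vec_eq_iff hermitian_inner_self assms) (simp add: outer_def)
qed

lemma norm_outer:
  assumes "norm w = 1"
  shows "norm (outer w u) = norm u"
proof -
  have "complex_of_real ((norm (outer w u))\<^sup>2) = trace (outer u u)"
    by (simp only: trace_gram[symmetric] gram_outer[OF assms])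
  also have "\<dots> = hermitian_inner u u"
    by (simp add: trace_def outer_def hermitian_inner_def mult.commute)
  finally have "(norm (outer w u))\<^sup>2 = (norm u)\<^sup>2"
    by (simp only: hermitian_inner_self of_real_eq_iff)
  then show ?thesis by simp
qed

lemma defect_outer:
  assumes "norm w = 1"
  shows "sqrt 2 *\<^sub>R defect (outer w u) = bloch u" "defect (outer w u) = (1 / sqrt 2) *\<^sub>R bloch u"
  by (simp_all add: defect_def bloch_def gram_outer[OF assms])

text \<open>\<open>bloch u\<close> is a rescaled defect of the rank-one matrix
  \<open>outer u u\<close>. Its Gram determinant is zero, so the squared defect has the extremal
  value 1/2, which the factor \<open>sqrt 2\<close> normalizes to 1.\<close>

lemma bloch_unit:
  assumes "norm u = 1"
  shows "bloch u \<in> E_space" "bloch u \<bullet> bloch u = 1"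
proof -
  let ?Z = "defect (outer u u)"
  have Z: "?Z \<in> E_space" by (rule defect_E_space) (simp add: norm_outer assms)
  have b: "bloch u = sqrt 2 *\<^sub>R ?Z" by (simp add: defect_outer[OF assms])
  show "bloch u \<in> E_space" unfolding b by (rule subspace_scale[OF subspace_E_space Z])
  have "det (conj_transpose (outer u u) ** outer u u) = 0"
    unfolding gram_outer[OF assms] by (simp add: det_2 outer_def)
  then have "?Z \<bullet> ?Z = 1 / 2"
    using det_mat_plus_E_space[OF Z, of "1 / 2"] unfolding gram_eq_defect by (simp add: power_divide)
  moreover have "bloch u \<bullet> bloch u = (sqrt 2 * sqrt 2) * (?Z \<bullet> ?Z)" unfolding b by simp
  ultimately show "bloch u \<bullet> bloch u = 1" by simp
qed

lemma two_columns_balanced: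
  assumes "norm a = 1" "norm b = 1" "hermitian_inner a b = 0"
  shows "defect ((1 / sqrt 2) *\<^sub>R two_columns a b) = 0" "norm ((1 / sqrt 2) *\<^sub>R two_columns a b) = 1"
proof -
  let ?M = "(1 / sqrt 2) *\<^sub>R two_columns a b"
  have M: "?M $ x $ 1 = complex_of_real (1 / sqrt 2) * a $ x" "?M $ x $ 2 = complex_of_real (1 / sqrt 2) * b $ x" for x
    by (simp add: two_columns_def, simp add: scaleR_conv_of_real)+
  have s: "cnj (complex_of_real (1 / sqrt 2) * p) * (complex_of_real (1 / sqrt 2) * q) = 1 / 2 * (cnj p * q)" for p q
    using sqrt_half_sq by (simp add: mult_ac flip: mult.assoc)
  have "hermitian_inner b a = cnj (hermitian_inner a b)"
    by (simp add: hermitian_inner_def mult.commute)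
  then have h: "hermitian_inner b a = 0" using assms by simp
  have "conj_transpose ?M ** ?M = mat (1 / 2)"
    unfolding vec_eq_iff forall_2 gram_nth M s sum_distrib_left[symmetric] hermitian_inner_def[symmetric]
    by (simp add: mat_def h assms hermitian_inner_self)
  then show d: "defect ?M = 0" by (simp add: defect_def)
  have "complex_of_real ((norm ?M)\<^sup>2) = trace (mat (1 / 2) :: complex ^ 2 ^ 2)"
    using d by (simp only: trace_gram[symmetric] gram_eq_defect) simp
  also have "\<dots> = complex_of_real 1" by (simp add: trace_def mat_def sum_2)
  finally have "(norm ?M)\<^sup>2 = 1" by (simp only: of_real_eq_iff)
  then show "norm ?M = 1"
    unfolding power2_eq_1_iff using norm_ge_zero[of ?M] by linarith
qed

text \<open>The tetrahedron is a set of four points, so the four indices give distinct vertices, and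
  sums over the set become sums over indices.\<close>

lemma sum_bloch_tetrahedron:
  fixes u :: "nat \<Rightarrow> complex ^ 2"
  assumes unit: "\<forall>j\<in>{1..4}. norm (u j) = 1" and tetra: "regular_tetrahedron (bloch ` u ` {1..4})"
  shows "inj_on (\<lambda>j. bloch (u j)) {1..4}"
    and "(\<Sum>j=1..4. bloch (u j)) = 0"
    and "B \<in> E_space \<Longrightarrow> (\<Sum>j=1..4. (B \<bullet> bloch (u j)) * (C \<bullet> bloch (u j))) = 4 / 3 * (B \<bullet> C)"
proof -
  let ?T = "bloch ` u ` {1..4}"
  have T: "?T = (\<lambda>j. bloch (u j)) ` {1..4}" by auto
  have "card ?T = 4" using tetra by (simp add: regular_tetrahedron_def)
  then show inj: "inj_on (\<lambda>j. bloch (u j)) {1..4}"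
    unfolding T by (intro eq_card_imp_inj_on) auto
  have TE: "?T \<subseteq> E_space" "\<And>t. t \<in> ?T \<Longrightarrow> t \<bullet> t = 1"
    using unit bloch_unit by auto
  have frame: "\<Sum>?T = 0" "B \<in> E_space \<Longrightarrow> (\<Sum>t\<in>?T. (B \<bullet> t) *\<^sub>R t) = (4 / 3) *\<^sub>R B" for B
    by (rule regular_tetrahedron_frame[OF tetra subspace_E_space dim_E_space TE(1)]; use TE(2) in simp)+
  have sum: "(\<Sum>t\<in>?T. f t) = (\<Sum>j=1..4. f (bloch (u j)))" for f :: "complex ^ 2 ^ 2 \<Rightarrow> 'b::comm_monoid_add"
    unfolding T by (simp only: sum.reindex[OF inj] comp_def)
  show "(\<Sum>j=1..4. bloch (u j)) = 0" using frame(1) by (simp only: sum)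
  show "(\<Sum>j=1..4. (B \<bullet> bloch (u j)) * (C \<bullet> bloch (u j))) = 4 / 3 * (B \<bullet> C)" if "B \<in> E_space"
  proof -
    have "(\<Sum>j=1..4. (B \<bullet> bloch (u j)) * (C \<bullet> bloch (u j))) = C \<bullet> (\<Sum>t\<in>?T. (B \<bullet> t) *\<^sub>R t)"
      by (simp only: sum inner_sum_right inner_scaleR_right)
    then show ?thesis
      by (simp only: frame(2)[OF that] inner_scaleR_right inner_commute[of C B])
  qed
qed

lemma filterlim_two_power: "filterlim (\<lambda>r. 2 ^ (r + 2) :: nat) at_top sequentially"
proof (rule filterlim_at_top_mono[OF filterlim_ident])
  have "r \<le> 2 ^ (r + 2)" for r :: nat
    using less_exp[of "r + 2"] by linarith
  then show "\<forall>\<^sub>F r in sequentially. r \<le> 2 ^ (r + 2)" by simp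
qed

text \<open>Index 0 carries the balanced orbit, whose zero defect affects neither moment condition,
  and 1 to 4 carry the tetrahedral orbits. Their common weight is chosen to give the right
  second-order constant; the remaining mass 2(n - 1)/(2n + 1) goes to \<open>M0\<close>. The design
  property then follows from \<open>completion_design_5\<close>.\<close>

theorem corollary5p6:
  fixes e1 e2 w :: "('r::finite) qvec"
    and u :: "nat \<Rightarrow> complex ^ 2"
    and M0 :: "'r vspace" and C x :: "nat \<Rightarrow> 'r vspace"
    and v :: "nat \<Rightarrow> real"
    and \<mu> :: "'r vspace pmf"
  assumes "norm e1 = 1" and "norm e2 = 1" and "hermitian_inner e1 e2 = 0"
    and M0: "M0 = (1 / sqrt 2) *\<^sub>R two_columns e1 e2"
    and "\<forall>j\<in>{1..4}. norm (u j) = 1"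
    and "regular_tetrahedron (bloch ` u ` {1..4})"
    and "norm w = 1"
    and C: "C = (\<lambda>j. outer w (u j))"
    and x: "x = (\<lambda>j. if j = 0 then M0 else C j)"
    and v: "v = (\<lambda>j. if j = 0 then 2 * (2 ^ CARD('r) - 1) / (2 ^ (CARD('r) + 1) + 1)
                     else 3 / (4 * (2 ^ (CARD('r) + 1) + 1)))"
    and \<mu>: "\<mu> = orbit_mixture {0..4} v x"
  shows
    "(\<forall>N. pmf \<mu> N =
        2 * (2 ^ CARD('r) - 1) / (2 ^ (CARD('r) + 1) + 1) * pmf (orbit_measure M0) N
        + 3 / (4 * (2 ^ (CARD('r) + 1) + 1)) * (\<Sum>j=1..4. pmf (orbit_measure (C j)) N))
     \<and> (\<forall>g\<in>clifford_group. map_pmf (\<lambda>N. g ** N) \<mu> = \<mu>)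
     \<and> weighted_spherical_design 5 \<mu>
     \<and> is_completion {0..4} v x
     \<and> (\<forall>(I :: nat set) v' (x' :: nat \<Rightarrow> 'r vspace). is_completion I v' x' \<longrightarrow>
          3 / (2 ^ (CARD('r) + 1) + 1) \<le> correction_weight I v' x')
     \<and> correction_weight {0..4} v x = (2 + 1) / (2 * 2 ^ CARD('r) + 1)
     \<and> correction_weight {0..4} v x = 3 / (2 ^ (CARD('r) + 1) + 1)
     \<and> correction_orbits {0..4} x = (\<lambda>j. clifford_orbit (C j)) ` {1..4}
     \<and> card (correction_orbits {0..4} x) = 4
     \<and> (\<forall>(I :: nat set) v' (x' :: nat \<Rightarrow> 'r vspace). weight_optimal I v' x' \<longrightarrow>
          4 \<le> card (correction_orbits I x'))
     \<and> DIM('r vspace) = 2 ^ (CARD('r) + 2)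
     \<and> filterlim (\<lambda>r. 2 ^ (r + 2) :: nat) at_top sequentially
     \<and> dim E_space = 3
     \<and> (\<forall>j\<in>{1..4}. sqrt 2 *\<^sub>R defect (C j) = bloch (u j) \<and>
          bloch (u j) \<in> E_space \<and> E_inner (bloch (u j)) (bloch (u j)) = 1)
     \<and> regular_tetrahedron ((\<lambda>j. sqrt 2 *\<^sub>R defect (C j)) ` {1..4})"
proof -
  define n :: real where "n = 2 ^ CARD('r)"
  have n1: "1 < n" by (simp add: n_def)
  have unit: "norm (u j) = 1" if "j \<in> {1..4}" for j using assms(5) that by simp
  note tetra = sum_bloch_tetrahedron[OF assms(5,6)]
  have I: "{0..4::nat} = insert 0 {1..4}" by auto
  have sum_I: "(\<Sum>i\<in>{0..4}. f i) = f 0 + (\<Sum>j=1..4. f j)" for f :: "nat \<Rightarrow> 'b::comm_monoid_add"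
    unfolding I by (rule sum.insert) auto
  have x0: "x 0 = M0" and xj: "j \<in> {1..4} \<Longrightarrow> x j = C j" for j by (auto simp: x)
  have v0: "v 0 = 2 * (n - 1) / (2 * n + 1)" and vj: "j \<in> {1..4} \<Longrightarrow> v j = 3 / (4 * (2 * n + 1))" for j
    by (auto simp: v n_def)
  have M0': "norm M0 = 1" "defect M0 = 0"
    unfolding M0 by (simp_all only: two_columns_balanced[OF assms(1-3)])
  have dC: "sqrt 2 *\<^sub>R defect (C j) = bloch (u j)" "defect (C j) = (1 / sqrt 2) *\<^sub>R bloch (u j)" for j
    unfolding C by (rule defect_outer[OF assms(7)])+
  have nC: "norm (C j) = 1" if "j \<in> {1..4}" for j
    unfolding C by (simp only: norm_outer[OF assms(7)] unit[OF that])
  have dC0: "defect (C j) \<noteq> 0" if "j \<in> {1..4}" for j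
    using bloch_unit(2)[OF unit[OF that]] dC(1)[of j] by auto
  have v_pos: "0 < v i" if "i \<in> {0..4}" for i
    using that n1 v0 vj[of i] by (cases "i = 0") auto
  have v_sum: "(\<Sum>i\<in>{0..4}. v i) = 1"
  proof -
    have "(\<Sum>j=1..4. v j) = (\<Sum>j\<in>{1..4::nat}. 3 / (4 * (2 * n + 1)))" by (rule sum.cong[OF refl]) (rule vj)
    then show ?thesis using n1 unfolding sum_I v0 by (simp add: field_simps)
  qed
  have mix: "finite {0..4::nat}" "\<And>i. i \<in> {0..4} \<Longrightarrow> 0 < v i" "(\<Sum>i\<in>{0..4}. v i) = 1"
    using v_pos v_sum by auto
  have pmf_\<mu>: "pmf \<mu> N = (\<Sum>i\<in>{0..4}. v i * pmf (orbit_measure (x i)) N)" for N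
    unfolding \<mu> by (rule pmf_mixture[OF mix])
  have completion: "is_completion {0..4} v x"
    unfolding is_completion_def
  proof (intro conjI ballI)
    show "finite {0..4::nat}" "(\<Sum>i\<in>{0..4}. v i) = 1" by (auto simp: v_sum)
    show "0 < v i" if "i \<in> {0..4}" for i using that by (rule v_pos)
    show "x i \<in> sphere 0 1" if "i \<in> {0..4}" for i
      using that M0' nC x0 xj[of i] by (cases "i = 0") auto
    show "\<exists>i\<in>{0..4}. spherical_design 2 (clifford_orbit (x i))"
      by (rule bexI[of _ 0]) (simp_all add: x0 balanced_orbit_design_2 M0')
    have "(\<Sum>j=1..4. v j *\<^sub>R defect (x j)) = (3 / (4 * (2 * n + 1)) / sqrt 2) *\<^sub>R (\<Sum>j=1..4. bloch (u j))"
      unfolding scaleR_sum_right by (intro sum.cong refl) (simp add: vj xj dC(2))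
    then show "(\<Sum>i\<in>{0..4}. v i *\<^sub>R defect (x i)) = 0"
      unfolding sum_I x0 M0' tetra(2) by simp
  next
    fix B D assume BD: "B \<in> E_space" "D \<in> E_space"
    have s: "p * (1 / sqrt 2 * a) * (1 / sqrt 2 * b) = p / 2 * (a * b)" for p a b :: real
    proof -
      have "p * (1 / sqrt 2 * a) * (1 / sqrt 2 * b) = p * (a * b) * (1 / sqrt 2 * (1 / sqrt 2))"
        by (simp only: mult_ac)
      then show ?thesis by simp
    qed
    have "(\<Sum>j=1..4. v j * E_inner B (defect (x j)) * E_inner D (defect (x j)))
        = (\<Sum>j=1..4. 3 / (4 * (2 * n + 1)) / 2 * ((B \<bullet> bloch (u j)) * (D \<bullet> bloch (u j))))"
    proof (rule sum.cong[OF refl])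
      fix j :: nat assume j: "j \<in> {1..4}"
      show "v j * E_inner B (defect (x j)) * E_inner D (defect (x j))
        = 3 / (4 * (2 * n + 1)) / 2 * ((B \<bullet> bloch (u j)) * (D \<bullet> bloch (u j)))"
        by (simp only: vj[OF j] xj[OF j] dC(2) BD[THEN E_inner_eq_inner] inner_scaleR_right s)
    qed
    \<comment> \<open>Weight, squared scaling and frame constant combine to 3/(4(2n + 1)) * 1/2 *
      4/3 = 1/(2(2n + 1)).\<close>
    also have "\<dots> = 1 / (2 * (2 * n + 1)) * (B \<bullet> D)"
      unfolding sum_distrib_left[symmetric] tetra(3)[OF BD(1)] using n1 by (simp add: field_simps)
    finally show "(\<Sum>i\<in>{0..4}. v i * E_inner B (defect (x i)) * E_inner D (defect (x i)))
        = 1 / (2 * (real DIM('r qvec) + 1)) * E_inner B D"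
      unfolding sum_I x0 M0' DIM_qvec n_def[symmetric] by (simp add: E_inner_eq_inner BD)
  qed
  have corr: "{i \<in> {0..4}. defect (x i) \<noteq> 0} = {1..4}"
  proof -
    have "defect (x i) \<noteq> 0 \<longleftrightarrow> i \<in> {1..4}" if "i \<in> {0..4}" for i
      using that M0' dC0[of i] x0 xj[of i] by (cases "i = 0") auto
    then have "{i \<in> {0..4}. defect (x i) \<noteq> 0} = {i \<in> {0..4}. i \<in> {1..4}}"
      by (intro Collect_cong conj_cong refl)
    also have "\<dots> = {1..4}" by auto
    finally show ?thesis .
  qed
  have weight: "correction_weight {0..4} v x = 3 / (2 * n + 1)"
  proof -
    have "correction_weight {0..4} v x = (\<Sum>j\<in>{1..4::nat}. 3 / (4 * (2 * n + 1)))"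
      unfolding correction_weight_def corr by (rule sum.cong[OF refl]) (rule vj)
    then show ?thesis using n1 by (simp add: field_simps)
  qed
  have orbits: "correction_orbits {0..4} x = (\<lambda>j. clifford_orbit (C j)) ` {1..4}"
    unfolding correction_orbits_def corr using xj by (intro image_cong) auto
  have "inj_on (\<lambda>j. clifford_orbit (C j)) {1..4}"
  proof (rule inj_onI)
    fix i j assume ij: "i \<in> {1..4}" "j \<in> {1..4}" and "clifford_orbit (C i) = clifford_orbit (C j)"
    \<comment> \<open>Orbits are told apart by their defects, which here are four distinct
      vertices.\<close>
    then have "defect (C i) = defect (C j)"
      using clifford_orbit_self defect_clifford_orbit by blast
    then have "bloch (u i) = bloch (u j)" by (simp only: dC(1)[symmetric])
    then show "i = j" using tetra(1) ij by (auto dest: inj_onD)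
  qed
  then have card_orbits: "card (correction_orbits {0..4} x) = 4"
    unfolding orbits by (simp add: card_image)
  show ?thesis
  proof (intro conjI allI impI ballI)
    show "pmf \<mu> N = 2 * (2 ^ CARD('r) - 1) / (2 ^ (CARD('r) + 1) + 1) * pmf (orbit_measure M0) N
        + 3 / (4 * (2 ^ (CARD('r) + 1) + 1)) * (\<Sum>j=1..4. pmf (orbit_measure (C j)) N)" for N
      unfolding pmf_\<mu> sum_I sum_distrib_left by (simp add: x v)
    show "map_pmf (\<lambda>N. g ** N) \<mu> = \<mu>" if "g \<in> clifford_group" for g
      unfolding \<mu> by (rule map_pmf_mixture[OF mix that])
    show "weighted_spherical_design 5 \<mu>"
      unfolding \<mu> by (rule completion_design_5[OF completion])
    show "is_completion {0..4} v x" by (rule completion)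
    show "3 / (2 ^ (CARD('r) + 1) + 1) \<le> correction_weight J v' x'"
      if "is_completion J v' x'" for J :: "nat set" and v' and x' :: "nat \<Rightarrow> 'r vspace"
      using correction_weight_ge[OF that] by simp
    show "correction_weight {0..4} v x = (2 + 1) / (2 * 2 ^ CARD('r) + 1)"
      "correction_weight {0..4} v x = 3 / (2 ^ (CARD('r) + 1) + 1)"
      by (simp_all add: weight n_def)
    show "correction_orbits {0..4} x = (\<lambda>j. clifford_orbit (C j)) ` {1..4}" by (rule orbits)
    show "card (correction_orbits {0..4} x) = 4" by (rule card_orbits)
    show "4 \<le> card (correction_orbits J x')"
      if "weight_optimal J v' x'" for J :: "nat set" and v' and x' :: "nat \<Rightarrow> 'r vspace"
      using card_correction_orbits_ge[of J v' x'] that by (simp add: weight_optimal_def)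
    show "DIM('r vspace) = 2 ^ (CARD('r) + 2)" by (simp add: card_fun)
    show "filterlim (\<lambda>r. 2 ^ (r + 2) :: nat) at_top sequentially" by (rule filterlim_two_power)
    show "dim E_space = 3" by (rule dim_E_space)
    show "sqrt 2 *\<^sub>R defect (C j) = bloch (u j)" for j by (rule dC)
    show "bloch (u j) \<in> E_space" "E_inner (bloch (u j)) (bloch (u j)) = 1" if "j \<in> {1..4}" for j
      using bloch_unit[OF unit[OF that]] by (simp_all add: E_inner_eq_inner)
    have "(\<lambda>j. sqrt 2 *\<^sub>R defect (C j)) ` {1..4} = bloch ` u ` {1..4}"
      by (simp only: dC(1) image_image)
    then show "regular_tetrahedron ((\<lambda>j. sqrt 2 *\<^sub>R defect (C j)) ` {1..4})"
      using assms(6) by simp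
  qed
qed

end
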